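(* Let $\Gamma$ be a finite simple graph with vertex set $V=\{1,\dots,n\}$, and suppose $\Gamma$ is $K_4$-free (i.e. $\Gamma$ has no clique of cardinality four). Then the homomorphism $$\rho_{\mathcal X(\Gamma)}\colon P_\Gamma \longrightarrow \prod_{X\in\mathcal X(\Gamma)} P_X$$ is injective, where $\mathcal X(\Gamma)$ is the set of maximal cliques of $\Gamma$.
   Context: $B_n$ is the Artin braid group on $n$ strands with standard generators $\sigma_1,\dots,\sigma_{n-1}$, and $P_n\subseteq B_n$ is the pure braid group, generated by the Artin generators $a_{ij}=\sigma_{j-1}\cdots\sigma_{i+1}\sigma_i^2\sigma_{i+1}^{-1}\cdots\sigma_{j-1}^{-1}$, $1\le i<j\le n$. For a finite simple graph $\Gamma$ with vertex set $V=\{1,\dots,n\}$ and edge set $E_\Gamma\subseteq\binom{V}{2}$, the graphic pure braid group $P_\Gamma$ is the quotient of $P_n$ by the normal closure of $\{a_{ij}\mid i<j,\ \{i,j\}\notin E_\Gamma\}$ (equivalently, $P_\Gamma\cong\pi_1(\mathbb C^n\setminus\bigcup_{\{i,j\}\in E_\Gamma}\{x_i=x_j\})$). The image of $a_{ij}$ in $P_\Gamma$ is again denoted $a_{ij}$. For $X\subseteq V$, $\Gamma_X$ is the induced subgraph on $X$, $P_{\Gamma_X}$ is defined in the same way (relabelling the vertices in an order-preserving way), and $\rho_X\colon P_\Gamma\to P_{\Gamma_X}$ is the quotient map sending $a_{ij}$ to $a_{ij}$ if $\{i,j\}\subseteq X$ and to $1$ otherwise. A subset $X\subseteq V$ is a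 clique if $\binom{X}{2}\subseteq E_\Gamma$; in that case $P_{\Gamma_X}\cong P_{|X|}$ is denoted $P_X$. For a family $\mathcal X$ of cliques, $\rho_{\mathcal X}=\prod_{X\in\mathcal X}\rho_X\colon P_\Gamma\to\prod_{X\in\mathcal X}P_X$. *)

theory Defs
  imports "HOL-Algebra.Sym_Groups" "HOL-Algebra.Product_Groups" "HOL-Library.Ramsey"
begin

section \<open>Groups given by generators and relations\<close>

text \<open>A word is a list of signed letters: \<open>(True, x)\<close> stands for \<open>x\<close> and
  \<open>(False, x)\<close> for the inverse of \<open>x\<close>.  A relation \<open>(u, v)\<close> is read \<open>u = v\<close>.\<close>

type_synonym 'a word = "(bool \<times> 'a) list"

definition words :: "'a set \<Rightarrow> 'a word set" where
  "words S = lists (UNIV \<times> S)"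

inductive_set word_rel :: "'a set \<Rightarrow> ('a word \<times> 'a word) set \<Rightarrow> ('a word \<times> 'a word) set"
  for S R where
  refl: "w \<in> words S \<Longrightarrow> (w, w) \<in> word_rel S R"
| sym: "(u, v) \<in> word_rel S R \<Longrightarrow> (v, u) \<in> word_rel S R"
| trans: "(u, v) \<in> word_rel S R \<Longrightarrow> (v, w) \<in> word_rel S R \<Longrightarrow> (u, w) \<in> word_rel S R"
| append: "(u, u') \<in> word_rel S R \<Longrightarrow> (v, v') \<in> word_rel S R \<Longrightarrow> (u @ v, u' @ v') \<in> word_rel S R"
| cancel: "x \<in> S \<Longrightarrow> ([(b, x), (\<not> b, x)], []) \<in> word_rel S R"
| relation: "(u, v) \<in> R \<Longrightarrow> u \<in> words S \<Longrightarrow> v \<in> words S \<Longrightarrow> (u, v) \<in> word_rel S R"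

definition presented_group :: "'a set \<Rightarrow> ('a word \<times> 'a word) set \<Rightarrow> 'a word set monoid" where
  "presented_group S R =
    \<lparr>carrier = words S // word_rel S R,
     mult = (\<lambda>A B. \<Union>u\<in>A. \<Union>v\<in>B. word_rel S R `` {u @ v}),
     one = word_rel S R `` {[]}\<rparr>"

lemma word_rel_in_words:
  assumes "(u, v) \<in> word_rel S R" shows "u \<in> words S \<and> v \<in> words S"
  using assms by induction (auto simp: words_def)

lemma equiv_word_rel: "equiv (words S) (word_rel S R)"
proof (rule equivI)
  show "word_rel S R \<subseteq> words S \<times> words S" using word_rel_in_words by fastforce
  show "refl_on (words S) (word_rel S R)" by (auto simp: refl_on_def intro: word_rel.refl)
  show "sym (word_rel S R)" by (auto simp: sym_def intro: word_rel.sym)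
  show "trans (word_rel S R)" by (meson trans_def word_rel.trans)
qed

lemma mult_presented_group:
  assumes "u \<in> words S" "v \<in> words S"
  shows "word_rel S R `` {u} \<otimes>\<^bsub>presented_group S R\<^esub> word_rel S R `` {v} = word_rel S R `` {u @ v}"
proof -
  have inner: "(\<Union>v'\<in>word_rel S R `` {v}. word_rel S R `` {u' @ v'}) = word_rel S R `` {u @ v}"
    if u': "u' \<in> word_rel S R `` {u}" for u'
  proof (intro UN_constant_eq ballI)
    show "v \<in> word_rel S R `` {v}" using assms by (simp add: word_rel.refl)
    fix v' assume "v' \<in> word_rel S R `` {v}"
    then have "(u @ v, u' @ v') \<in> word_rel S R" using u' by (simp add: word_rel.append)
    then show "word_rel S R `` {u' @ v'} = word_rel S R `` {u @ v}"
      using equiv_class_eq[OF equiv_word_rel] by metis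
  qed
  have "u \<in> word_rel S R `` {u}" using assms by (simp add: word_rel.refl)
  then have "(\<Union>u'\<in>word_rel S R `` {u}. \<Union>v'\<in>word_rel S R `` {v}. word_rel S R `` {u' @ v'})
      = word_rel S R `` {u @ v}"
    by (rule UN_constant_eq) (simp add: inner del: Image_singleton_iff)
  then show ?thesis by (simp add: presented_group_def)
qed

lemma word_rel_cancel_left:
  assumes "w \<in> words S"
  shows "(rev (map (\<lambda>(b, x). (\<not> b, x)) w) @ w, []) \<in> word_rel S R"
  using assms
proof (induction w)
  case Nil
  then show ?case by (auto simp: words_def intro: word_rel.refl)
next
  case (Cons a w)
  obtain b x where a: "a = (b, x)" by force
  have w: "w \<in> words S" and x: "x \<in> S" using Cons.prems a by (auto simp: words_def)
  let ?r = "rev (map (\<lambda>(b, x). (\<not> b, x)) w)"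
  have r: "?r \<in> words S" using w by (auto simp: words_def lists_eq_set)
  have "([(\<not> b, x), (\<not> \<not> b, x)], []) \<in> word_rel S R" by (rule word_rel.cancel[OF x])
  then have "([(\<not> b, x), (b, x)], []) \<in> word_rel S R" by simp
  then have "(?r @ [(\<not> b, x), (b, x)] @ w, ?r @ [] @ w) \<in> word_rel S R"
    using r w by (intro word_rel.append word_rel.refl)
  then show ?case using Cons.IH[OF w] a by (auto intro: word_rel.trans)
qed

lemma group_presented_group: "group (presented_group S R)"
proof (rule groupI)
  note c = presented_group_def[of S R]
  have nil: "[] \<in> words S" by (simp add: words_def)
  show "\<one>\<^bsub>presented_group S R\<^esub> \<in> carrier (presented_group S R)"
    using nil by (auto simp: c quotientI)
  fix A assume "A \<in> carrier (presented_group S R)"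
  then obtain u where u: "u \<in> words S" "A = word_rel S R `` {u}" by (auto simp: c elim: quotientE)
  show "\<one>\<^bsub>presented_group S R\<^esub> \<otimes>\<^bsub>presented_group S R\<^esub> A = A"
    using mult_presented_group[OF nil u(1), of R] u by (simp add: c)
  let ?r = "rev (map (\<lambda>(b, x). (\<not> b, x)) u)"
  have r: "?r \<in> words S" using u by (auto simp: words_def lists_eq_set)
  have "word_rel S R `` {?r} \<otimes>\<^bsub>presented_group S R\<^esub> A = \<one>\<^bsub>presented_group S R\<^esub>"
    using mult_presented_group[OF r u(1), of R] u
      equiv_class_eq[OF equiv_word_rel word_rel_cancel_left[OF u(1)], of R] by (simp add: c)
  then show "\<exists>B\<in>carrier (presented_group S R). B \<otimes>\<^bsub>presented_group S R\<^esub> A = \<one>\<^bsub>presented_group S R\<^esub>"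
    using r quotientI[OF r, of "word_rel S R"] by (intro bexI[of _ "word_rel S R `` {?r}"]) (simp_all add: c)
  fix B assume "B \<in> carrier (presented_group S R)"
  then obtain v where v: "v \<in> words S" "B = word_rel S R `` {v}" by (auto simp: c elim: quotientE)
  have uv: "u @ v \<in> words S" using u v by (auto simp: words_def)
  show "A \<otimes>\<^bsub>presented_group S R\<^esub> B \<in> carrier (presented_group S R)"
    using mult_presented_group[OF u(1) v(1), of R] u v uv by (auto simp: c quotientI)
  fix C assume "C \<in> carrier (presented_group S R)"
  then obtain w where w: "w \<in> words S" "C = word_rel S R `` {w}" by (auto simp: c elim: quotientE)
  have vw: "v @ w \<in> words S" using w v by (auto simp: words_def)
  show "A \<otimes>\<^bsub>presented_group S R\<^esub> B \<otimes>\<^bsub>presented_group S R\<^esub> C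
      = A \<otimes>\<^bsub>presented_group S R\<^esub> (B \<otimes>\<^bsub>presented_group S R\<^esub> C)"
    by (simp add: u(2) v(2) w(2) mult_presented_group u(1) v(1) w(1) uv vw)
qed


section \<open>Braid groups and pure braid groups\<close>

definition braid_relations :: "(nat word \<times> nat word) set" where
  "braid_relations =
    {([(True, i), (True, j)], [(True, j), (True, i)]) | i j. Suc i < j} \<union>
    {([(True, i), (True, Suc i), (True, i)], [(True, Suc i), (True, i), (True, Suc i)]) | i. True}"

definition braid_group :: "nat \<Rightarrow> nat word set monoid" where
  "braid_group n = presented_group {1..<n} braid_relations"

definition braid_of_word :: "nat \<Rightarrow> nat word \<Rightarrow> nat word set" where
  "braid_of_word n w = word_rel {1..<n} braid_relations `` {w}"

text \<open>The projection to the symmetric group sends the \<open>i\<close>-th standard generator and its inverse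
  to the transposition of \<open>i\<close> and \<open>i + 1\<close>; all words in one class have the same image.\<close>

definition word_perm :: "nat word \<Rightarrow> nat \<Rightarrow> nat" where
  "word_perm w = foldr (\<lambda>(b, i) p. transpose i (Suc i) \<circ> p) w id"

definition braid_perm :: "nat word set \<Rightarrow> nat \<Rightarrow> nat" where
  "braid_perm B = the_elem (word_perm ` B)"

definition pure_braid_group :: "nat \<Rightarrow> nat word set monoid" where
  "pure_braid_group n =
    (braid_group n)\<lparr>carrier := kernel (braid_group n) (sym_group n) braid_perm\<rparr>"

definition artin_word :: "nat \<Rightarrow> nat \<Rightarrow> nat word" where
  "artin_word i j =
    map (Pair True) (rev [Suc i..<j]) @ [(True, i), (True, i)] @ map (Pair False) [Suc i..<j]"

definition artin_gen :: "nat \<Rightarrow> nat \<Rightarrow> nat \<Rightarrow> nat word set" where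
  "artin_gen n i j = braid_of_word n (artin_word i j)"

lemma group_braid_group: "group (braid_group n)"
  by (simp add: braid_group_def group_presented_group)

lemma word_perm_append: "word_perm (u @ v) = word_perm u \<circ> word_perm v"
  by (induction u) (auto simp: word_perm_def o_assoc)

lemma word_perm_Nil: "word_perm [] = id"
  by (simp add: word_perm_def)

lemma word_perm_Cons: "word_perm ((b, i) # w) = transpose i (Suc i) \<circ> word_perm w"
  by (simp add: word_perm_def)

lemma word_perm_relation:
  assumes "(u, v) \<in> braid_relations" shows "word_perm u = word_perm v"
  using assms
  by (auto simp: braid_relations_def word_perm_Cons word_perm_Nil fun_eq_iff transpose_def)

lemma word_perm_cong:
  assumes "(u, v) \<in> word_rel S braid_relations" shows "word_perm u = word_perm v"
  using assms
  by induction (auto simp: word_perm_append word_perm_relation word_perm_Cons word_perm_Nil)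

lemma braid_perm_of_word:
  assumes "w \<in> words {1..<n}" shows "braid_perm (braid_of_word n w) = word_perm w"
proof -
  have "word_perm ` braid_of_word n w = {word_perm w}"
    using word_rel.refl[OF assms, of braid_relations]
    unfolding braid_of_word_def by (force dest: word_perm_cong)
  then show ?thesis by (simp add: braid_perm_def)
qed

lemma word_perm_permutes:
  assumes "w \<in> words {1..<n}" shows "word_perm w permutes {1..n}"
  using assms
proof (induction w)
  case Nil
  then show ?case unfolding word_perm_Nil by (intro permutes_id)
next
  case (Cons a w)
  obtain b x where a: "a = (b, x)" by force
  have w: "w \<in> words {1..<n}" and x: "x \<in> {1..<n}" using Cons.prems a by (auto simp: words_def)
  have "transpose x (Suc x) permutes {1..n}" using x by (intro permutes_swap_id) auto
  then show ?case unfolding a word_perm_Cons by (intro permutes_compose Cons.IH[OF w])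
qed

lemma braid_perm_hom: "braid_perm \<in> hom (braid_group n) (sym_group n)"
proof (rule homI)
  note c = braid_group_def presented_group_def
  fix A assume "A \<in> carrier (braid_group n)"
  then obtain u where u: "u \<in> words {1..<n}" "A = braid_of_word n u"
    by (auto simp: c braid_of_word_def elim: quotientE)
  show "braid_perm A \<in> carrier (sym_group n)"
    using word_perm_permutes[OF u(1)] u by (simp add: braid_perm_of_word sym_group_carrier)
  fix B assume "B \<in> carrier (braid_group n)"
  then obtain v where v: "v \<in> words {1..<n}" "B = braid_of_word n v"
    by (auto simp: c braid_of_word_def elim: quotientE)
  have uv: "u @ v \<in> words {1..<n}" using u v by (auto simp: words_def)
  have "A \<otimes>\<^bsub>braid_group n\<^esub> B = braid_of_word n (u @ v)"
    using mult_presented_group[OF u(1) v(1)] u v by (simp add: braid_group_def braid_of_word_def)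
  then show "braid_perm (A \<otimes>\<^bsub>braid_group n\<^esub> B) = braid_perm A \<otimes>\<^bsub>sym_group n\<^esub> braid_perm B"
    using u v uv by (simp add: braid_perm_of_word word_perm_append sym_group_mult)
qed

lemma group_hom_braid_perm: "group_hom (braid_group n) (sym_group n) braid_perm"
  by (simp add: group_hom_def group_hom_axioms_def group_braid_group sym_group_is_group braid_perm_hom)

lemma group_pure_braid_group: "group (pure_braid_group n)"
  unfolding pure_braid_group_def
  by (intro subgroup.subgroup_is_group group_hom.subgroup_kernel group_hom_braid_perm group_braid_group)

lemma word_perm_conj:
  "word_perm (map (Pair True) (rev xs)) \<circ> word_perm (map (Pair False) xs) = id"
proof (induction xs)
  case Nil
  then show ?case by (simp add: word_perm_Nil)
next
  case (Cons x xs)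
  have "word_perm (map (Pair True) (rev xs)) (word_perm (map (Pair False) xs) y) = y" for y
    using Cons.IH by (metis comp_apply id_apply)
  then show ?case
    by (simp add: fun_eq_iff word_perm_append word_perm_Cons word_perm_Nil)
qed

lemma artin_gen_in_pure_braid_group:
  assumes "1 \<le> i" "i < j" "j \<le> n"
  shows "artin_gen n i j \<in> carrier (pure_braid_group n)"
proof -
  have w: "artin_word i j \<in> words {1..<n}"
    using assms by (auto simp: artin_word_def words_def lists_eq_set)
  have "word_perm [(True, i), (True, i)] = id" by (simp add: word_perm_Cons word_perm_Nil)
  then have "word_perm (artin_word i j) = id"
    by (simp add: artin_word_def word_perm_append word_perm_conj del: append.simps)
  then show ?thesis
    using w by (auto simp: pure_braid_group_def kernel_def artin_gen_def braid_perm_of_word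
        sym_group_one braid_group_def presented_group_def braid_of_word_def[symmetric])
      (simp add: braid_of_word_def quotientI)
qed


section \<open>Graphic pure braid groups\<close>

definition normal_closure :: "('a, 'b) monoid_scheme \<Rightarrow> 'a set \<Rightarrow> 'a set" where
  "normal_closure G A = \<Inter>{N. N \<lhd> G \<and> A \<subseteq> N}"

text \<open>A simple graph with vertex set \<open>{1..n}\<close> is given by its set of edges, a subset
  of the set of two-element subsets of \<open>{1..n}\<close>.\<close>

definition non_edge_subgroup :: "nat \<Rightarrow> nat set set \<Rightarrow> nat word set set" where
  "non_edge_subgroup n E = normal_closure (pure_braid_group n)
    {artin_gen n i j | i j. 1 \<le> i \<and> i < j \<and> j \<le> n \<and> {i, j} \<notin> E}"

definition graphic_pure_braid_group :: "nat \<Rightarrow> nat set set \<Rightarrow> nat word set set monoid" where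
  "graphic_pure_braid_group n E = pure_braid_group n Mod non_edge_subgroup n E"

definition graphic_gen :: "nat \<Rightarrow> nat set set \<Rightarrow> nat \<Rightarrow> nat \<Rightarrow> nat word set set" where
  "graphic_gen n E i j = non_edge_subgroup n E #>\<^bsub>pure_braid_group n\<^esub> artin_gen n i j"

lemma normal_closure_normal:
  assumes "group G" "A \<subseteq> carrier G"
  shows "normal_closure G A \<lhd> G"
proof -
  interpret group G by fact
  have G: "carrier G \<lhd> G" by (rule normal_self)
  have sub: "subgroup (normal_closure G A) G"
    unfolding normal_closure_def using G assms(2)
    by (intro subgroups_Inter) (auto intro: normal_imp_subgroup)
  show ?thesis
    unfolding normal_inv_iff using sub
    by (auto simp: normal_closure_def normal_inv_iff)
qed

lemma non_edge_subgroup_normal: "non_edge_subgroup n E \<lhd> pure_braid_group n"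
  unfolding non_edge_subgroup_def
  by (intro normal_closure_normal group_pure_braid_group) (auto intro: artin_gen_in_pure_braid_group)

lemma group_graphic_pure_braid_group: "group (graphic_pure_braid_group n E)"
  unfolding graphic_pure_braid_group_def
  by (intro normal.factorgroup_is_group non_edge_subgroup_normal)

lemma graphic_gen_in_carrier:
  assumes "1 \<le> i" "i < j" "j \<le> n"
  shows "graphic_gen n E i j \<in> carrier (graphic_pure_braid_group n E)"
  using artin_gen_in_pure_braid_group[OF assms]
  by (auto simp: graphic_gen_def graphic_pure_braid_group_def FactGroup_def RCOSETS_def)


section \<open>Restriction to induced subgraphs\<close>

text \<open>\<open>rank X\<close> restricts to the order-preserving bijection from a finite set \<open>X\<close>
  onto \<open>{1..card X}\<close>; the induced subgraph on \<open>X\<close> is transported along it.\<close>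

definition rank :: "nat set \<Rightarrow> nat \<Rightarrow> nat" where
  "rank X i = card {k \<in> X. k \<le> i}"

definition induced_graph :: "nat set set \<Rightarrow> nat set \<Rightarrow> nat set set" where
  "induced_graph E X = (\<lambda>e. rank X ` e) ` {e \<in> E. e \<subseteq> X}"

definition induced_group :: "nat set set \<Rightarrow> nat set \<Rightarrow> nat word set set monoid" where
  "induced_group E X = graphic_pure_braid_group (card X) (induced_graph E X)"

text \<open>The map \<open>\<rho>\<^sub>X\<close> is pinned down by its values on the generators; it is made extensional
  so that it is unique as a function.\<close>

definition restriction_hom :: "nat \<Rightarrow> nat set set \<Rightarrow> nat set \<Rightarrow> nat word set set \<Rightarrow> nat word set set"
  where "restriction_hom n E X =
    (THE h. h \<in> hom (graphic_pure_braid_group n E) (induced_group E X) \<and>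
       h \<in> extensional (carrier (graphic_pure_braid_group n E)) \<and>
       (\<forall>i j. 1 \<le> i \<and> i < j \<and> j \<le> n \<longrightarrow>
          h (graphic_gen n E i j) =
            (if {i, j} \<subseteq> X
             then graphic_gen (card X) (induced_graph E X) (rank X i) (rank X j)
             else \<one>\<^bsub>induced_group E X\<^esub>)))"

definition restriction_prod ::
    "nat \<Rightarrow> nat set set \<Rightarrow> nat set set \<Rightarrow> nat word set set \<Rightarrow> nat set \<Rightarrow> nat word set set"
  where "restriction_prod n E \<X> g = (\<lambda>X\<in>\<X>. restriction_hom n E X g)"

definition max_cliques :: "nat \<Rightarrow> nat set set \<Rightarrow> nat set set" where
  "max_cliques n E =
    {X. X \<subseteq> {1..n} \<and> clique X E \<and> (\<forall>Y. Y \<subseteq> {1..n} \<and> clique Y E \<and> X \<subseteq> Y \<longrightarrow> Y = X)}"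

end

theory Submission
  imports Defs "HOL-Algebra.Bij" "HOL-Algebra.FiniteProduct"
begin

text \<open>
  Write \<open>a\<^sub>e\<close> for the generator of \<open>P\<^sub>\<Gamma>\<close> that belongs to the edge \<open>e\<close>.
  The absence of 4-cliques leaves very few relations.  For four strands, each pure braid
  relation between two generators with disjoint index pairs says that they commute, possibly
  after conjugating one of them by a third generator, and this third generator can be any of the
  four remaining ones.  One of the six pairs is not an edge, so in \<open>P\<^sub>\<Gamma>\<close> the
  relation becomes a plain commutation.  For three strands the product
  \<open>a\<^sub>i\<^sub>j a\<^sub>i\<^sub>k a\<^sub>j\<^sub>k\<close> is central in the subgroup
  that the three generate, which is again a commutation as soon as one factor is trivial.
  Hence \<open>a\<^sub>e\<close> and \<open>a\<^sub>f\<close> commute unless \<open>e\<close> and \<open>f\<close>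
  lie in a common triangle (\<open>A_commute_if_no_triangle\<close>).

  For a triangle \<open>T\<close> let \<open>H T\<close> be the subgroup generated by its three edges and
  \<open>D T\<close> the commutator subgroup of \<open>H T\<close>.  Because of the central product, two edges of
  \<open>T\<close>, chosen at will, already have \<open>D T\<close> as commutator subgroup
  (\<open>D_two_edges\<close>).  An edge that is not contained in \<open>T\<close> commutes with two of the
  edges of \<open>T\<close>, since otherwise there would be a 4-clique; so it centralises
  \<open>D T\<close> (\<open>A_centralises_D\<close>).  It follows that the groups \<open>D T\<close> are normal and
  commute with each other, and that \<open>P\<^sub>\<Gamma>\<close> is abelian modulo their product \<open>N\<close>.

  Let \<open>x\<close> be in the kernel of all restrictions to maximal cliques.  Every edge lies in a
  maximal clique \<open>X\<close>, and the exponent sum of \<open>a\<^sub>e\<close> in \<open>x\<close>, which is a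
  linking number, can be computed from \<open>\<rho>\<^sub>X x\<close>; so all exponent sums vanish and
  \<open>x \<in> N\<close> (\<open>word_eval_in_N\<close>).  Thus \<open>x\<close> is a product of elements
  \<open>d\<^sub>T \<in> D T\<close>.  Triangles are maximal cliques, and \<open>\<rho>\<^sub>T\<close> kills \<open>D T'\<close> for
  \<open>T' \<noteq> T\<close> because at most one edge of \<open>T'\<close> survives; therefore
  \<open>\<rho>\<^sub>T d\<^sub>T = 1\<close>.  Finally \<open>\<rho>\<^sub>T\<close> is injective on \<open>D T\<close>
  (\<open>rho_injective_on_D\<close>): it maps two of the edges to \<open>\<sigma>\<^sub>1\<^sup>2\<close> and
  \<open>\<sigma>\<^sub>2\<^sup>2\<close>, which generate a free group by a ping-pong argument for shears of
  the integer lattice.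

  About braid groups this uses that the Artin generators generate the pure braid group
  (\<open>pure_braid_group_generated\<close>, from a normal form for words in the symmetric group), that
  they satisfy the relations above (proved for adjacent strands and carried to all others by
  conjugation), and that the restrictions exist (\<open>restriction_hom_spec\<close>, by deleting strands
  from braid words).
\<close>

section \<open>Evaluation of words in a group\<close>

definition word_eval :: "('g, 'm) monoid_scheme \<Rightarrow> ('a \<Rightarrow> 'g) \<Rightarrow> 'a word \<Rightarrow> 'g" where
  "word_eval G f w = foldr (\<lambda>(b, x) y. (if b then f x else inv\<^bsub>G\<^esub> f x) \<otimes>\<^bsub>G\<^esub> y) w \<one>\<^bsub>G\<^esub>"

lemma word_eval_Nil [simp]: "word_eval G f [] = \<one>\<^bsub>G\<^esub>"
  by (simp add: word_eval_def)

lemma word_eval_Cons [simp]: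
  "word_eval G f ((b, x) # w) = (if b then f x else inv\<^bsub>G\<^esub> f x) \<otimes>\<^bsub>G\<^esub> word_eval G f w"
  by (simp add: word_eval_def)

lemma words_Nil [simp]: "[] \<in> words S"
  by (simp add: words_def)

lemma words_Cons [simp]: "(b, x) # w \<in> words S \<longleftrightarrow> x \<in> S \<and> w \<in> words S"
  by (auto simp: words_def)

lemma words_append [simp]: "u @ v \<in> words S \<longleftrightarrow> u \<in> words S \<and> v \<in> words S"
  by (auto simp: words_def)

lemma words_mono: "S \<subseteq> T \<Longrightarrow> w \<in> words S \<Longrightarrow> w \<in> words T"
  by (auto simp: words_def lists_eq_set)

lemma words_map_Pair [simp]: "map (Pair b) xs \<in> words S \<longleftrightarrow> set xs \<subseteq> S"
  by (auto simp: words_def lists_eq_set)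

lemma word_eval_cong:
  assumes "w \<in> words S" "\<And>x. x \<in> S \<Longrightarrow> f x = g x"
  shows "word_eval G f w = word_eval G g w"
  using assms(1) by (induction w) (auto simp: assms(2))

context group
begin

text \<open>Together with associativity and the rule for the inverse of a product, these rules let the
  simplifier decide identities that hold in every group.\<close>

lemma inv_mult_cancel [simp]:
  assumes "x \<in> carrier G" "y \<in> carrier G"
  shows "inv x \<otimes> (x \<otimes> y) = y" "x \<otimes> (inv x \<otimes> y) = y"
  using assms by (simp_all add: m_assoc [symmetric])

lemma word_eval_closed [simp]:
  assumes "f \<in> S \<rightarrow> carrier G" "w \<in> words S"
  shows "word_eval G f w \<in> carrier G"
  using assms(2,1) by (induction w) (auto simp: Pi_iff)

lemma word_eval_append:
  assumes "f \<in> S \<rightarrow> carrier G" "u \<in> words S" "v \<in> words S"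
  shows "word_eval G f (u @ v) = word_eval G f u \<otimes> word_eval G f v"
  using assms(2)
proof (induction u)
  case Nil
  then show ?case using assms by simp
next
  case (Cons a u)
  obtain b x where a: "a = (b, x)" by force
  have x: "x \<in> S" "u \<in> words S" using Cons.prems a by auto
  have "f x \<in> carrier G" "word_eval G f u \<in> carrier G" "word_eval G f v \<in> carrier G"
    using assms x by auto
  then show ?case using a x Cons.IH by (auto simp: m_assoc)
qed

lemma word_eval_word_rel:
  assumes f: "f \<in> S \<rightarrow> carrier G"
    and R: "\<And>u v. (u, v) \<in> R \<Longrightarrow> u \<in> words S \<Longrightarrow> v \<in> words S \<Longrightarrow> word_eval G f u = word_eval G f v"
    and "(u, v) \<in> word_rel S R"
  shows "word_eval G f u = word_eval G f v"
  using assms(3)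
proof induction
  case (append u u' v v')
  then show ?case
    using word_eval_append[OF f] word_rel_in_words by metis
next
  case (cancel x b)
  then have "f x \<in> carrier G" using f by auto
  then show ?case by auto
next
  case (relation u v)
  then show ?case by (rule R)
qed simp_all

lemma generate_eq_word_eval:
  assumes f: "f \<in> S \<rightarrow> carrier G"
  shows "generate G (f ` S) = word_eval G f ` words S"
proof
  show "generate G (f ` S) \<subseteq> word_eval G f ` words S"
  proof
    fix g assume "g \<in> generate G (f ` S)"
    then show "g \<in> word_eval G f ` words S"
    proof induction
      case one
      show ?case by (rule image_eqI[of _ _ "[]"]) auto
    next
      case (incl h)
      then obtain x where "x \<in> S" "h = f x" by auto
      then show ?case using f by (intro image_eqI[of _ _ "[(True, x)]"]) (auto simp: Pi_iff)
    next
      case (inv h)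
      then obtain x where "x \<in> S" "h = f x" by auto
      then show ?case using f by (intro image_eqI[of _ _ "[(False, x)]"]) (auto simp: Pi_iff)
    next
      case (eng g h)
      then obtain u v where "u \<in> words S" "v \<in> words S" "g = word_eval G f u" "h = word_eval G f v"
        by auto
      then show ?case using word_eval_append[OF f] by (intro image_eqI[of _ _ "u @ v"]) auto
    qed
  qed
  show "word_eval G f ` words S \<subseteq> generate G (f ` S)"
  proof (rule image_subsetI)
    fix w assume "w \<in> words S"
    then show "word_eval G f w \<in> generate G (f ` S)"
    proof (induction w)
      case (Cons a w)
      then show ?case
        by (cases a) (auto intro: generate.eng[OF generate.incl] generate.eng[OF generate.inv])
    qed (simp add: generate.one)
  qed
qed

end

lemma (in group_hom) hom_word_eval:
  assumes "f \<in> S \<rightarrow> carrier G" "w \<in> words S"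
  shows "h (word_eval G f w) = word_eval H (\<lambda>x. h (f x)) w"
  using assms(2)
proof (induction w)
  case (Cons a w)
  obtain b x where a: "a = (b, x)" by force
  then have x: "x \<in> S" "w \<in> words S" using Cons.prems by auto
  have c: "f x \<in> carrier G" "word_eval G f w \<in> carrier G"
    using assms x by auto
  then show ?case using a Cons.IH x by auto
qed simp

text \<open>This is what makes a homomorphism unique once its values on generators are prescribed.\<close>

lemma (in group_hom) hom_eq_on_generate:
  assumes k: "k \<in> hom G H" and S: "S \<subseteq> carrier G" and eq: "\<And>x. x \<in> S \<Longrightarrow> h x = k x"
    and g: "g \<in> generate G S"
  shows "h g = k g"
proof -
  interpret k: group_hom G H k
    by (unfold_locales) (rule k)
  show ?thesis using g
  proof induction
    case (inv x)
    then show ?case using S eq by (metis hom_inv k.hom_inv subsetD)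
  next
    case (eng x y)
    then show ?case using G.generate_in_carrier[OF S] by simp
  qed (auto simp: eq)
qed

text \<open>Transfers statements about words to statements about products of the generators, where the
  group axioms are available.\<close>

lemma presented_group_class:
  assumes "w \<in> words S"
  shows "word_rel S R `` {w}
    = word_eval (presented_group S R) (\<lambda>x. word_rel S R `` {[(True, x)]}) w"
  using assms
proof (induction w)
  case Nil
  then show ?case by (simp add: presented_group_def)
next
  case (Cons a w)
  interpret group "presented_group S R" by (rule group_presented_group)
  obtain b x where a: "a = (b, x)" by force
  then have x: "x \<in> S" "w \<in> words S" using Cons.prems by auto
  have c: "word_rel S R `` {u} \<in> carrier (presented_group S R)" if "u \<in> words S" for u
    using that by (auto simp: presented_group_def quotientI)
  have "word_rel S R `` {[(False, x)]} \<otimes>\<^bsub>presented_group S R\<^esub> word_rel S R `` {[(True, x)]}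
      = \<one>\<^bsub>presented_group S R\<^esub>"
    using x equiv_class_eq[OF equiv_word_rel word_rel.cancel[of x S False R]]
    by (simp add: mult_presented_group) (simp add: presented_group_def)
  then have i: "inv\<^bsub>presented_group S R\<^esub> (word_rel S R `` {[(True, x)]}) = word_rel S R `` {[(False, x)]}"
    using c x by (intro inv_equality) auto
  have "word_rel S R `` {[(b, x)]} \<otimes>\<^bsub>presented_group S R\<^esub> word_rel S R `` {w} = word_rel S R `` {a # w}"
    using x a by (simp add: mult_presented_group)
  then show ?case using Cons.IH x a i by auto
qed

lemma presented_group_lift:
  assumes H: "group H" and f: "f \<in> S \<rightarrow> carrier H"
    and R: "\<And>u v. (u, v) \<in> R \<Longrightarrow> u \<in> words S \<Longrightarrow> v \<in> words S \<Longrightarrow> word_eval H f u = word_eval H f v"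
  obtains h where "h \<in> hom (presented_group S R) H"
    "\<And>w. w \<in> words S \<Longrightarrow> h (word_rel S R `` {w}) = word_eval H f w"
proof -
  interpret H: group H by (rule H)
  define h where "h A = the_elem (word_eval H f ` A)" for A
  have h: "h (word_rel S R `` {w}) = word_eval H f w" if "w \<in> words S" for w
  proof -
    have "word_eval H f ` (word_rel S R `` {w}) = {word_eval H f w}"
    proof (intro equalityI subsetI)
      fix y assume "y \<in> word_eval H f ` (word_rel S R `` {w})"
      then obtain v where "(w, v) \<in> word_rel S R" "y = word_eval H f v" by auto
      then show "y \<in> {word_eval H f w}" using H.word_eval_word_rel[OF f R] by simp
    next
      fix y assume "y \<in> {word_eval H f w}"
      then show "y \<in> word_eval H f ` (word_rel S R `` {w})"
        using word_rel.refl[OF that, of R] by simp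
    qed
    then show ?thesis by (simp add: h_def)
  qed
  have "h \<in> hom (presented_group S R) H"
  proof (rule homI)
    fix A assume "A \<in> carrier (presented_group S R)"
    then obtain u where u: "u \<in> words S" "A = word_rel S R `` {u}"
      by (auto simp: presented_group_def elim: quotientE)
    show "h A \<in> carrier H" using h u f by simp
    fix B assume "B \<in> carrier (presented_group S R)"
    then obtain v where v: "v \<in> words S" "B = word_rel S R `` {v}"
      by (auto simp: presented_group_def elim: quotientE)
    show "h (A \<otimes>\<^bsub>presented_group S R\<^esub> B) = h A \<otimes>\<^bsub>H\<^esub> h B"
      using h u v H.word_eval_append[OF f] by (simp add: mult_presented_group)
  qed
  then show ?thesis using h by (rule that)
qed

section \<open>Relations between the pure braid generators\<close>

context group
begin

definition conjg :: "'a \<Rightarrow> 'a \<Rightarrow> 'a" where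
  "conjg g x = g \<otimes> x \<otimes> inv g"

lemma conj_closed [simp]: "g \<in> carrier G \<Longrightarrow> x \<in> carrier G \<Longrightarrow> conjg g x \<in> carrier G"
  by (simp add: conjg_def)

lemma conj_mult:
  "g \<in> carrier G \<Longrightarrow> x \<in> carrier G \<Longrightarrow> y \<in> carrier G \<Longrightarrow> conjg g (x \<otimes> y) = conjg g x \<otimes> conjg g y"
  by (simp add: conjg_def m_assoc)

lemma conj_one [simp]: "g \<in> carrier G \<Longrightarrow> conjg g \<one> = \<one>"
  by (simp add: conjg_def)

lemma conj_m_inv: "g \<in> carrier G \<Longrightarrow> x \<in> carrier G \<Longrightarrow> conjg g (inv x) = inv (conjg g x)"
  by (simp add: conjg_def m_assoc inv_mult_group)

lemma conj_conj:
  "g \<in> carrier G \<Longrightarrow> h \<in> carrier G \<Longrightarrow> x \<in> carrier G \<Longrightarrow> conjg g (conjg h x) = conjg (g \<otimes> h) x"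
  by (simp add: conjg_def m_assoc inv_mult_group)

lemma conj_distrib:
  "g \<in> carrier G \<Longrightarrow> h \<in> carrier G \<Longrightarrow> x \<in> carrier G \<Longrightarrow>
    conjg g (conjg h x) = conjg (conjg g h) (conjg g x)"
  by (simp add: conjg_def m_assoc inv_mult_group)

lemma conj_inv_cancel [simp]:
  "g \<in> carrier G \<Longrightarrow> x \<in> carrier G \<Longrightarrow> conjg (inv g) (conjg g x) = x"
  "g \<in> carrier G \<Longrightarrow> x \<in> carrier G \<Longrightarrow> conjg g (conjg (inv g) x) = x"
  by (simp_all add: conjg_def m_assoc)

lemma conj_eq_self_iff:
  assumes "g \<in> carrier G" "x \<in> carrier G"
  shows "conjg g x = x \<longleftrightarrow> g \<otimes> x = x \<otimes> g"
  using assms by (metis conjg_def inv_closed inv_solve_right m_closed)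

lemma conj_commute:
  assumes "x \<otimes> y = y \<otimes> x" "g \<in> carrier G" "x \<in> carrier G" "y \<in> carrier G"
  shows "conjg g x \<otimes> conjg g y = conjg g y \<otimes> conjg g x"
  using assms conj_mult by metis

lemma commute_mult:
  assumes "x \<otimes> y = y \<otimes> x" "x \<otimes> z = z \<otimes> x" "x \<in> carrier G" "y \<in> carrier G" "z \<in> carrier G"
  shows "x \<otimes> (y \<otimes> z) = y \<otimes> z \<otimes> x"
  using assms by (metis m_assoc)

lemma commute_inv:
  assumes "x \<otimes> y = y \<otimes> x" "x \<in> carrier G" "y \<in> carrier G"
  shows "x \<otimes> inv y = inv y \<otimes> x"
  using assms by (metis inv_closed inv_mult_cancel(2) inv_solve_right m_assoc m_closed)

lemma commute_generate:
  assumes "x \<in> carrier G" "S \<subseteq> carrier G" "\<And>y. y \<in> S \<Longrightarrow> x \<otimes> y = y \<otimes> x" "z \<in> generate G S"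
  shows "x \<otimes> z = z \<otimes> x"
  using assms(4)
proof induction
  case (inv y)
  then show ?case using assms commute_inv by blast
next
  case (eng y z)
  then show ?case using assms commute_mult generate_in_carrier by blast
qed (use assms in auto)

lemma conj_generate:
  assumes "g \<in> carrier G" "S \<subseteq> carrier G" "\<And>x. x \<in> S \<Longrightarrow> conjg g x \<in> generate G T"
    "T \<subseteq> carrier G" "x \<in> generate G S"
  shows "conjg g x \<in> generate G T"
  using assms(5)
proof induction
  case one
  then show ?case using assms(1) by (simp add: generate.one)
next
  case (incl x)
  then show ?case using assms by blast
next
  case (inv x)
  then show ?case
    using assms(1-4) conj_m_inv[of g x] generate_m_inv_closed[of T] by auto
next
  case (eng x y)
  then show ?case
    using assms(1,2) generate_in_carrier[of S] by (auto simp: conj_mult intro: generate.eng)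
qed

text \<open>Both \<open>g\<close> and its inverse are needed: a subgroup of an infinite group may be mapped
  properly into itself by conjugation.\<close>

lemma normal_if_generators:
  assumes "subgroup N G" and S: "S \<subseteq> carrier G" and gen: "carrier G = generate G S"
    and conj: "\<And>g x. g \<in> S \<Longrightarrow> x \<in> N \<Longrightarrow> conjg g x \<in> N \<and> conjg (inv g) x \<in> N"
  shows "N \<lhd> G"
proof -
  have N: "N \<subseteq> carrier G" using assms(1) by (rule subgroup.subset)
  have "\<forall>x\<in>N. conjg g x \<in> N" if "g \<in> generate G S" for g
    using that
  proof induction
    case one
    then show ?case using N by (auto simp: conjg_def)
  next
    case (eng g h)
    then have "g \<in> carrier G" "h \<in> carrier G" using S generate_in_carrier by auto
    then show ?case using eng.IH N by (auto simp: conj_conj [symmetric])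
  qed (use conj in auto)
  then show ?thesis
    using assms(1) gen by (simp add: normal_inv_iff conjg_def)
qed

end


text \<open>Only the relations between the generators are assumed, not that they present \<open>G\<close>, so
  that the results hold in the braid group and in its quotients alike.\<close>

locale artin_relations = group G for G (structure) +
  fixes s :: "nat \<Rightarrow> 'a" and n :: nat
  assumes s_closed: "s \<in> {1..<n} \<rightarrow> carrier G"
    and far: "1 \<le> i \<Longrightarrow> Suc i < j \<Longrightarrow> j < n \<Longrightarrow> s i \<otimes> s j = s j \<otimes> s i"
    and braid: "1 \<le> i \<Longrightarrow> Suc i < n \<Longrightarrow> s i \<otimes> s (Suc i) \<otimes> s i = s (Suc i) \<otimes> s i \<otimes> s (Suc i)"
begin

lemma s_carrier [simp]: "0 < i \<Longrightarrow> i < n \<Longrightarrow> s i \<in> carrier G"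
  using s_closed by (auto simp: Pi_iff)

definition a :: "nat \<Rightarrow> nat \<Rightarrow> 'a" where
  "a i j = word_eval G s (artin_word i j)"

lemma artin_word_in_words:
  assumes "0 < i" "i < j" "j \<le> n" shows "artin_word i j \<in> words {1..<n}"
  using assms by (auto simp: artin_word_def)

lemma a_carrier [simp]: "0 < i \<Longrightarrow> i < j \<Longrightarrow> j \<le> n \<Longrightarrow> a i j \<in> carrier G"
  unfolding a_def by (rule word_eval_closed[OF s_closed artin_word_in_words])

lemma a_adjacent: "0 < i \<Longrightarrow> i < n \<Longrightarrow> a i (Suc i) = s i \<otimes> s i"
  by (simp add: a_def artin_word_def)

lemma artin_word_Suc: "i < j \<Longrightarrow> artin_word i (Suc j) = (True, j) # artin_word i j @ [(False, j)]"
  by (simp add: artin_word_def)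

lemma a_Suc:
  assumes "0 < i" "i < j" "j < n" shows "a i (Suc j) = conjg (s j) (a i j)"
proof -
  have w: "artin_word i j \<in> words {1..<n}" "[(False, j)] \<in> words {1..<n}"
    using assms artin_word_in_words by auto
  show ?thesis
    using assms a_carrier[of i j] unfolding a_def artin_word_Suc[OF assms(2)] conjg_def
    by (simp add: word_eval_append[OF s_closed w] m_assoc)
qed

lemma far_conj:
  assumes "0 < i" "Suc i < j \<or> Suc j < i" "i < n" "0 < j" "j < n"
  shows "conjg (s i) (s j) = s j"
  using assms far[of i j] far[of j i] by (subst conj_eq_self_iff) auto

lemma conj_s_swap:
  assumes "0 < i" "Suc i < j \<or> Suc j < i" "i < n" "0 < j" "j < n" "x \<in> carrier G"
  shows "conjg (s i) (conjg (s j) x) = conjg (s j) (conjg (s i) x)"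
  using assms conj_distrib[of "s i" "s j" x] far_conj[of i j] by simp

text \<open>The relation \<open>sts = tst\<close> says that \<open>st\<close> conjugates \<open>s\<close> to \<open>t\<close>.\<close>

lemma braid_conj:
  assumes "0 < i" "Suc i < n"
  shows "conjg (s i) (conjg (s (Suc i)) (s i)) = s (Suc i)"
    "conjg (s (Suc i)) (conjg (s i) (s (Suc i))) = s i"
proof -
  let ?s = "s i" and ?t = "s (Suc i)"
  have c: "?s \<in> carrier G" "?t \<in> carrier G" using assms by auto
  have b: "?s \<otimes> ?t \<otimes> ?s = ?t \<otimes> ?s \<otimes> ?t" using assms braid by simp
  show "conjg ?s (conjg ?t ?s) = ?t"
    using c b by (simp add: conj_conj) (simp add: conjg_def m_assoc inv_mult_group)
  show "conjg ?t (conjg ?s ?t) = ?s"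
    using c b [symmetric] by (simp add: conj_conj) (simp add: conjg_def m_assoc inv_mult_group)
qed

lemma conj_s_braid:
  assumes "0 < i" "Suc i < n" "x \<in> carrier G"
  shows "conjg (s i) (conjg (s (Suc i)) (conjg (s i) x)) = conjg (s (Suc i)) (conjg (s i) (conjg (s (Suc i)) x))"
  using assms braid[of i] by (simp add: conj_conj m_assoc)

lemma conj_s_square:
  assumes "0 < i" "Suc i < n"
  shows "conjg (s i) (conjg (s (Suc i)) (s i \<otimes> s i)) = s (Suc i) \<otimes> s (Suc i)"
    "conjg (s (Suc i)) (s i \<otimes> s i) = conjg (inv s i) (s (Suc i) \<otimes> s (Suc i))"
    "conjg (inv (s (Suc i))) (s i \<otimes> s i) = conjg (s i) (s (Suc i) \<otimes> s (Suc i))"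
proof -
  let ?s = "s i" and ?t = "s (Suc i)"
  have c: "?s \<in> carrier G" "?t \<in> carrier G" using assms by auto
  show 1: "conjg ?s (conjg ?t (?s \<otimes> ?s)) = ?t \<otimes> ?t"
    using c braid_conj[OF assms] by (simp add: conj_mult)
  then show "conjg ?t (?s \<otimes> ?s) = conjg (inv ?s) (?t \<otimes> ?t)"
    using c by (metis conj_closed conj_inv_cancel(1) m_closed)
  have "conjg ?t (conjg ?s (?t \<otimes> ?t)) = ?s \<otimes> ?s"
    using c braid_conj[OF assms] by (simp add: conj_mult)
  then show "conjg (inv ?t) (?s \<otimes> ?s) = conjg ?s (?t \<otimes> ?t)"
    using c by (metis conj_closed conj_inv_cancel(1) m_closed)
qed

text \<open>This lemma and the next two are inductions on the right index, based on the fact that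
  \<open>a i (Suc j)\<close> is the conjugate of \<open>a i j\<close> by \<open>s j\<close>.\<close>

lemma conj_s_outside:
  assumes "0 < i" "i < j" "j \<le> n" "0 < k" "k < n" "Suc k < i \<or> j < k"
  shows "conjg (s k) (a i j) = a i j"
proof -
  have "0 < i \<Longrightarrow> j \<le> n \<Longrightarrow> Suc k < i \<or> j < k \<Longrightarrow> conjg (s k) (a i j) = a i j"
    using Suc_leI[OF assms(2)]
  proof (induction j rule: dec_induct)
    case base
    then show ?case using assms(4,5) by (simp add: a_adjacent conj_mult far_conj)
  next
    case (step j)
    then have "conjg (s k) (a i (Suc j)) = conjg (s j) (conjg (s k) (a i j))"
      using assms(4,5) conj_s_swap[of k j "a i j"] by (auto simp: a_Suc)
    then show ?case using step assms(4,5) by (auto simp: a_Suc)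
  qed
  then show ?thesis using assms by blast
qed

lemma conj_s_inside:
  assumes "0 < i" "i < k" "Suc k < j" "j \<le> n"
  shows "conjg (s k) (a i j) = a i j"
  using Suc_leI[OF assms(3)] assms(4)
proof (induction j rule: dec_induct)
  case base
  then show ?case
    using assms(1,2) conj_s_outside[of i k "Suc k"] by (simp add: a_Suc conj_s_braid)
next
  case (step j)
  then have "conjg (s k) (a i (Suc j)) = conjg (s j) (conjg (s k) (a i j))"
    using assms(1,2) conj_s_swap[of k j "a i j"] by (auto simp: a_Suc)
  then show ?case using step assms(1,2) by (simp add: a_Suc)
qed

lemma conj_s_left:
  assumes "0 < i" "Suc i < j" "j \<le> n"
  shows "conjg (s i) (a i j) = a (Suc i) j"
  using Suc_leI[OF assms(2)] assms(3)
proof (induction j rule: dec_induct)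
  case base
  then show ?case using assms(1) by (simp add: a_Suc a_adjacent conj_s_square)
next
  case (step j)
  then have "conjg (s i) (a i (Suc j)) = conjg (s j) (conjg (s i) (a i j))"
    using assms(1) conj_s_swap[of i j "a i j"] by (auto simp: a_Suc)
  then show ?case using step assms(1) by (simp add: a_Suc)
qed

text \<open>Conjugation by \<open>s p\<close> renames the strand \<open>p\<close> to \<open>Suc p\<close>, as long as the
  new name is free.\<close>

lemma conj_s_shift:
  assumes "0 < q" "q < r" "r \<le> n" "0 < p" "p < n" "Suc p \<noteq> q" "Suc p \<noteq> r"
  shows "conjg (s p) (a q r) = a (if q = p then Suc p else q) (if r = p then Suc p else r)"
proof -
  consider "p = q" | "p = r" | "q < p" "Suc p < r" | "Suc p < q \<or> r < p"
    using assms by linarith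
  then show ?thesis
  proof cases
    case 1
    then show ?thesis using assms conj_s_left[of q r] by simp
  next
    case 2
    then show ?thesis using assms a_Suc[of q r] by simp
  next
    case 3
    then show ?thesis using assms conj_s_inside[of q p r] by simp
  next
    case 4
    then show ?thesis using assms conj_s_outside[of q r p] by auto
  qed
qed

definition pure :: "'a set" where
  "pure = generate G {a i j |i j. 0 < i \<and> i < j \<and> j \<le> n}"

text \<open>One of the two conjugates is a generator, by \<open>conj_s_shift\<close>; the other one differs from
  it by a conjugation with \<open>s k \<otimes> s k\<close>, which is \<open>a k (Suc k)\<close>.\<close>

lemma conj_s_pure:
  assumes "0 < i" "i < j" "j \<le> n" "0 < k" "k < n"
  shows "conjg (s k) (a i j) \<in> pure \<and> conjg (inv (s k)) (a i j) \<in> pure"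
proof -
  have sub: "subgroup pure G"
    unfolding pure_def by (rule generate_is_subgroup) auto
  have a_in: "a p q \<in> pure" if "0 < p" "p < q" "q \<le> n" for p q
    unfolding pure_def using that by (intro generate.incl) auto
  have sq: "s k \<otimes> s k \<in> pure" using a_in[of k "Suc k"] assms by (simp add: a_adjacent)
  have c: "s k \<in> carrier G" "a i j \<in> carrier G" using assms by auto
  have flip: "conjg (s k) x \<in> pure \<longleftrightarrow> conjg (inv (s k)) x \<in> pure" if x: "x \<in> carrier G" for x
  proof
    assume "conjg (s k) x \<in> pure"
    then have "inv (s k \<otimes> s k) \<otimes> conjg (s k) x \<otimes> (s k \<otimes> s k) \<in> pure"
      using sub sq by (metis subgroup.m_closed subgroup.m_inv_closed)
    then show "conjg (inv (s k)) x \<in> pure"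
      using c x by (simp add: conjg_def m_assoc inv_mult_group)
  next
    assume "conjg (inv (s k)) x \<in> pure"
    then have "s k \<otimes> s k \<otimes> conjg (inv (s k)) x \<otimes> inv (s k \<otimes> s k) \<in> pure"
      using sub sq by (metis subgroup.m_closed subgroup.m_inv_closed)
    then show "conjg (s k) x \<in> pure"
      using c x by (simp add: conjg_def m_assoc inv_mult_group)
  qed
  have "conjg (s k) (a i j) \<in> pure \<or> conjg (inv (s k)) (a i j) \<in> pure"
  proof (cases "Suc k = i \<or> Suc k = j")
    case False
    then have "conjg (s k) (a i j) \<in> pure"
      using assms by (auto simp: conj_s_shift intro!: a_in)
    then show ?thesis ..
  next
    case True
    show ?thesis
    proof (cases "k = i")
      case True
      then have "conjg (s k) (a i j) = a i j"
        using \<open>Suc k = i \<or> Suc k = j\<close> assms by (auto simp: a_adjacent conjg_def m_assoc)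
      then show ?thesis using assms a_in by auto
    next
      case False
      \<comment> \<open>\<open>a i j\<close> is the result of renaming the strand \<open>k\<close> of \<open>a p q\<close> to \<open>Suc k\<close>.\<close>
      define p q where "p = (if i = Suc k then k else i)" and "q = (if j = Suc k then k else j)"
      have pq: "0 < p" "p < q" "q \<le> n" "Suc k \<noteq> p" "Suc k \<noteq> q"
        using True False assms by (auto simp: p_def q_def)
      have "conjg (s k) (a p q) = a i j"
        using pq assms True False by (subst conj_s_shift) (auto simp: p_def q_def)
      then have "conjg (inv (s k)) (a i j) = a p q"
        using conj_inv_cancel(1)[OF c(1), of "a p q"] pq assms by simp
      then show ?thesis using a_in pq by auto
    qed
  qed
  then show ?thesis using flip c by blast
qed

lemma pure_normal:
  assumes "carrier G = generate G (s ` {1..<n})"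
  shows "pure \<lhd> G"
proof (rule normal_if_generators[OF _ _ assms])
  let ?A = "{a i j |i j. 0 < i \<and> i < j \<and> j \<le> n}"
  have A: "?A \<subseteq> carrier G" by auto
  show "subgroup pure G"
    unfolding pure_def by (rule generate_is_subgroup[OF A])
  show "s ` {1..<n} \<subseteq> carrier G" using s_closed by auto
  fix g x assume g: "g \<in> s ` {1..<n}" and x: "x \<in> pure"
  then obtain k where k: "g = s k" "0 < k" "k < n" by auto
  have "conjg g y \<in> generate G ?A \<and> conjg (inv g) y \<in> generate G ?A" if "y \<in> ?A" for y
    using that conj_s_pure k unfolding pure_def by blast
  then show "conjg g x \<in> pure \<and> conjg (inv g) x \<in> pure"
    using conj_generate[OF _ A _ A, of _ x] k x unfolding pure_def by simp
qed


definition central_product :: "'a \<Rightarrow> 'a \<Rightarrow> 'a \<Rightarrow> bool" where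
  "central_product x y z \<longleftrightarrow> (\<forall>w \<in> {x, y, z}. (x \<otimes> y \<otimes> z) \<otimes> w = w \<otimes> (x \<otimes> y \<otimes> z))"

lemma central_product_conj:
  assumes "central_product x y z" "x \<in> carrier G" "y \<in> carrier G" "z \<in> carrier G" "g \<in> carrier G"
  shows "central_product (conjg g x) (conjg g y) (conjg g z)"
  using assms conj_commute[of "x \<otimes> y \<otimes> z" _ g] by (auto simp: central_product_def conj_mult)

text \<open>The generators \<open>a\<^sub>1\<^sub>3\<close> and \<open>a\<^sub>2\<^sub>4\<close> of the pure braid group do
  not commute.  They do so after one of them is conjugated by a suitable further generator; the
  three conjuncts use those of the strand pairs 34, 12 and 23.\<close>

definition crossing :: "'a \<Rightarrow> 'a \<Rightarrow> 'a \<Rightarrow> 'a \<Rightarrow> 'a \<Rightarrow> bool" where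
  "crossing x12 x13 x23 x24 x34 \<longleftrightarrow>
    x13 \<otimes> conjg (inv x34) x24 = conjg (inv x34) x24 \<otimes> x13 \<and>
    conjg x12 x13 \<otimes> x24 = x24 \<otimes> conjg x12 x13 \<and>
    conjg (inv x23) x13 \<otimes> x24 = x24 \<otimes> conjg (inv x23) x13"

lemma crossing_conj:
  assumes "crossing x12 x13 x23 x24 x34" "g \<in> carrier G"
    "x12 \<in> carrier G" "x13 \<in> carrier G" "x23 \<in> carrier G" "x24 \<in> carrier G" "x34 \<in> carrier G"
  shows "crossing (conjg g x12) (conjg g x13) (conjg g x23) (conjg g x24) (conjg g x34)"
proof -
  have "conjg (conjg g x) (conjg g y) = conjg g (conjg x y)" 
    "conjg (inv (conjg g x)) (conjg g y) = conjg g (conjg (inv x) y)"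
    if "x \<in> carrier G" "y \<in> carrier G" for x y
    using that assms(2) by (simp_all add: conj_distrib[of g] conj_m_inv)
  then show ?thesis
    using assms unfolding crossing_def by (auto intro!: conj_commute)
qed

text \<open>The product is the full twist on the three strands, that is, the square of the half twist
  \<open>sts\<close>, and conjugation by the half twist exchanges \<open>s\<close> and \<open>t\<close>.\<close>

lemma central_product_adjacent:
  assumes "0 < i" "Suc i < n"
  shows "central_product (a i (Suc i)) (a i (Suc (Suc i))) (a (Suc i) (Suc (Suc i)))"
proof -
  let ?s = "s i" and ?t = "s (Suc i)"
  have c: "?s \<in> carrier G" "?t \<in> carrier G" using assms by auto
  have b: "?s \<otimes> ?t \<otimes> ?s = ?t \<otimes> ?s \<otimes> ?t" using assms braid[of i] by simp
  \<comment> \<open>the half twist on the three strands\<close>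
  define d where "d = ?s \<otimes> ?t \<otimes> ?s"
  have dc: "d \<in> carrier G" using c by (simp add: d_def)
  have sd: "?s \<otimes> d = d \<otimes> ?t"
    unfolding d_def by (subst b) (use c in \<open>simp add: m_assoc\<close>)
  have td: "?t \<otimes> d = d \<otimes> ?s"
    unfolding d_def by (subst (2) b) (use c in \<open>simp add: m_assoc\<close>)
  define z where "z = d \<otimes> d"
  have zc: "z \<in> carrier G" using dc by (simp add: z_def)
  have zs: "z \<otimes> ?s = ?s \<otimes> z" and zt: "z \<otimes> ?t = ?t \<otimes> z"
    using c dc sd td by (metis m_assoc z_def)+
  have "z = ?s \<otimes> (?t \<otimes> ?s \<otimes> ?t) \<otimes> (?s \<otimes> ?t)"
    unfolding z_def by (subst (2) d_def, subst b) (use c in \<open>simp add: d_def m_assoc\<close>)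
  then have z: "z = ?s \<otimes> ?s \<otimes> (?t \<otimes> ?s \<otimes> ?s \<otimes> ?t)"
    unfolding b [symmetric] using c by (simp add: m_assoc)
  have zss: "z \<otimes> (?s \<otimes> ?s) = ?s \<otimes> ?s \<otimes> z" and ztt: "z \<otimes> (?t \<otimes> ?t) = ?t \<otimes> ?t \<otimes> z"
    using commute_mult[OF zs zs] commute_mult[OF zt zt] c zc by auto
  have "z \<otimes> conjg ?t (?s \<otimes> ?s) = conjg ?t (?s \<otimes> ?s) \<otimes> z"
    using commute_mult[OF commute_mult[OF zt zss] commute_inv[OF zt]] c zc by (simp add: conjg_def)
  moreover have "?s \<otimes> ?s \<otimes> conjg ?t (?s \<otimes> ?s) \<otimes> (?t \<otimes> ?t) = z"
    using c by (simp add: z conjg_def m_assoc)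
  ultimately show ?thesis
    using assms zss ztt by (simp add: central_product_def a_adjacent a_Suc)
qed

text \<open>In each of the three cases both elements become conjugates, by one and the same power of
  \<open>s (Suc i)\<close>, of the commuting squares of \<open>s i\<close> and \<open>s (Suc (Suc i))\<close>.\<close>

lemma crossing_adjacent:
  assumes "0 < i" "Suc (Suc i) < n"
  shows "crossing (a i (Suc i)) (a i (Suc (Suc i))) (a (Suc i) (Suc (Suc i)))
    (a (Suc i) (Suc (Suc (Suc i)))) (a (Suc (Suc i)) (Suc (Suc (Suc i))))"
proof -
  let ?s = "s i" and ?t = "s (Suc i)" and ?u = "s (Suc (Suc i))"
  have c: "?s \<in> carrier G" "?t \<in> carrier G" "?u \<in> carrier G" using assms by auto
  have su: "?s \<otimes> ?u = ?u \<otimes> ?s" using assms far[of i "Suc (Suc i)"] by simp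
  have su2: "(?s \<otimes> ?s) \<otimes> (?u \<otimes> ?u) = (?u \<otimes> ?u) \<otimes> (?s \<otimes> ?s)"
    using c su by (metis commute_mult m_closed)
  have sq: "conjg (inv (g \<otimes> g)) (conjg g x) = conjg (inv g) x" "conjg (g \<otimes> g) (conjg (inv g) x) = conjg g x"
    if "g \<in> carrier G" "x \<in> carrier G" for g x
    using that by (simp_all add: conjg_def inv_mult_group m_assoc)
  have 1: "conjg ?t (?s \<otimes> ?s) \<otimes> conjg ?t (?u \<otimes> ?u) = conjg ?t (?u \<otimes> ?u) \<otimes> conjg ?t (?s \<otimes> ?s)"
    "conjg (inv ?t) (?s \<otimes> ?s) \<otimes> conjg (inv ?t) (?u \<otimes> ?u)
      = conjg (inv ?t) (?u \<otimes> ?u) \<otimes> conjg (inv ?t) (?s \<otimes> ?s)"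
    using c su2 by (auto intro!: conj_commute)
  have 2: "conjg (inv ?u) (?t \<otimes> ?t) = conjg ?t (?u \<otimes> ?u)" "conjg ?u (?t \<otimes> ?t) = conjg (inv ?t) (?u \<otimes> ?u)"
    "conjg (inv ?t) (?s \<otimes> ?s) = conjg ?s (?t \<otimes> ?t)" "conjg ?t (?s \<otimes> ?s) = conjg (inv ?s) (?t \<otimes> ?t)"
    using assms conj_s_square[of i] conj_s_square[of "Suc i"] by auto
  have A: "a i (Suc i) = ?s \<otimes> ?s" "a i (Suc (Suc i)) = conjg ?t (?s \<otimes> ?s)"
    "a (Suc i) (Suc (Suc i)) = ?t \<otimes> ?t" "a (Suc i) (Suc (Suc (Suc i))) = conjg ?u (?t \<otimes> ?t)"
    "a (Suc (Suc i)) (Suc (Suc (Suc i))) = ?u \<otimes> ?u"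
    using assms by (simp_all add: a_adjacent a_Suc)
  have B: "conjg (inv (?u \<otimes> ?u)) (conjg ?u (?t \<otimes> ?t)) = conjg ?t (?u \<otimes> ?u)"
    "conjg (?s \<otimes> ?s) (conjg ?t (?s \<otimes> ?s)) = conjg (inv ?t) (?s \<otimes> ?s)"
    "conjg (inv (?t \<otimes> ?t)) (conjg ?t (?s \<otimes> ?s)) = conjg (inv ?t) (?s \<otimes> ?s)"
    using sq(1)[of ?u "?t \<otimes> ?t"] sq(2)[of ?s "?t \<otimes> ?t"] sq(1)[of ?t "?s \<otimes> ?s"] c
    unfolding 2(1,3) 2(4) [symmetric] by simp_all
  show ?thesis
    unfolding crossing_def A B using 1 2(2) by simp
qed

text \<open>Starting with adjacent strands, move the strands to their final positions one step at a time by
  conjugation with \<open>conj_s_shift\<close>.  The rightmost strand moves first, so that the next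
  position is always free.\<close>

lemma central_product_a:
  assumes "0 < i" "i < j" "j < k" "k \<le> n"
  shows "central_product (a i j) (a i k) (a j k)"
proof -
  have 1: "k \<le> n \<Longrightarrow> central_product (a i (Suc i)) (a i k) (a (Suc i) k)" if "Suc (Suc i) \<le> k" for k
    using that
  proof (induction k rule: dec_induct)
    case base
    then show ?case using assms central_product_adjacent by simp
  next
    case (step k)
    then show ?case
      using central_product_conj[of "a i (Suc i)" "a i k" "a (Suc i) k" "s k"] assms
      by (simp add: conj_s_shift)
  qed
  have "j < k \<Longrightarrow> central_product (a i j) (a i k) (a j k)"
    using Suc_leI[OF assms(2)]
  proof (induction j rule: dec_induct)
    case base
    then show ?case using assms 1 by simp
  next
    case (step j)
    then show ?case
      using central_product_conj[of "a i j" "a i k" "a j k" "s j"] assms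
      by (simp add: conj_s_shift)
  qed
  then show ?thesis using assms by simp
qed

text \<open>The proof moves strands to the right just as in \<open>central_product_a\<close>.\<close>

lemma crossing_a:
  assumes "0 < i" "i < j" "j < k" "k < l" "l \<le> n"
  shows "crossing (a i j) (a i k) (a j k) (a j l) (a k l)"
proof -
  have 1: "l \<le> n \<Longrightarrow> crossing (a i (Suc i)) (a i (Suc (Suc i))) (a (Suc i) (Suc (Suc i)))
      (a (Suc i) l) (a (Suc (Suc i)) l)" if "Suc (Suc (Suc i)) \<le> l" for l
    using that
  proof (induction l rule: dec_induct)
    case base
    then show ?case using assms crossing_adjacent by simp
  next
    case (step l)
    then show ?case
      using crossing_conj[of "a i (Suc i)" "a i (Suc (Suc i))" "a (Suc i) (Suc (Suc i))"
          "a (Suc i) l" "a (Suc (Suc i)) l" "s l"] assms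
      by (simp add: conj_s_shift)
  qed
  have 2: "k < l \<Longrightarrow> crossing (a i (Suc i)) (a i k) (a (Suc i) k) (a (Suc i) l) (a k l)"
    if "Suc (Suc i) \<le> k" for k
    using that
  proof (induction k rule: dec_induct)
    case base
    then show ?case using assms 1 by simp
  next
    case (step k)
    then show ?case
      using crossing_conj[of "a i (Suc i)" "a i k" "a (Suc i) k" "a (Suc i) l" "a k l" "s k"] assms
      by (simp add: conj_s_shift)
  qed
  have "j < k \<Longrightarrow> crossing (a i j) (a i k) (a j k) (a j l) (a k l)"
    using Suc_leI[OF assms(2)]
  proof (induction j rule: dec_induct)
    case base
    then show ?case using assms 2 by simp
  next
    case (step j)
    then show ?case
      using crossing_conj[of "a i j" "a i k" "a j k" "a j l" "a k l" "s j"] assms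
      by (simp add: conj_s_shift)
  qed
  then show ?thesis using assms by simp
qed

lemma conj_word_fixed:
  assumes "x \<in> carrier G" "w \<in> words {1..<n}"
    "\<And>b k. (b, k) \<in> set w \<Longrightarrow> conjg (s k) x = x"
  shows "conjg (word_eval G s w) x = x"
  using assms(2,3)
proof (induction w)
  case Nil
  then show ?case using assms(1) by (simp add: conjg_def)
next
  case (Cons p w)
  obtain b k where p: "p = (b, k)" by force
  have k: "s k \<in> carrier G" "w \<in> words {1..<n}" "conjg (s k) x = x"
    using Cons.prems p by auto
  then have "conjg (inv (s k)) x = x" using assms(1) by (metis conj_inv_cancel(1))
  moreover have "conjg (word_eval G s w) x = x" using Cons k by auto
  ultimately show ?case
    using p k assms(1) word_eval_closed[OF s_closed, of w] by (auto simp: conj_conj [symmetric])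
qed

lemma a_commute_separate:
  assumes "0 < i" "i < j" "j < k" "k < l" "l \<le> n"
  shows "a i j \<otimes> a k l = a k l \<otimes> a i j"
proof -
  have "conjg (a k l) (a i j) = a i j"
    unfolding a_def[of k l]
    by (rule conj_word_fixed)
      (use assms in \<open>auto simp: artin_word_def intro!: artin_word_in_words conj_s_outside\<close>)
  then show ?thesis using assms by (simp add: conj_eq_self_iff)
qed

lemma a_commute_nested:
  assumes "0 < i" "i < j" "j < k" "k < l" "l \<le> n"
  shows "a i l \<otimes> a j k = a j k \<otimes> a i l"
proof -
  have "conjg (a j k) (a i l) = a i l"
    unfolding a_def[of j k]
    by (rule conj_word_fixed)
      (use assms in \<open>auto simp: artin_word_def intro!: conj_s_inside\<close>)
  then show ?thesis using assms by (simp add: conj_eq_self_iff)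
qed

end

section \<open>The pure braid group is generated by the Artin generators\<close>

text \<open>The products \<open>s\<^bsub>m-1\<^esub> \<dots> s\<^sub>k\<close> represent the cosets of the symmetric group on
  \<open>m - 1\<close> letters in the one on \<open>m\<close> letters.\<close>

definition descending_word :: "nat \<Rightarrow> nat \<Rightarrow> nat word" where
  "descending_word k m = map (Pair True) (rev [k..<m])"

lemma descending_word_in_words [simp]: "descending_word k m \<in> words S \<longleftrightarrow> {k..<m} \<subseteq> S"
  by (simp add: descending_word_def)

lemma descending_word_self [simp]: "descending_word m m = []"
  by (simp add: descending_word_def)

lemma descending_word_Suc: "k \<le> m \<Longrightarrow> descending_word k (Suc m) = (True, m) # descending_word k m"
  by (simp add: descending_word_def)

lemma descending_word_extend: "k < m \<Longrightarrow> descending_word k m = descending_word (Suc k) m @ [(True, k)]"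
  by (simp add: descending_word_def upt_conv_Cons)

lemma word_perm_descending: "k \<le> m \<Longrightarrow> word_perm (descending_word k m) k = m"
proof (induction m rule: dec_induct)
  case (step m)
  then show ?case by (simp add: descending_word_Suc word_perm_Cons)
qed (simp add: word_perm_Nil)

text \<open>The assumption \<open>perm\<close> says that the symmetric group is a quotient of the subgroup generated
  by the \<open>s i\<close>.  With \<open>involution\<close> the two turn out to be equal, which is the Coxeter
  presentation of the symmetric group in the form in which it is applied below.\<close>

locale symmetric_relations = artin_relations +
  assumes involution: "0 < i \<Longrightarrow> i < n \<Longrightarrow> s i \<otimes> s i = \<one>"
    and perm: "u \<in> words {1..<n} \<Longrightarrow> v \<in> words {1..<n} \<Longrightarrow>
      word_eval G s u = word_eval G s v \<Longrightarrow> word_perm u = word_perm v"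
begin

lemma commute_word:
  assumes "w \<in> words S" "S \<subseteq> {1..<n}" "x \<in> carrier G" "\<And>i. i \<in> S \<Longrightarrow> x \<otimes> s i = s i \<otimes> x"
  shows "x \<otimes> word_eval G s w = word_eval G s w \<otimes> x"
proof -
  have f: "s \<in> S \<rightarrow> carrier G" using s_closed assms(2) by blast
  show ?thesis
  proof (rule commute_generate)
    show "word_eval G s w \<in> generate G (s ` S)"
      using generate_eq_word_eval[OF f] assms(1) by blast
  qed (use f assms in auto)
qed

lemma eval_append:
  "u \<in> words {1..<n} \<Longrightarrow> v \<in> words {1..<n} \<Longrightarrow>
    word_eval G s (u @ v) = word_eval G s u \<otimes> word_eval G s v"
  by (rule word_eval_append[OF s_closed])

lemma eval_carrier [simp]: "w \<in> words {1..<n} \<Longrightarrow> word_eval G s w \<in> carrier G"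
  by (rule word_eval_closed[OF s_closed])

lemma inv_s: "0 < i \<Longrightarrow> i < n \<Longrightarrow> inv (s i) = s i"
  using involution by (simp add: inv_equality)

text \<open>The letter \<open>j\<close> passes everything to the right of \<open>j, j - 1\<close> in the descending word, then
  the braid relation turns it into \<open>j - 1\<close>, which passes the rest.\<close>

lemma descending_slide:
  assumes "0 < k" "k < j" "j < m" "m \<le> n"
  shows "word_eval G s (descending_word k m) \<otimes> s j = s (j - 1) \<otimes> word_eval G s (descending_word k m)"
  using Suc_leI[OF assms(3)] assms(4)
proof (induction m rule: dec_induct)
  case base
  obtain i where i: "j = Suc i" using assms(2) by (cases j) auto
  let ?v = "word_eval G s (descending_word k i)"
  have c: "s i \<in> carrier G" "s j \<in> carrier G" "?v \<in> carrier G"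
    using assms base i by (auto intro!: s_carrier)
  have "s j \<otimes> ?v = ?v \<otimes> s j"
    by (rule commute_word[of _ "{k..<i}"]) (use assms base i far[of _ j] c in auto)
  then have "s j \<otimes> s i \<otimes> ?v \<otimes> s j = s j \<otimes> s i \<otimes> s j \<otimes> ?v"
    using c by (simp add: m_assoc)
  also have "\<dots> = s i \<otimes> s j \<otimes> s i \<otimes> ?v"
    using braid[of i] assms base i by simp
  finally show ?case
    using c assms i by (simp add: descending_word_Suc m_assoc)
next
  case (step m)
  let ?v = "word_eval G s (descending_word k m)"
  have c: "s m \<in> carrier G" "s j \<in> carrier G" "s (j - 1) \<in> carrier G" "?v \<in> carrier G"
    using assms step by (auto intro!: s_carrier)
  have sm: "s m \<otimes> s (j - 1) = s (j - 1) \<otimes> s m"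
    using far[of "j - 1" m] assms step by simp
  have "s m \<otimes> ?v \<otimes> s j = s m \<otimes> (s (j - 1) \<otimes> ?v)"
    using step c by (simp add: m_assoc)
  also have "\<dots> = s (j - 1) \<otimes> (s m \<otimes> ?v)"
    using sm c by (metis m_assoc)
  finally show ?case
    using assms step by (simp add: descending_word_Suc)
qed

text \<open>Append the letters one by one.  The new letter \<open>j\<close> lengthens the descending word, shortens
  it, or can be moved to its left, depending on the position of \<open>j\<close> relative to \<open>k\<close>.\<close>

lemma normal_form:
  assumes "0 < m" "m \<le> n" "w \<in> words {1..<m}"
  shows "\<exists>w' k. w' \<in> words {1..<m - 1} \<and> 0 < k \<and> k \<le> m \<and>
    word_eval G s w = word_eval G s (w' @ descending_word k m)"
  using assms(3)
proof (induction w rule: rev_induct)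
  case Nil
  show ?case using assms by (intro exI[of _ "[]"] exI[of _ m]) simp
next
  case (snoc p w)
  obtain b j where p: "p = (b, j)" by force
  have j: "0 < j" "j < m" "w \<in> words {1..<m}" using snoc.prems p by auto
  obtain w' k where w': "w' \<in> words {1..<m - 1}" and k: "0 < k" "k \<le> m"
    and eq: "word_eval G s w = word_eval G s (w' @ descending_word k m)"
    using snoc.IH[OF j(3)] by blast
  let ?d = "descending_word k m"
  have in_n: "w \<in> words {1..<n}" "w' \<in> words {1..<n}" "?d \<in> words {1..<n}" "[(b, j)] \<in> words {1..<n}"
    using j w' k assms by (auto elim!: words_mono[rotated])
  have c: "s j \<in> carrier G" using j assms by simp
  have *: "word_eval G s (w @ [p]) = word_eval G s w' \<otimes> (word_eval G s ?d \<otimes> s j)"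
    using in_n c j assms eq p inv_s[of j] by (auto simp: eval_append m_assoc)
  have goal: ?case
    if u: "u \<in> words {1..<m - 1}" and l: "0 < l" "l \<le> m"
      and e: "word_eval G s ?d \<otimes> s j = word_eval G s (u @ descending_word l m)" for u l
  proof (intro exI conjI)
    have "u \<in> words {1..<n}" "descending_word l m \<in> words {1..<n}"
      using u l assms by (auto elim!: words_mono[rotated])
    then show "word_eval G s (w @ [p]) = word_eval G s ((w' @ u) @ descending_word l m)"
      using in_n by (simp add: * e eval_append m_assoc)
  qed (use w' u l in auto)
  consider "Suc j = k" | "j = k" | "Suc j < k" | "k < j" by linarith
  then show ?case
  proof cases
    case 1
    then have "descending_word j m = ?d @ [(True, j)]"
      using descending_word_extend[of j m] j by simp
    then have "word_eval G s ?d \<otimes> s j = word_eval G s ([] @ descending_word j m)"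
      using in_n c j assms by (simp add: eval_append)
    then show ?thesis using goal[of "[]" j] j by simp
  next
    case 2
    then have "?d = descending_word (Suc j) m @ [(True, j)]"
      using descending_word_extend[of j m] j by simp
    then have "word_eval G s ?d \<otimes> s j = word_eval G s ([] @ descending_word (Suc j) m)"
      using in_n c j assms by (simp add: eval_append m_assoc involution)
    then show ?thesis using goal[of "[]" "Suc j"] j by simp
  next
    case 3
    have "s j \<otimes> word_eval G s ?d = word_eval G s ?d \<otimes> s j"
      by (rule commute_word[of _ "{k..<m}"]) (use j k assms 3 far[of j] c in auto)
    then show ?thesis using goal[of "[(True, j)]" k] j k 3 c by simp
  next
    case 4
    then have "0 < j - 1" "j - 1 < m - 1" using j k by auto
    with 4 show ?thesis
      using goal[of "[(True, j - 1)]" k] descending_slide[of k j m] j k assms by simp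
  qed
qed

text \<open>In the normal form \<open>w'\<close> fixes \<open>m\<close>, and the descending word sends \<open>k\<close> to
  \<open>m\<close>.  A trivial permutation therefore forces \<open>k = m\<close>, which leaves a word in fewer letters.\<close>

lemma eval_eq_one_if_perm_trivial:
  assumes "m \<le> n" "w \<in> words {1..<m}" "word_perm w = id"
  shows "word_eval G s w = \<one>"
  using assms
proof (induction m arbitrary: w)
  case 0
  then show ?case by (cases w) auto
next
  case (Suc m)
  obtain w' k where w': "w' \<in> words {1..<m}" and k: "0 < k" "k \<le> Suc m"
    and eq: "word_eval G s w = word_eval G s (w' @ descending_word k (Suc m))"
    using normal_form[of "Suc m" w] Suc.prems by auto
  have in_n: "w \<in> words {1..<n}" "w' \<in> words {1..<n}" "descending_word k (Suc m) \<in> words {1..<n}"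
    using Suc.prems w' k by (auto elim!: words_mono[rotated])
  have "word_perm w = word_perm (w' @ descending_word k (Suc m))"
    by (rule perm[OF in_n(1) _ eq]) (use in_n in simp)
  then have "word_perm w' \<circ> word_perm (descending_word k (Suc m)) = id"
    using Suc.prems(3) word_perm_append by metis
  then have id: "word_perm w' (word_perm (descending_word k (Suc m)) x) = x" for x
    by (metis comp_apply id_apply)
  have "word_perm w' (Suc m) = Suc m"
    using word_perm_permutes[OF w'] by (auto simp: permutes_def)
  then have km: "k = Suc m" using id[of k] k by (simp add: word_perm_descending)
  then have "word_perm w' = id" using id by (simp add: word_perm_Nil fun_eq_iff)
  then show ?case using Suc.IH[of w'] Suc.prems w' eq km by simp
qed

end


abbreviation sigma :: "nat \<Rightarrow> nat \<Rightarrow> nat word set" where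
  "sigma n i \<equiv> braid_of_word n [(True, i)]"

lemma braid_of_word_eval:
  "w \<in> words {1..<n} \<Longrightarrow> braid_of_word n w = word_eval (braid_group n) (sigma n) w"
  unfolding braid_of_word_def braid_group_def by (rule presented_group_class)

lemma braid_of_word_mult:
  "u \<in> words {1..<n} \<Longrightarrow> v \<in> words {1..<n} \<Longrightarrow>
    braid_of_word n u \<otimes>\<^bsub>braid_group n\<^esub> braid_of_word n v = braid_of_word n (u @ v)"
  unfolding braid_of_word_def braid_group_def by (rule mult_presented_group)

lemma carrier_braid_group: "carrier (braid_group n) = braid_of_word n ` words {1..<n}"
  by (auto simp: braid_group_def presented_group_def quotient_def braid_of_word_def)

lemma braid_of_word_eqI:
  assumes "(u, v) \<in> word_rel {1..<n} braid_relations"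
  shows "braid_of_word n u = braid_of_word n v"
  unfolding braid_of_word_def by (rule equiv_class_eq[OF equiv_word_rel assms])

interpretation braid: artin_relations "braid_group n" "sigma n" n for n
proof (intro artin_relations.intro group_braid_group artin_relations_axioms.intro)
  show s: "sigma n \<in> {1..<n} \<rightarrow> carrier (braid_group n)"
    by (auto simp: carrier_braid_group)
  fix i :: nat
  assume i: "1 \<le> i"
  show "sigma n i \<otimes>\<^bsub>braid_group n\<^esub> sigma n j = sigma n j \<otimes>\<^bsub>braid_group n\<^esub> sigma n i"
    if "Suc i < j" "j < n" for j
  proof -
    have "braid_of_word n [(True, i), (True, j)] = braid_of_word n [(True, j), (True, i)]"
      using i that by (intro braid_of_word_eqI word_rel.relation) (auto simp: braid_relations_def)
    then show ?thesis using i that by (simp add: braid_of_word_mult)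
  qed
  show "sigma n i \<otimes>\<^bsub>braid_group n\<^esub> sigma n (Suc i) \<otimes>\<^bsub>braid_group n\<^esub> sigma n i
      = sigma n (Suc i) \<otimes>\<^bsub>braid_group n\<^esub> sigma n i \<otimes>\<^bsub>braid_group n\<^esub> sigma n (Suc i)"
    if "Suc i < n"
  proof -
    have "braid_of_word n [(True, i), (True, Suc i), (True, i)]
        = braid_of_word n [(True, Suc i), (True, i), (True, Suc i)]"
      using i that by (intro braid_of_word_eqI word_rel.relation) (auto simp: braid_relations_def)
    then show ?thesis using i that by (simp add: braid_of_word_mult)
  qed
qed

lemma braid_a: 
  assumes "0 < i" "i < j" "j \<le> n" shows "braid.a n i j = artin_gen n i j"
  unfolding braid.a_def artin_gen_def
  using braid.artin_word_in_words[OF assms] by (simp add: braid_of_word_eval)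

lemma braid_group_generated: "carrier (braid_group n) = generate (braid_group n) (sigma n ` {1..<n})"
  unfolding carrier_braid_group braid.generate_eq_word_eval[OF braid.s_closed]
  by (intro image_cong) (simp_all add: braid_of_word_eval)

abbreviation artin_gens :: "nat \<Rightarrow> nat word set set" where
  "artin_gens n \<equiv> {artin_gen n i j |i j. 1 \<le> i \<and> i < j \<and> j \<le> n}"

lemma subgroup_pure: "subgroup (carrier (pure_braid_group n)) (braid_group n)"
  by (simp add: pure_braid_group_def group_hom.subgroup_kernel[OF group_hom_braid_perm])

text \<open>The subgroup generated by the Artin generators is normal in the braid group and contains the
  squares of the standard generators.  In the quotient the standard generators satisfy the
  relations of the symmetric group, so a pure braid becomes trivial there.\<close>

lemma pure_braid_group_generated_in_braid_group:
  "carrier (pure_braid_group n) = generate (braid_group n) (artin_gens n)"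
proof
  let ?B = "braid_group n"
  let ?P = "braid.pure n"
  have P: "?P = generate ?B (artin_gens n)"
    unfolding braid.pure_def
    by (intro arg_cong[of _ _ "generate ?B"] Collect_cong ex_cong1) (auto simp: braid_a)
  show sub: "generate ?B (artin_gens n) \<subseteq> carrier (pure_braid_group n)"
    by (rule braid.generate_subgroup_incl[OF _ subgroup_pure])
      (auto intro: artin_gen_in_pure_braid_group)
  have N: "?P \<lhd> ?B"
    by (rule braid.pure_normal[OF braid_group_generated])
  interpret N: normal ?P ?B by (rule N)
  let ?Q = "?B Mod ?P"
  interpret proj: group_hom ?B ?Q "\<lambda>x. ?P #>\<^bsub>?B\<^esub> x"
    by (intro group_hom.intro group_hom_axioms.intro braid.is_group N.factorgroup_is_group
        N.r_coset_hom_Mod)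
  let ?t = "\<lambda>i. ?P #>\<^bsub>?B\<^esub> sigma n i"
  have ev: "word_eval ?Q ?t w = ?P #>\<^bsub>?B\<^esub> braid_of_word n w" if "w \<in> words {1..<n}" for w
    using proj.hom_word_eval[OF braid.s_closed that] that by (simp add: braid_of_word_eval)
  have kernel: "?P \<subseteq> kernel ?B (sym_group n) braid_perm"
    using sub unfolding P by (simp add: pure_braid_group_def)
  interpret perm: group_hom ?B "sym_group n" braid_perm by (rule group_hom_braid_perm)
  interpret Q: symmetric_relations ?Q ?t n
  proof (intro symmetric_relations.intro artin_relations.intro N.factorgroup_is_group
      artin_relations_axioms.intro symmetric_relations_axioms.intro)
    show "?t \<in> {1..<n} \<rightarrow> carrier ?Q"
      using braid.s_closed proj.hom_closed by blast
    fix i :: nat assume i: "1 \<le> i"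
    show "?t i \<otimes>\<^bsub>?Q\<^esub> ?t j = ?t j \<otimes>\<^bsub>?Q\<^esub> ?t i" if "Suc i < j" "j < n" for j
      using that i braid.far[of i j n] by (simp flip: proj.hom_mult del: mult_FactGroup)
    show "?t i \<otimes>\<^bsub>?Q\<^esub> ?t (Suc i) \<otimes>\<^bsub>?Q\<^esub> ?t i = ?t (Suc i) \<otimes>\<^bsub>?Q\<^esub> ?t i \<otimes>\<^bsub>?Q\<^esub> ?t (Suc i)" if "Suc i < n"
      using that i braid.braid[of i n] by (simp flip: proj.hom_mult del: mult_FactGroup)
  next
    fix i :: nat assume i: "0 < i" "i < n"
    have "sigma n i \<otimes>\<^bsub>?B\<^esub> sigma n i \<in> ?P"
      using i braid.a_adjacent[of i n] unfolding braid.pure_def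
      by (intro generate.incl) force
    then show "?t i \<otimes>\<^bsub>?Q\<^esub> ?t i = \<one>\<^bsub>?Q\<^esub>"
      using i N.rcos_const by (simp flip: proj.hom_mult del: mult_FactGroup)
  next
    fix u v :: "nat word" assume uv: "u \<in> words {1..<n}" "v \<in> words {1..<n}"
      and "word_eval ?Q ?t u = word_eval ?Q ?t v"
    then have "?P #>\<^bsub>?B\<^esub> braid_of_word n u = ?P #>\<^bsub>?B\<^esub> braid_of_word n v"
      by (simp add: ev)
    moreover have c: "braid_of_word n u \<in> carrier ?B" "braid_of_word n v \<in> carrier ?B"
      using uv by (auto simp: carrier_braid_group)
    ultimately have "braid_of_word n u \<in> ?P #>\<^bsub>?B\<^esub> braid_of_word n v"
      using braid.rcos_self[OF c(1) N.is_subgroup] by simp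
    then obtain h where "h \<in> ?P" "braid_of_word n u = h \<otimes>\<^bsub>?B\<^esub> braid_of_word n v"
      by (auto simp: r_coset_def)
    then have "braid_perm (braid_of_word n u) = braid_perm (braid_of_word n v)"
      using kernel c perm.hom_closed[OF c(2)] by (auto simp: kernel_def sym_group_is_group)
    then show "word_perm u = word_perm v" using uv by (simp add: braid_perm_of_word)
  qed
  show "carrier (pure_braid_group n) \<subseteq> generate ?B (artin_gens n)"
  proof
    fix x assume "x \<in> carrier (pure_braid_group n)"
    then obtain w where w: "w \<in> words {1..<n}" "x = braid_of_word n w" "braid_perm x = id"
      by (auto simp: pure_braid_group_def kernel_def carrier_braid_group sym_group_one)
    then have "word_eval ?Q ?t w = \<one>\<^bsub>?Q\<^esub>"
      by (intro Q.eval_eq_one_if_perm_trivial[of n]) (auto simp: braid_perm_of_word)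
    then have "?P #>\<^bsub>?B\<^esub> x = ?P" using w by (simp add: ev)
    moreover have "x \<in> carrier ?B" using w by (auto simp: carrier_braid_group)
    ultimately show "x \<in> generate ?B (artin_gens n)"
      using braid.rcos_self[OF _ N.is_subgroup, of x] P by simp
  qed
qed

lemma pure_braid_group_generated:
  "carrier (pure_braid_group n) = generate (pure_braid_group n) (artin_gens n)"
proof -
  have "artin_gens n \<subseteq> carrier (pure_braid_group n)"
    by (auto intro: artin_gen_in_pure_braid_group)
  then have "generate (braid_group n \<lparr>carrier := carrier (pure_braid_group n)\<rparr>) (artin_gens n)
      = generate (braid_group n) (artin_gens n)"
    by (rule braid.generate_consistent[OF _ subgroup_pure])
  moreover have "braid_group n \<lparr>carrier := carrier (pure_braid_group n)\<rparr> = pure_braid_group n"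
    by (simp add: pure_braid_group_def)
  ultimately show ?thesis using pure_braid_group_generated_in_braid_group by simp
qed

section \<open>Deletion of strands\<close>

text \<open>The set \<open>Y\<close> contains the positions of the surviving strands.  A crossing of two survivors is
  kept and renumbered by their rank, every other crossing only changes the set of positions.\<close>

fun delete_strands :: "nat set \<Rightarrow> nat word \<Rightarrow> nat word" where
  "delete_strands Y [] = []"
| "delete_strands Y ((b, i) # w) = (if i \<in> Y \<and> Suc i \<in> Y then [(b, rank Y i)] else [])
    @ delete_strands (transpose i (Suc i) -` Y) w"

lemma rank_Suc: "rank Y (Suc i) = rank Y i + (if Suc i \<in> Y then 1 else 0)"
proof -
  have "{k \<in> Y. k \<le> Suc i} = (if Suc i \<in> Y then insert (Suc i) {k \<in> Y. k \<le> i} else {k \<in> Y. k \<le> i})"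
    by (auto simp: le_Suc_eq)
  then show ?thesis by (simp add: rank_def)
qed

lemma rank_swap:
  assumes "k \<noteq> i" shows "rank (transpose i (Suc i) -` Y) k = rank Y k"
proof -
  have "{x \<in> Y. x \<le> k} = transpose i (Suc i) ` {x \<in> transpose i (Suc i) -` Y. x \<le> k}"
  proof (intro equalityI subsetI)
    fix x assume "x \<in> {x \<in> Y. x \<le> k}"
    then show "x \<in> transpose i (Suc i) ` {x \<in> transpose i (Suc i) -` Y. x \<le> k}"
      using assms by (intro image_eqI[of _ _ "transpose i (Suc i) x"]) (auto simp: transpose_def)
  next
    fix x assume "x \<in> transpose i (Suc i) ` {x \<in> transpose i (Suc i) -` Y. x \<le> k}"
    then show "x \<in> {x \<in> Y. x \<le> k}"
      using assms by (auto simp: transpose_def split: if_splits)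
  qed
  then show ?thesis
    by (simp add: rank_def card_image inj_on_subset[OF inj_swap])
qed

text \<open>If \<open>Suc i\<close> is occupied and \<open>i\<close> is not, the crossing moves that strand from
  \<open>Suc i\<close> to \<open>i\<close> without changing its rank.\<close>

lemma rank_swap_self:
  "rank (transpose i (Suc i) -` Y) i = rank Y (Suc i) - (if i \<in> Y then 1 else 0)"
  using rank_Suc[of "transpose i (Suc i) -` Y" i] rank_swap[of "Suc i" i Y] by auto

lemma rank_pos: "i \<in> Y \<Longrightarrow> 0 < rank Y i"
  by (auto simp: rank_def card_gt_0_iff)

lemma rank_mono: "i \<le> j \<Longrightarrow> rank Y i \<le> rank Y j"
  unfolding rank_def by (intro card_mono) auto

lemma rank_less: "i < j \<Longrightarrow> j \<in> Y \<Longrightarrow> rank Y i < rank Y j"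
  using rank_mono[of i "j - 1" Y] rank_Suc[of Y "j - 1"] by (cases j) auto

lemma rank_le_card: "finite Y \<Longrightarrow> rank Y i \<le> card Y"
  unfolding rank_def by (intro card_mono) auto

lemma inj_on_rank: "inj_on (rank Y) Y"
  by (rule linorder_inj_onI) (auto dest: rank_less)

lemma rank_less_card: "finite Y \<Longrightarrow> Suc i \<in> Y \<Longrightarrow> rank Y i < card Y"
  using rank_le_card[of Y "Suc i"] by (simp add: rank_Suc)

lemma swap_vimage_eq: "i \<in> Y \<Longrightarrow> Suc i \<in> Y \<Longrightarrow> transpose i (Suc i) -` Y = Y"
  by (auto simp: transpose_def split: if_splits)

lemma bij_word_perm: "bij (word_perm w)"
proof (induction w)
  case Nil
  show ?case unfolding word_perm_Nil by (rule bij_id)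
next
  case (Cons p w)
  obtain b i where p: "p = (b, i)" by force
  show ?case unfolding p word_perm_Cons by (intro bij_comp Cons.IH) simp
qed

lemma card_vimage_bij: "bij f \<Longrightarrow> card (f -` Y) = card Y"
  by (intro card_vimage_inj) (auto simp: bij_def)

lemma finite_vimage_bij: "bij f \<Longrightarrow> finite Y \<Longrightarrow> finite (f -` Y)"
  by (intro finite_vimageI) (auto simp: bij_def)

text \<open>A first part \<open>u\<close> of the word moves the survivors to the positions
  \<open>word_perm u -` Y\<close>.  On pure braids the deletion is therefore a homomorphism.\<close>

lemma delete_strands_append:
  "delete_strands Y (u @ v) = delete_strands Y u @ delete_strands (word_perm u -` Y) v"
  by (induction Y u rule: delete_strands.induct)
    (auto simp: word_perm_Nil word_perm_Cons vimage_def)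

lemma delete_strands_in_words: "finite Y \<Longrightarrow> delete_strands Y w \<in> words {1..<card Y}"
proof (induction Y w rule: delete_strands.induct)
  case (2 Y b i w)
  then have "delete_strands (transpose i (Suc i) -` Y) w \<in> words {1..<card Y}"
    using card_vimage_bij[of "transpose i (Suc i)" Y] finite_vimage_bij[of "transpose i (Suc i)" Y]
    by simp
  then show ?case
    using 2 rank_pos[of i Y] rank_less_card[of Y i] by (auto simp: Suc_le_eq)
qed simp

text \<open>For the relation of length three the number of survivors among the three strands decides: with
  three the relation is kept, with two both sides shrink to the same letter, with fewer both sides
  disappear.\<close>

lemma delete_strands_relation:
  assumes "(u, v) \<in> braid_relations" "finite Y"
  shows "(delete_strands Y u, delete_strands Y v) \<in> word_rel {1..<card Y} braid_relations"
proof -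
  have w: "delete_strands Y w \<in> words {1..<card Y}" for w
    by (rule delete_strands_in_words[OF assms(2)])
  have refl: ?thesis if "delete_strands Y u = delete_strands Y v"
    unfolding that by (rule word_rel.refl[OF w])
  have rel: ?thesis if "(delete_strands Y u, delete_strands Y v) \<in> braid_relations"
    by (rule word_rel.relation[OF that w w])
  consider (far) i j where "u = [(True, i), (True, j)]" "v = [(True, j), (True, i)]" "Suc i < j"
    | (braid) i where "u = [(True, i), (True, Suc i), (True, i)]"
        "v = [(True, Suc i), (True, i), (True, Suc i)]"
    using assms(1) by (auto simp: braid_relations_def)
  then show ?thesis
  proof cases
    case far
    have mem: "j \<in> transpose i (Suc i) -` Y \<longleftrightarrow> j \<in> Y" "Suc j \<in> transpose i (Suc i) -` Y \<longleftrightarrow> Suc j \<in> Y"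
      "i \<in> transpose j (Suc j) -` Y \<longleftrightarrow> i \<in> Y" "Suc i \<in> transpose j (Suc j) -` Y \<longleftrightarrow> Suc i \<in> Y"
      "rank (transpose i (Suc i) -` Y) j = rank Y j" "rank (transpose j (Suc j) -` Y) i = rank Y i"
      using far by (auto simp: rank_swap)
    have u: "delete_strands Y u = (if i \<in> Y \<and> Suc i \<in> Y then [(True, rank Y i)] else [])
        @ (if j \<in> Y \<and> Suc j \<in> Y then [(True, rank Y j)] else [])"
      and v: "delete_strands Y v = (if j \<in> Y \<and> Suc j \<in> Y then [(True, rank Y j)] else [])
        @ (if i \<in> Y \<and> Suc i \<in> Y then [(True, rank Y i)] else [])"
      by (simp_all only: far delete_strands.simps mem append_Nil2)
    show ?thesis
    proof (cases "i \<in> Y \<and> Suc i \<in> Y \<and> j \<in> Y \<and> Suc j \<in> Y")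
      case True
      then have "Suc (rank Y i) < rank Y j"
        using rank_less[of "Suc i" j Y] far by (simp add: rank_Suc)
      then show ?thesis using True by (intro rel) (auto simp: u v braid_relations_def)
    next
      case False
      then show ?thesis by (intro refl) (auto simp: u v)
    qed
  next
    case braid
    show ?thesis
    proof (cases "i \<in> Y \<and> Suc i \<in> Y \<and> Suc (Suc i) \<in> Y")
      case True
      then show ?thesis
        by (intro rel) (auto simp: braid swap_vimage_eq rank_Suc braid_relations_def)
    next
      case False
      then show ?thesis
        using rank_pos[of i Y]
        by (intro refl)
          (auto simp: braid transpose_def rank_swap rank_swap_self rank_Suc)
    qed
  qed
qed

lemma delete_strands_word_rel:
  assumes "(u, v) \<in> word_rel S braid_relations" "finite Y"
  shows "(delete_strands Y u, delete_strands Y v) \<in> word_rel {1..<card Y} braid_relations"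
  using assms
proof (induction arbitrary: Y)
  case (refl w)
  then show ?case by (intro word_rel.refl delete_strands_in_words)
next
  case (sym u v)
  then show ?case by (blast intro: word_rel.sym)
next
  case (trans u v w)
  then show ?case by (blast intro: word_rel.trans)
next
  case (append u u' v v')
  have "word_perm u = word_perm u'" using append.hyps(1) by (rule word_perm_cong)
  moreover have "(delete_strands (word_perm u' -` Y) v, delete_strands (word_perm u' -` Y) v')
      \<in> word_rel {1..<card Y} braid_relations"
    using append.IH(2)[of "word_perm u' -` Y"] append.prems
    by (simp add: card_vimage_bij finite_vimage_bij bij_word_perm)
  ultimately show ?case
    using append.IH(1)[OF append.prems] by (simp add: delete_strands_append word_rel.append)
next
  case (cancel i b)
  show ?case
  proof (cases "i \<in> Y \<and> Suc i \<in> Y")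
    case True
    then have "rank Y i \<in> {1..<card Y}"
      using rank_pos[of i Y] rank_less_card[of Y i] cancel.prems by (simp add: Suc_le_eq)
    then show ?thesis using True by (simp add: swap_vimage_eq word_rel.cancel)
  next
    case False
    then have "delete_strands Y [(b, i), (\<not> b, i)] = []" by auto
    then show ?thesis by (simp add: word_rel.refl)
  qed
next
  case (relation u v)
  then show ?case by (intro delete_strands_relation)
qed

lemma word_perm_artin_word: "word_perm (artin_word i j) = id"
proof -
  have "word_perm [(True, i), (True, i)] = id" by (simp add: word_perm_Cons word_perm_Nil)
  then show ?thesis
    by (simp add: artin_word_def word_perm_append word_perm_conj del: append.simps)
qed

text \<open>By induction on \<open>j\<close>, where the word is conjugated by \<open>j\<close>.  If both strands at
  \<open>j\<close> and \<open>Suc j\<close> survive, the conjugation survives as well; otherwise it only moves a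
  survivor between these two positions.\<close>

lemma delete_strands_artin_word:
  assumes "i < j" "finite Y"
  shows "(delete_strands Y (artin_word i j),
      if i \<in> Y \<and> j \<in> Y then artin_word (rank Y i) (rank Y j) else [])
    \<in> word_rel {1..<card Y} braid_relations"
  using Suc_leI[OF assms(1)] assms(2)
proof (induction j arbitrary: Y rule: dec_induct)
  case base
  have "delete_strands Y (artin_word i (Suc i))
      = (if i \<in> Y \<and> Suc i \<in> Y then artin_word (rank Y i) (rank Y (Suc i)) else [])"
    by (auto simp: artin_word_def swap_vimage_eq rank_Suc)
  then show ?case
    using delete_strands_in_words[OF base, of "artin_word i (Suc i)"] by (simp add: word_rel.refl)
next
  case (step j)
  let ?W = "word_rel {1..<card Y} braid_relations"
  let ?Y = "transpose j (Suc j) -` Y"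
  have fin: "finite ?Y" "card ?Y = card Y"
    using step.prems card_vimage_bij[of "transpose j (Suc j)" Y]
      finite_vimage_bij[of "transpose j (Suc j)" Y] by simp_all
  note IH = step.IH[OF fin(1), unfolded fin(2)]
  have split: "artin_word i (Suc j) = (True, j) # artin_word i j @ [(False, j)]"
    using step.hyps by (simp add: artin_word_def)
  have i: "i \<in> ?Y \<longleftrightarrow> i \<in> Y" "rank ?Y i = rank Y i"
    using step.hyps by (auto simp: transpose_def rank_swap)
  show ?case
  proof (cases "j \<in> Y \<and> Suc j \<in> Y")
    case True
    then have Y: "?Y = Y" by (simp add: swap_vimage_eq)
    have r: "rank Y j \<in> {1..<card Y}"
      using True rank_pos[of j Y] rank_less_card[of Y j] step.prems by (simp add: Suc_le_eq)
    have "delete_strands Y (artin_word i (Suc j))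
        = [(True, rank Y j)] @ delete_strands Y (artin_word i j) @ [(False, rank Y j)]"
      using True by (simp add: split delete_strands_append word_perm_artin_word Y)
    then have 1: "(delete_strands Y (artin_word i (Suc j)), [(True, rank Y j)]
        @ (if i \<in> Y \<and> j \<in> Y then artin_word (rank Y i) (rank Y j) else []) @ [(False, rank Y j)]) \<in> ?W"
      using IH[unfolded Y] r by (auto intro!: word_rel.append word_rel.refl simp del: append.simps)
    show ?thesis
    proof (cases "i \<in> Y")
      case i: True
      have "rank Y i < rank Y j" using step.hyps True by (intro rank_less) auto
      then have "artin_word (rank Y i) (rank Y (Suc j))
          = [(True, rank Y j)] @ artin_word (rank Y i) (rank Y j) @ [(False, rank Y j)]"
        using True by (simp add: rank_Suc artin_word_def)
      then show ?thesis using 1 i True by simp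
    next
      case False
      have "([(True, rank Y j), (\<not> True, rank Y j)], []) \<in> ?W"
        by (rule word_rel.cancel[OF r])
      then show ?thesis using 1 False by (auto intro: word_rel.trans)
    qed
  next
    case False
    then have "delete_strands Y (artin_word i (Suc j)) = delete_strands ?Y (artin_word i j)"
      by (auto simp: split delete_strands_append word_perm_artin_word)
    moreover have "(j \<in> ?Y) = (Suc j \<in> Y)" "Suc j \<in> Y \<Longrightarrow> rank ?Y j = rank Y (Suc j)"
      using False by (auto simp: rank_swap_self)
    ultimately show ?thesis using IH i by auto
  qed
qed

definition strand_deletion :: "nat set \<Rightarrow> nat word set \<Rightarrow> nat word set" where
  "strand_deletion Y A = the_elem ((\<lambda>w. braid_of_word (card Y) (delete_strands Y w)) ` A)"

lemma strand_deletion_braid_of_word: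
  assumes "w \<in> words {1..<n}" "finite Y"
  shows "strand_deletion Y (braid_of_word n w) = braid_of_word (card Y) (delete_strands Y w)"
proof -
  have "(\<lambda>w. braid_of_word (card Y) (delete_strands Y w)) ` braid_of_word n w
      = {braid_of_word (card Y) (delete_strands Y w)}"
  proof (intro equalityI subsetI)
    fix x assume "x \<in> (\<lambda>w. braid_of_word (card Y) (delete_strands Y w)) ` braid_of_word n w"
    then obtain v where v: "(w, v) \<in> word_rel {1..<n} braid_relations"
        "x = braid_of_word (card Y) (delete_strands Y v)"
      unfolding braid_of_word_def by auto
    then show "x \<in> {braid_of_word (card Y) (delete_strands Y w)}"
      using braid_of_word_eqI[OF delete_strands_word_rel[OF v(1) assms(2)]] by simp
  next
    fix x assume "x \<in> {braid_of_word (card Y) (delete_strands Y w)}"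
    then show "x \<in> (\<lambda>w. braid_of_word (card Y) (delete_strands Y w)) ` braid_of_word n w"
      using word_rel.refl[OF assms(1), of braid_relations] by (simp add: braid_of_word_def)
  qed
  then show ?thesis by (simp add: strand_deletion_def)
qed

lemma carrier_pure_braid_group:
  "carrier (pure_braid_group n) = {braid_of_word n w |w. w \<in> words {1..<n} \<and> word_perm w = id}"
  by (auto simp: pure_braid_group_def kernel_def carrier_braid_group sym_group_one
      braid_perm_of_word)

lemma mult_pure_braid_group [simp]: "mult (pure_braid_group n) = mult (braid_group n)"
  and one_pure_braid_group [simp]: "one (pure_braid_group n) = one (braid_group n)"
  by (simp_all add: pure_braid_group_def)

lemma one_braid_group: "\<one>\<^bsub>braid_group n\<^esub> = braid_of_word n []"
  by (simp add: braid_group_def presented_group_def braid_of_word_def)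

lemma strand_deletion_artin_gen:
  assumes "1 \<le> i" "i < j" "j \<le> n" "finite Y"
  shows "strand_deletion Y (artin_gen n i j) =
    (if {i, j} \<subseteq> Y then artin_gen (card Y) (rank Y i) (rank Y j) else \<one>\<^bsub>braid_group (card Y)\<^esub>)"
  using braid.artin_word_in_words[of i j n] assms
    braid_of_word_eqI[OF delete_strands_artin_word[OF assms(2,4)]]
  by (simp add: artin_gen_def strand_deletion_braid_of_word one_braid_group)

lemma strand_deletion_hom_braid:
  assumes "finite Y"
  shows "strand_deletion Y \<in> hom (pure_braid_group n) (braid_group (card Y))"
proof (rule homI)
  fix x assume "x \<in> carrier (pure_braid_group n)"
  then obtain u where u: "x = braid_of_word n u" "u \<in> words {1..<n}" "word_perm u = id"
    by (auto simp: carrier_pure_braid_group)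
  show "strand_deletion Y x \<in> carrier (braid_group (card Y))"
    using u assms delete_strands_in_words
    by (auto simp: strand_deletion_braid_of_word carrier_braid_group)
  fix y assume "y \<in> carrier (pure_braid_group n)"
  then obtain v where v: "y = braid_of_word n v" "v \<in> words {1..<n}" "word_perm v = id"
    by (auto simp: carrier_pure_braid_group)
  show "strand_deletion Y (x \<otimes>\<^bsub>pure_braid_group n\<^esub> y)
      = strand_deletion Y x \<otimes>\<^bsub>braid_group (card Y)\<^esub> strand_deletion Y y"
    using u v assms delete_strands_in_words[OF assms]
    by (simp add: braid_of_word_mult strand_deletion_braid_of_word delete_strands_append)
qed

lemma artin_gens_subset: "artin_gens n \<subseteq> carrier (pure_braid_group n)"
  by (auto intro: artin_gen_in_pure_braid_group)

lemma rank_pair_bounds: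
  assumes "{i, j} \<subseteq> Y" "i < j" "finite Y"
  shows "1 \<le> rank Y i" "rank Y i < rank Y j" "rank Y j \<le> card Y"
  using assms rank_pos[of i Y] rank_less[of i j Y] rank_le_card[of Y j] by (auto simp: Suc_le_eq)

text \<open>That pure braids are mapped to pure braids is visible on the Artin generators.\<close>

lemma strand_deletion_hom:
  assumes "finite Y"
  shows "strand_deletion Y \<in> hom (pure_braid_group n) (pure_braid_group (card Y))"
proof -
  interpret f: group_hom "pure_braid_group n" "braid_group (card Y)" "strand_deletion Y"
    by (intro group_hom.intro group_hom_axioms.intro group_pure_braid_group group_braid_group
        strand_deletion_hom_braid[OF assms])
  have "strand_deletion Y ` artin_gens n \<subseteq> carrier (pure_braid_group (card Y))"
  proof (rule image_subsetI)
    fix x assume "x \<in> artin_gens n"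
    then obtain i j where ij: "x = artin_gen n i j" "1 \<le> i" "i < j" "j \<le> n" by auto
    show "strand_deletion Y x \<in> carrier (pure_braid_group (card Y))"
      unfolding ij(1) strand_deletion_artin_gen[OF ij(2-) assms]
      using rank_pair_bounds[of i j Y] ij assms subgroup.one_closed[OF subgroup_pure]
      by (auto intro!: artin_gen_in_pure_braid_group)
  qed
  then have "generate (braid_group (card Y)) (strand_deletion Y ` artin_gens n)
      \<subseteq> carrier (pure_braid_group (card Y))"
    by (rule braid.generate_subgroup_incl[OF _ subgroup_pure])
  then have "strand_deletion Y ` carrier (pure_braid_group n) \<subseteq> carrier (pure_braid_group (card Y))"
    using f.generate_img[OF artin_gens_subset] pure_braid_group_generated[of n] by simp
  then show ?thesis
    using strand_deletion_hom_braid[OF assms, of n] by (auto simp: hom_def)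
qed


abbreviation graphic_gens :: "nat \<Rightarrow> nat set set \<Rightarrow> nat word set set set" where
  "graphic_gens n E \<equiv> {graphic_gen n E i j |i j. 1 \<le> i \<and> i < j \<and> j \<le> n}"

lemma graphic_proj_hom:
  "group_hom (pure_braid_group n) (graphic_pure_braid_group n E)
    (\<lambda>x. non_edge_subgroup n E #>\<^bsub>pure_braid_group n\<^esub> x)"
  unfolding graphic_pure_braid_group_def
  by (intro group_hom.intro group_hom_axioms.intro group_pure_braid_group
      normal.factorgroup_is_group normal.r_coset_hom_Mod non_edge_subgroup_normal)

lemma graphic_gens_subset: "graphic_gens n E \<subseteq> carrier (graphic_pure_braid_group n E)"
  by (auto intro: graphic_gen_in_carrier)

lemma graphic_group_generated:
  "carrier (graphic_pure_braid_group n E)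
    = generate (graphic_pure_braid_group n E) (graphic_gens n E)"
proof -
  interpret p: group_hom "pure_braid_group n" "graphic_pure_braid_group n E"
    "\<lambda>x. non_edge_subgroup n E #>\<^bsub>pure_braid_group n\<^esub> x"
    by (rule graphic_proj_hom)
  have "carrier (graphic_pure_braid_group n E)
      = (\<lambda>x. non_edge_subgroup n E #>\<^bsub>pure_braid_group n\<^esub> x) ` carrier (pure_braid_group n)"
    by (simp add: graphic_pure_braid_group_def carrier_FactGroup)
  also have "\<dots> = generate (graphic_pure_braid_group n E)
      ((\<lambda>x. non_edge_subgroup n E #>\<^bsub>pure_braid_group n\<^esub> x) ` artin_gens n)"
    using p.generate_img[OF artin_gens_subset] pure_braid_group_generated[of n] by simp
  also have "(\<lambda>x. non_edge_subgroup n E #>\<^bsub>pure_braid_group n\<^esub> x) ` artin_gens n = graphic_gens n E"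
    by (auto simp: graphic_gen_def)
  finally show ?thesis .
qed

text \<open>These are the relations that distinguish the graphic group from the pure braid group.\<close>

lemma graphic_gen_non_edge:
  assumes "1 \<le> i" "i < j" "j \<le> n" "{i, j} \<notin> E"
  shows "graphic_gen n E i j = \<one>\<^bsub>graphic_pure_braid_group n E\<^esub>"
proof -
  interpret N: normal "non_edge_subgroup n E" "pure_braid_group n"
    by (rule non_edge_subgroup_normal)
  have "artin_gen n i j \<in> non_edge_subgroup n E"
    unfolding non_edge_subgroup_def normal_closure_def using assms by auto
  then show ?thesis
    by (simp add: graphic_gen_def graphic_pure_braid_group_def N.rcos_const)
qed

lemma graphic_group_lift:
  assumes H: "group H" and f: "f \<in> hom (pure_braid_group n) H"
    and non_edges: "\<And>i j. 1 \<le> i \<Longrightarrow> i < j \<Longrightarrow> j \<le> n \<Longrightarrow> {i, j} \<notin> E \<Longrightarrow> f (artin_gen n i j) = \<one>\<^bsub>H\<^esub>"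
  obtains h where "h \<in> hom (graphic_pure_braid_group n E) H"
    "\<And>i j. 1 \<le> i \<Longrightarrow> i < j \<Longrightarrow> j \<le> n \<Longrightarrow> h (graphic_gen n E i j) = f (artin_gen n i j)"
proof -
  interpret f: group_hom "pure_braid_group n" H f
    by (intro group_hom.intro group_hom_axioms.intro group_pure_braid_group H f)
  have "non_edge_subgroup n E \<subseteq> kernel (pure_braid_group n) H f"
    unfolding non_edge_subgroup_def normal_closure_def
  proof (rule Inter_lower, intro CollectI conjI)
    show "kernel (pure_braid_group n) H f \<lhd> pure_braid_group n" by (rule f.normal_kernel)
    show "{artin_gen n i j |i j. 1 \<le> i \<and> i < j \<and> j \<le> n \<and> {i, j} \<notin> E} \<subseteq> kernel (pure_braid_group n) H f"
      using non_edges by (auto simp: kernel_def artin_gen_in_pure_braid_group)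
  qed
  then obtain h where "h \<in> hom (graphic_pure_braid_group n E) H"
    and "\<And>x. x \<in> carrier (pure_braid_group n) \<Longrightarrow>
      h (non_edge_subgroup n E #>\<^bsub>pure_braid_group n\<^esub> x) = f x"
    unfolding graphic_pure_braid_group_def
    by (rule f.FactGroup_universal_kernel[OF non_edge_subgroup_normal]) blast
  then show ?thesis
    by (intro that) (auto simp: graphic_gen_def artin_gen_in_pure_braid_group)
qed

lemma graphic_hom_ext:
  assumes "group H" "h \<in> hom (graphic_pure_braid_group n E) H" "k \<in> hom (graphic_pure_braid_group n E) H"
    and "\<And>i j. 1 \<le> i \<Longrightarrow> i < j \<Longrightarrow> j \<le> n \<Longrightarrow> h (graphic_gen n E i j) = k (graphic_gen n E i j)"
    and "x \<in> carrier (graphic_pure_braid_group n E)"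
  shows "h x = k x"
proof -
  interpret h: group_hom "graphic_pure_braid_group n E" H h
    by (intro group_hom.intro group_hom_axioms.intro group_graphic_pure_braid_group assms)
  show ?thesis
    by (rule h.hom_eq_on_generate[OF assms(3) graphic_gens_subset])
      (use assms graphic_group_generated in auto)
qed

lemma induced_graph_pair:
  assumes "i \<in> X" "j \<in> X"
  shows "{rank X i, rank X j} \<in> induced_graph E X \<longleftrightarrow> {i, j} \<in> E"
proof
  assume "{rank X i, rank X j} \<in> induced_graph E X"
  then obtain e where e: "e \<in> E" "e \<subseteq> X" "rank X ` {i, j} = rank X ` e"
    by (auto simp: induced_graph_def)
  then have "{i, j} = e"
    using inj_on_image_eq_iff[OF inj_on_rank, of "{i, j}" X e] assms by simp
  then show "{i, j} \<in> E" using e by simp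
next
  assume "{i, j} \<in> E"
  then have "rank X ` {i, j} \<in> induced_graph E X"
    unfolding induced_graph_def using assms by blast
  then show "{rank X i, rank X j} \<in> induced_graph E X" by simp
qed

lemma group_induced_group: "group (induced_group E X)"
  by (simp add: induced_group_def group_graphic_pure_braid_group)

text \<open>Existence comes from the deletion of the strands outside \<open>X\<close>, which respects non-edges, and
  uniqueness from the fact that the group is generated by the images of the Artin generators.\<close>

lemma restriction_hom_spec:
  assumes "finite X"
  shows "restriction_hom n E X \<in> hom (graphic_pure_braid_group n E) (induced_group E X)"
    and "restriction_hom n E X \<in> extensional (carrier (graphic_pure_braid_group n E))"
    and "\<And>i j. 1 \<le> i \<Longrightarrow> i < j \<Longrightarrow> j \<le> n \<Longrightarrow> restriction_hom n E X (graphic_gen n E i j) =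
      (if {i, j} \<subseteq> X then graphic_gen (card X) (induced_graph E X) (rank X i) (rank X j)
       else \<one>\<^bsub>induced_group E X\<^esub>)"
proof -
  let ?G = "graphic_pure_braid_group n E" and ?H = "induced_group E X"
  let ?m = "card X" and ?F = "induced_graph E X"
  let ?v = "\<lambda>i j. if {i, j} \<subseteq> X then graphic_gen ?m ?F (rank X i) (rank X j) else \<one>\<^bsub>?H\<^esub>"
  let ?P = "\<lambda>h. h \<in> hom ?G ?H \<and> h \<in> extensional (carrier ?G) \<and>
    (\<forall>i j. 1 \<le> i \<and> i < j \<and> j \<le> n \<longrightarrow> h (graphic_gen n E i j) = ?v i j)"
  interpret proj: group_hom "pure_braid_group ?m" ?H
    "\<lambda>x. non_edge_subgroup ?m ?F #>\<^bsub>pure_braid_group ?m\<^esub> x"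
    unfolding induced_group_def by (rule graphic_proj_hom)
  define f where "f x = non_edge_subgroup ?m ?F #>\<^bsub>pure_braid_group ?m\<^esub> strand_deletion X x" for x
  have f: "f \<in> hom (pure_braid_group n) ?H"
    using hom_compose[OF strand_deletion_hom[OF assms, of n] proj.homh]
    unfolding f_def [abs_def] comp_def .
  have fv: "f (artin_gen n i j) = ?v i j" if "1 \<le> i" "i < j" "j \<le> n" for i j
    using strand_deletion_artin_gen[OF that assms] proj.hom_one
    by (simp add: f_def graphic_gen_def)
  have non_edge: "f (artin_gen n i j) = \<one>\<^bsub>?H\<^esub>" if "1 \<le> i" "i < j" "j \<le> n" "{i, j} \<notin> E" for i j
    using fv[OF that(1-3)] that induced_graph_pair[of i X j E] rank_pair_bounds[of i j X] assms
      graphic_gen_non_edge[of "rank X i" "rank X j" ?m ?F]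
    by (auto simp: induced_group_def)
  obtain h where h: "h \<in> hom ?G ?H"
    "\<And>i j. 1 \<le> i \<Longrightarrow> i < j \<Longrightarrow> j \<le> n \<Longrightarrow> h (graphic_gen n E i j) = f (artin_gen n i j)"
    using graphic_group_lift[OF group_induced_group f non_edge] by blast
  let ?h = "restrict h (carrier ?G)"
  interpret G: group ?G by (rule group_graphic_pure_braid_group)
  have Ph: "?P ?h"
  proof (intro conjI allI impI)
    show "?h \<in> hom ?G ?H"
      using h(1) by (auto simp: hom_def Pi_iff)
    show "?h (graphic_gen n E i j) = ?v i j" if "1 \<le> i \<and> i < j \<and> j \<le> n" for i j
      using that h(2)[of i j] fv[of i j] graphic_gen_in_carrier[of i j n E] by simp
  qed simp
  have "\<exists>!h. ?P h"
  proof (rule ex1I[of ?P, OF Ph])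
    fix k assume k: "?P k"
    show "k = ?h"
    proof (rule extensionalityI)
      fix x assume "x \<in> carrier ?G"
      then show "k x = ?h x"
      proof (rule graphic_hom_ext[OF group_induced_group, rotated 3])
        show "k \<in> hom ?G ?H" "?h \<in> hom ?G ?H" using k Ph by blast+
        fix i j :: nat assume "1 \<le> i" "i < j" "j \<le> n"
        then have "k (graphic_gen n E i j) = ?v i j" "?h (graphic_gen n E i j) = ?v i j"
          using k Ph by blast+
        then show "k (graphic_gen n E i j) = ?h (graphic_gen n E i j)" by simp
      qed
    qed (use k in simp_all)
  qed
  then have "?P (restriction_hom n E X)"
    unfolding restriction_hom_def by (rule theI')
  then show "restriction_hom n E X \<in> hom ?G ?H"
    "restriction_hom n E X \<in> extensional (carrier ?G)"
    "\<And>i j. 1 \<le> i \<Longrightarrow> i < j \<Longrightarrow> j \<le> n \<Longrightarrow> restriction_hom n E X (graphic_gen n E i j) = ?v i j"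
    by blast+
qed

text \<open>Up to a factor of two this is the exponent of \<open>a\<^sub>i\<^sub>j\<close>: after the deletion of all
  strands but \<open>i\<close> and \<open>j\<close> it counts the letters of the remaining word in
  \<open>\<sigma>\<^sub>1\<close>, and \<open>a\<^sub>1\<^sub>2 = \<sigma>\<^sub>1\<^sup>2\<close>.\<close>

lemma edge_exponent_hom:
  assumes "1 \<le> i" "i < j" "j \<le> n" "{i, j} \<in> E"
  obtains \<chi> where "\<chi> \<in> hom (graphic_pure_braid_group n E) integer_group"
    "\<And>p q. 1 \<le> p \<Longrightarrow> p < q \<Longrightarrow> q \<le> n \<Longrightarrow>
      \<chi> (graphic_gen n E p q) = (if p = i \<and> q = j then 2 else 0)"
proof -
  have Y: "finite {i, j}" "card {i, j} = 2" "rank {i, j} i = 1" "rank {i, j} j = 2"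
  proof -
    have "{k \<in> {i, j}. k \<le> i} = {i}" "{k \<in> {i, j}. k \<le> j} = {i, j}" using assms by auto
    then show "rank {i, j} i = 1" "rank {i, j} j = 2" using assms by (simp_all add: rank_def)
  qed (use assms in auto)
  obtain e where e: "e \<in> hom (braid_group 2) integer_group"
    "\<And>w. w \<in> words {1..<2} \<Longrightarrow> e (braid_of_word 2 w) = word_eval integer_group (\<lambda>_. 1) w"
    unfolding braid_group_def braid_of_word_def
  proof (rule presented_group_lift[OF group_integer_group, of "\<lambda>_. 1" "{1..<2}" braid_relations])
    fix u v :: "nat word"
    assume "(u, v) \<in> braid_relations" "u \<in> words {1..<2}" "v \<in> words {1..<2}"
    then show "word_eval integer_group (\<lambda>_. 1) u = word_eval integer_group (\<lambda>_. 1) v"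
      by (auto simp: braid_relations_def)
  qed auto
  interpret e: group_hom "braid_group 2" integer_group e
    by (intro group_hom.intro group_hom_axioms.intro group_braid_group group_integer_group e)
  have f: "e \<circ> strand_deletion {i, j} \<in> hom (pure_braid_group n) integer_group"
    using hom_compose[OF strand_deletion_hom_braid[OF Y(1), of n, unfolded Y(2)] e(1)] .
  have "artin_word 1 2 = [(True, 1), (True, 1)]" by (simp add: artin_word_def)
  then have a12: "e (artin_gen 2 1 2) = 2" using e(2) by (simp add: artin_gen_def)
  have v: "(e \<circ> strand_deletion {i, j}) (artin_gen n p q) = (if p = i \<and> q = j then 2 else 0)"
    if "1 \<le> p" "p < q" "q \<le> n" for p q
  proof (cases "p = i \<and> q = j")
    case True
    then show ?thesis using strand_deletion_artin_gen[OF that Y(1)] Y a12 by simp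
  next
    case False
    then have "\<not> {p, q} \<subseteq> {i, j}" using that assms by auto
    then have "strand_deletion {i, j} (artin_gen n p q) = \<one>\<^bsub>braid_group 2\<^esub>"
      using strand_deletion_artin_gen[OF that Y(1)] by (simp only: if_False Y)
    then show ?thesis using False e.hom_one by simp
  qed
  have ne: "(e \<circ> strand_deletion {i, j}) (artin_gen n p q) = \<one>\<^bsub>integer_group\<^esub>"
    if "1 \<le> p" "p < q" "q \<le> n" "{p, q} \<notin> E" for p q
    using v[OF that(1-3)] that(4) assms by auto
  obtain h where "h \<in> hom (graphic_pure_braid_group n E) integer_group"
    "\<And>p q. 1 \<le> p \<Longrightarrow> p < q \<Longrightarrow> q \<le> n \<Longrightarrow>
      h (graphic_gen n E p q) = (e \<circ> strand_deletion {i, j}) (artin_gen n p q)"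
    using graphic_group_lift[OF group_integer_group f ne] by blast
  then show ?thesis using v by (intro that) auto
qed

section \<open>A free subgroup on three strands, and commutator subgroups\<close>

text \<open>The two letters act on the integer lattice by the squares of the shears that represent
  \<open>\<sigma>\<^sub>1\<close> and \<open>\<sigma>\<^sub>2\<close>; words act from right to left.\<close>

fun shear_word :: "bool word \<Rightarrow> int \<times> int \<Rightarrow> int \<times> int" where
  "shear_word [] v = v"
| "shear_word ((b, True) # w) v = (case shear_word w v of (x, y) \<Rightarrow> (x + (if b then 2 else -2) * y, y))"
| "shear_word ((b, False) # w) v = (case shear_word w v of (x, y) \<Rightarrow> (x, y + (if b then -2 else 2) * x))"

fun reduced :: "'a word \<Rightarrow> bool" where
  "reduced ((b, x) # (c, y) # w) \<longleftrightarrow> \<not> (x = y \<and> b \<noteq> c) \<and> reduced ((c, y) # w)"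
| "reduced _ \<longleftrightarrow> True"

lemma not_reduced_split:
  "\<not> reduced w \<Longrightarrow> \<exists>u b x v. w = u @ [(b, x), (\<not> b, x)] @ v"
proof (induction w rule: reduced.induct)
  case (1 b x c y w)
  show ?case
  proof (cases "x = y \<and> b \<noteq> c")
    case True
    then show ?thesis by (intro exI[of _ "[]"]) auto
  next
    case False
    then obtain u b' x' v where "(c, y) # w = u @ [(b', x'), (\<not> b', x')] @ v" using 1 by auto
    then show ?thesis by (intro exI[of _ "(b, x) # u"]) auto
  qed
qed auto

text \<open>The ping-pong regions.  Those of the two letters \<open>True\<close> and \<open>False\<close> are separated by the
  diagonals, and the sign of \<open>x * y\<close> tells a letter from its inverse.  A letter maps the regions
  of all letters except its inverse into its own region.\<close>

fun shear_cone :: "bool \<times> bool \<Rightarrow> int \<times> int \<Rightarrow> bool" where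
  "shear_cone (True, True) (x, y) \<longleftrightarrow> 0 < y \<and> y < x \<or> x < y \<and> y < 0"
| "shear_cone (False, True) (x, y) \<longleftrightarrow> 0 < y \<and> x < - y \<or> y < 0 \<and> - y < x"
| "shear_cone (True, False) (x, y) \<longleftrightarrow> 0 < x \<and> y < - x \<or> x < 0 \<and> - x < y"
| "shear_cone (False, False) (x, y) \<longleftrightarrow> 0 < x \<and> x < y \<or> y < x \<and> x < 0"

text \<open>The starting vector must lie outside of the regions, but be moved into the correct one by the last
  letter, which acts first; this is why it depends on that letter.\<close>

lemma shear_word_ping_pong:
  assumes "reduced w" "w \<noteq> []"
  shows "shear_cone (hd w) (shear_word w (if snd (last w) then (0, 1) else (1, 0)))"
  using assms
proof (induction w rule: reduced.induct)
  case (1 b x c y w)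
  let ?v = "if snd (last ((c, y) # w)) then (0, 1) else (1, 0) :: int \<times> int"
  obtain p q where pq: "shear_word ((c, y) # w) ?v = (p, q)" by force
  have cone: "shear_cone (c, y) (p, q)" using 1 pq by auto
  have "shear_cone (b, x) (shear_word ((b, x) # (c, y) # w) ?v)"
    using 1(2) cone pq
    by (cases b; cases x; cases c; cases y) (auto simp del: shear_word.simps(2,3) simp: shear_word.simps(2,3)[of _ "_ # _"])
  then show ?case by simp
next
  case ("2_2" p)
  then show ?case by (cases p; cases "fst p"; cases "snd p") auto
qed simp

lemma reduced_shear_word_eq_id:
  assumes "reduced w" "shear_word w = id" shows "w = []"
proof (rule ccontr)
  assume "w \<noteq> []"
  then have "shear_cone (hd w) (if snd (last w) then (0, 1) else (1, 0))"
    using shear_word_ping_pong[OF assms(1)] assms(2) by simp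
  then show False by (cases "hd w"; cases "fst (hd w)"; cases "snd (hd w)") (auto split: if_splits)
qed

lemma shear_word_append: "shear_word (u @ v) = shear_word u \<circ> shear_word v"
proof
  fix x show "shear_word (u @ v) x = (shear_word u \<circ> shear_word v) x"
    by (induction u x rule: shear_word.induct) auto
qed

lemma shear_word_cancel: "shear_word [(b, x), (\<not> b, x)] = id"
  by (cases b; cases x) (auto simp: fun_eq_iff)

text \<open>The two shears generate a free group: a word that acts trivially is not reduced unless it is
  empty, and a cancellation changes neither side.\<close>

lemma (in group) word_eval_eq_one_if_shear_word_id:
  assumes f: "f \<in> UNIV \<rightarrow> carrier G" and "shear_word w = id"
  shows "word_eval G f w = \<one>"
  using assms(2)
proof (induction "length w" arbitrary: w rule: less_induct)
  case less
  have words: "u \<in> words UNIV" for u :: "bool word" by (simp add: words_def)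
  show ?case
  proof (cases "reduced w")
    case True
    then show ?thesis using reduced_shear_word_eq_id less.prems by force
  next
    case False
    then obtain u b x v where w: "w = u @ [(b, x), (\<not> b, x)] @ v"
      using not_reduced_split by blast
    have "shear_word (u @ v) = id"
      using less.prems unfolding w shear_word_append shear_word_cancel by simp
    then have "word_eval G f (u @ v) = \<one>" using less.hyps[of "u @ v"] w by simp
    moreover have "f x \<in> carrier G" using f by auto
    moreover have "word_eval G f v \<in> carrier G" by (rule word_eval_closed[OF f words])
    ultimately show ?thesis
      using w by (auto simp: word_eval_append[OF f words words])
  qed
qed

text \<open>The shears that represent \<open>\<sigma>\<^sub>1\<close> (for \<open>True\<close>) and
  \<open>\<sigma>\<^sub>2\<close> (for \<open>False\<close>) if \<open>c = 1\<close>.  The opposite signs are what makes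
  them satisfy the braid relation.\<close>

definition shear_gen :: "int \<Rightarrow> bool \<Rightarrow> int \<times> int \<Rightarrow> int \<times> int" where
  "shear_gen c h = (\<lambda>(x, y). if h then (x + c * y, y) else (x, y - c * x))"

lemma shear_gen_inverse: "shear_gen c h (shear_gen (- c) h v) = v"
  by (cases v) (simp add: shear_gen_def)

lemma shear_gen_Bij: "shear_gen c h \<in> carrier (BijGroup UNIV)"
proof -
  have "bij (shear_gen c h)"
    by (rule o_bij[of "shear_gen (- c) h"])
      (use shear_gen_inverse[of c h] shear_gen_inverse[of "- c" h] in \<open>auto simp: fun_eq_iff\<close>)
  then show ?thesis by (simp add: BijGroup_def Bij_def)
qed

lemma mult_BijGroup_UNIV:
  "f \<in> carrier (BijGroup UNIV) \<Longrightarrow> g \<in> carrier (BijGroup UNIV) \<Longrightarrow> f \<otimes>\<^bsub>BijGroup UNIV\<^esub> g = f \<circ> g"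
  by (simp add: BijGroup_def compose_def fun_eq_iff)

lemma one_BijGroup_UNIV: "\<one>\<^bsub>BijGroup UNIV\<^esub> = id"
  by (simp add: BijGroup_def fun_eq_iff)

lemma inv_shear_gen: "inv\<^bsub>BijGroup UNIV\<^esub> (shear_gen c h) = shear_gen (- c) h"
proof -
  interpret B: group "BijGroup (UNIV :: (int \<times> int) set)" by (rule group_BijGroup)
  show ?thesis
    by (rule B.inv_equality)
      (use shear_gen_inverse[of "- c" h] in \<open>auto simp: mult_BijGroup_UNIV one_BijGroup_UNIV
         shear_gen_Bij fun_eq_iff\<close>)
qed

lemma word_eval_shear: "word_eval (BijGroup UNIV) (shear_gen 2) w = shear_word w"
proof (induction w)
  case Nil
  then show ?case by (simp add: one_BijGroup_UNIV fun_eq_iff)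
next
  case (Cons p w)
  obtain b h where p: "p = (b, h)" by force
  interpret B: group "BijGroup (UNIV :: (int \<times> int) set)" by (rule group_BijGroup)
  have "word_eval (BijGroup UNIV) (shear_gen 2) w \<in> carrier (BijGroup UNIV)"
    by (rule B.word_eval_closed[of _ UNIV]) (auto simp: shear_gen_Bij words_def)
  then have "word_eval (BijGroup UNIV) (shear_gen 2) (p # w)
      = shear_gen (if b then 2 else -2) h \<circ> shear_word w"
    using Cons.IH p by (simp add: mult_BijGroup_UNIV shear_gen_Bij inv_shear_gen)
  also have "\<dots> = shear_word (p # w)"
    by (cases h) (auto simp: p fun_eq_iff shear_gen_def split: prod.splits)
  finally show ?case .
qed

lemma three_strand_shear_hom:
  assumes "{1, 2} \<in> F" "{1, 3} \<in> F" "{2, 3} \<in> F"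
  obtains h where "h \<in> hom (graphic_pure_braid_group 3 F) (BijGroup (UNIV :: (int \<times> int) set))"
    "h (graphic_gen 3 F 1 2) = shear_gen 2 True" "h (graphic_gen 3 F 2 3) = shear_gen 2 False"
proof -
  let ?H = "BijGroup (UNIV :: (int \<times> int) set)"
  let ?f = "\<lambda>i::nat. shear_gen 1 (i = 1)"
  interpret H: group ?H by (rule group_BijGroup)
  have closed: "?f i \<in> carrier ?H" for i by (rule shear_gen_Bij)
  have id: "id \<in> carrier ?H" using H.one_closed by (simp add: one_BijGroup_UNIV)
  have comp: "f \<circ> g \<in> carrier ?H" if "f \<in> carrier ?H" "g \<in> carrier ?H" for f g
    using H.m_closed[OF that] that by (simp add: mult_BijGroup_UNIV)
  obtain k where k: "k \<in> hom (braid_group 3) ?H"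
    "\<And>w. w \<in> words {1..<3} \<Longrightarrow> k (braid_of_word 3 w) = word_eval ?H ?f w"
    unfolding braid_group_def braid_of_word_def
  proof (rule presented_group_lift[OF group_BijGroup, of ?f "{1..<3}" UNIV braid_relations])
    fix u v :: "nat word"
    assume uv: "(u, v) \<in> braid_relations" "u \<in> words {1..<3}" "v \<in> words {1..<3}"
    then have "u = [(True, 1), (True, 2), (True, 1)]" "v = [(True, 2), (True, 1), (True, 2)]"
      by (auto simp: braid_relations_def)
    then show "word_eval ?H ?f u = word_eval ?H ?f v"
      by (simp add: mult_BijGroup_UNIV one_BijGroup_UNIV shear_gen_Bij comp id del: comp_id)
        (simp add: fun_eq_iff shear_gen_def)
  qed (use closed in auto)
  have inc: "k \<in> hom (pure_braid_group 3) ?H"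
    using k(1) subgroup.subset[OF subgroup_pure[of 3]] by (auto simp: hom_def)
  have "k (artin_gen 3 i j) = \<one>\<^bsub>?H\<^esub>" if "1 \<le> i" "i < j" "j \<le> 3" "{i, j} \<notin> F" for i j
  proof -
    have "(i = 1 \<and> j = 2) \<or> (i = 1 \<and> j = 3) \<or> (i = 2 \<and> j = 3)" using that by auto
    then show ?thesis using that assms by auto
  qed
  then obtain h where h: "h \<in> hom (graphic_pure_braid_group 3 F) ?H"
    "\<And>i j. 1 \<le> i \<Longrightarrow> i < j \<Longrightarrow> j \<le> 3 \<Longrightarrow> h (graphic_gen 3 F i j) = k (artin_gen 3 i j)"
    using graphic_group_lift[OF group_BijGroup inc, of F] by blast
  have w: "artin_word 1 2 = [(True, 1), (True, 1)]" "artin_word 2 3 = [(True, 2), (True, 2)]"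
    by (simp_all add: artin_word_def)
  have "shear_gen 1 b \<circ> shear_gen 1 b = shear_gen 2 b" for b
    by (auto simp: fun_eq_iff shear_gen_def)
  then have "word_eval ?H ?f [(True, 1), (True, 1)] = shear_gen 2 True"
    "word_eval ?H ?f [(True, 2), (True, 2)] = shear_gen 2 False"
    by (simp_all add: mult_BijGroup_UNIV one_BijGroup_UNIV shear_gen_Bij comp id)
  moreover have "[(True, 1), (True, 1)] \<in> words {1::nat..<3}" "[(True, 2), (True, 2)] \<in> words {1::nat..<3}"
    by simp_all
  ultimately have "k (artin_gen 3 1 2) = shear_gen 2 True" "k (artin_gen 3 2 3) = shear_gen 2 False"
    unfolding artin_gen_def w using k(2) by simp_all
  then show ?thesis using h by (intro that[of h]) auto
qed

context group
begin

text \<open>A commutator does not change when its entries are multiplied by commuting central elements.\<close>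

lemma derived_generate_modulo_central:
  assumes S: "S \<subseteq> carrier G" and TS: "T \<subseteq> S" and c: "c \<in> carrier G"
    and central: "\<And>s. s \<in> S \<Longrightarrow> c \<otimes> s = s \<otimes> c"
    and factor: "\<And>s. s \<in> S \<Longrightarrow> \<exists>k \<in> generate G T. \<exists>l \<in> generate G {c}. s = k \<otimes> l"
  shows "derived G (generate G S) \<subseteq> derived G (generate G T)"
proof -
  have T: "T \<subseteq> carrier G" using S TS by auto
  have in_G: "k \<in> carrier G" if "k \<in> generate G T" for k using that T generate_in_carrier by auto
  have cl: "l \<in> carrier G" if "l \<in> generate G {c}" for l
    using that c generate_in_carrier by blast
  have comm: "l \<otimes> k = k \<otimes> l" if "l \<in> generate G {c}" "k \<in> generate G T" for l k
  proof (rule commute_generate[OF cl[OF that(1)] T _ that(2)])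
    fix t assume t: "t \<in> T"
    then have "t \<otimes> l = l \<otimes> t"
      using TS S c central by (intro commute_generate[OF _ _ _ that(1)]) auto
    then show "l \<otimes> t = t \<otimes> l" by simp
  qed
  have comm_l: "l \<otimes> l' = l' \<otimes> l" if "l \<in> generate G {c}" "l' \<in> generate G {c}" for l l'
  proof (rule commute_generate[OF cl[OF that(1)] _ _ that(2)])
    fix t assume "t \<in> {c}"
    then have "t \<otimes> l = l \<otimes> t"
      using c by (intro commute_generate[OF _ _ _ that(1)]) auto
    then show "l \<otimes> t = t \<otimes> l" by simp
  qed (use c in auto)
  \<comment> \<open>\<open>M\<close> is a subgroup that contains \<open>S\<close>.\<close>
  define M where "M = {k \<otimes> l |k l. k \<in> generate G T \<and> l \<in> generate G {c}}"
  have prod: "(k \<otimes> l) \<otimes> (k' \<otimes> l') = (k \<otimes> k') \<otimes> (l \<otimes> l')" 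
    if "k \<in> generate G T" "k' \<in> generate G T" "l \<in> generate G {c}" "l' \<in> generate G {c}" for k k' l l'
  proof -
    note g = in_G[OF that(1)] in_G[OF that(2)] cl[OF that(3)] cl[OF that(4)]
    have "l \<otimes> (k' \<otimes> l') = l \<otimes> k' \<otimes> l'" using g by (simp add: m_assoc)
    also have "\<dots> = k' \<otimes> (l \<otimes> l')" using g comm[OF that(3,2)] by (simp add: m_assoc)
    finally show ?thesis using g by (simp add: m_assoc)
  qed
  have inv_prod: "inv (k \<otimes> l) = inv k \<otimes> inv l" if "k \<in> generate G T" "l \<in> generate G {c}" for k l
    using comm[OF that(2,1)] inv_mult_group[OF cl[OF that(2)] in_G[OF that(1)]] by simp
  have inv_T: "inv k \<in> generate G T" if "k \<in> generate G T" for k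
    using generate_m_inv_closed[OF T that] .
  have inv_c: "inv l \<in> generate G {c}" if "l \<in> generate G {c}" for l
    using generate_m_inv_closed[OF _ that] c by simp
  have "x \<in> M" if "x \<in> generate G S" for x
    using that
  proof induction
    case one
    have "\<one> = \<one> \<otimes> \<one>" by simp
    then show ?case unfolding M_def using generate.one[of G T] generate.one[of G "{c}"] by blast
  next
    case (incl s)
    then show ?case unfolding M_def using factor by blast
  next
    case (inv s)
    then obtain k l where kl: "k \<in> generate G T" "l \<in> generate G {c}" "s = k \<otimes> l"
      using factor by blast
    show ?case
      unfolding M_def kl(3) inv_prod[OF kl(1,2)] using inv_T[OF kl(1)] inv_c[OF kl(2)] by blast
  next
    case (eng x y)
    then obtain k l k' l' where kl: "k \<in> generate G T" "l \<in> generate G {c}" "x = k \<otimes> l"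
        "k' \<in> generate G T" "l' \<in> generate G {c}" "y = k' \<otimes> l'"
      unfolding M_def by blast
    show ?case
      unfolding M_def kl(3,6) prod[OF kl(1,4,2,5)]
      using generate.eng[OF kl(1,4)] generate.eng[OF kl(2,5)] by blast
  qed
  then have M: "\<exists>k l. k \<in> generate G T \<and> l \<in> generate G {c} \<and> x = k \<otimes> l" if "x \<in> generate G S" for x
    using that unfolding M_def by blast
  have "derived_set G (generate G S) \<subseteq> derived_set G (generate G T)"
  proof
    fix d assume "d \<in> derived_set G (generate G S)"
    then obtain x y where xy: "x \<in> generate G S" "y \<in> generate G S" "d = x \<otimes> y \<otimes> inv x \<otimes> inv y"
      by auto
    obtain k l where kl: "k \<in> generate G T" "l \<in> generate G {c}" "x = k \<otimes> l" using M xy by blast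
    obtain k' l' where kl': "k' \<in> generate G T" "l' \<in> generate G {c}" "y = k' \<otimes> l'" using M xy by blast
    note g = in_G[OF kl(1)] in_G[OF kl'(1)] cl[OF kl(2)] cl[OF kl'(2)]
    have "d = (k \<otimes> k') \<otimes> (l \<otimes> l') \<otimes> (inv k \<otimes> inv l) \<otimes> (inv k' \<otimes> inv l')"
      unfolding xy(3) kl(3) kl'(3) inv_prod[OF kl(1,2)] inv_prod[OF kl'(1,2)]
        prod[OF kl(1) kl'(1) kl(2) kl'(2)] ..
    also have "\<dots> = (k \<otimes> k' \<otimes> inv k \<otimes> inv k') \<otimes> (l \<otimes> l' \<otimes> inv l \<otimes> inv l')"
    proof -
      have gg: "k \<otimes> k' \<in> generate G T" "l \<otimes> l' \<in> generate G {c}"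
        by (intro generate.eng kl(1) kl'(1)) (intro generate.eng kl(2) kl'(2))
      have "(k \<otimes> k') \<otimes> (l \<otimes> l') \<otimes> (inv k \<otimes> inv l) = (k \<otimes> k' \<otimes> inv k) \<otimes> (l \<otimes> l' \<otimes> inv l)"
        using prod[OF gg(1) inv_T[OF kl(1)] gg(2) inv_c[OF kl(2)]] .
      moreover have "k \<otimes> k' \<otimes> inv k \<in> generate G T" "l \<otimes> l' \<otimes> inv l \<in> generate G {c}"
        by (intro generate.eng gg(1) inv_T kl(1)) (intro generate.eng gg(2) inv_c kl(2))
      ultimately show ?thesis
        using prod[OF _ inv_T[OF kl'(1)] _ inv_c[OF kl'(2)]] by presburger
    qed
    also have "l \<otimes> l' \<otimes> inv l \<otimes> inv l' = \<one>"
      using comm_l[OF kl(2) kl'(2)] g by (simp add: m_assoc)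
    finally have "d = k \<otimes> k' \<otimes> inv k \<otimes> inv k'" using g by simp
    then show "d \<in> derived_set G (generate G T)" using kl kl' by blast
  qed
  then show ?thesis unfolding derived_def by (rule mono_generate)
qed

text \<open>Each of \<open>x\<close>, \<open>y\<close>, \<open>z\<close> is a word in the other two times the central element
  \<open>x \<otimes> y \<otimes> z\<close>.\<close>

lemma derived_three_generators:
  assumes "x \<in> carrier G" "y \<in> carrier G" "z \<in> carrier G"
    and central: "\<And>w. w \<in> {x, y, z} \<Longrightarrow> (x \<otimes> y \<otimes> z) \<otimes> w = w \<otimes> (x \<otimes> y \<otimes> z)"
  shows "derived G (generate G {x, y, z}) \<subseteq> derived G (generate G {x, y})"
    "derived G (generate G {x, y, z}) \<subseteq> derived G (generate G {x, z})"
    "derived G (generate G {x, y, z}) \<subseteq> derived G (generate G {y, z})"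
proof -
  define c where "c = x \<otimes> y \<otimes> z"
  have c: "c \<in> carrier G" using assms(1-3) by (simp add: c_def)
  have cw: "c \<otimes> w = w \<otimes> c" if "w \<in> {x, y, z}" for w unfolding c_def by (rule central[OF that])
  have gc: "c \<in> generate G {c}" "\<one> \<in> generate G {c}" by (simp_all add: generate.incl generate.one)
  have *: "derived G (generate G {x, y, z}) \<subseteq> derived G (generate G T)"
    if T: "T \<subseteq> {x, y, z}" and w: "{x, y, z} \<subseteq> insert w T" and k: "k \<in> generate G T" "w = k \<otimes> c" for T w k
  proof (rule derived_generate_modulo_central[OF _ T c cw])
    fix s assume "s \<in> {x, y, z}"
    then consider "s = w" | "s \<in> T" using w by blast
    then show "\<exists>k \<in> generate G T. \<exists>l \<in> generate G {c}. s = k \<otimes> l"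
    proof cases
      case 1
      show ?thesis unfolding 1 by (intro bexI[OF _ k(1)] bexI[OF _ gc(1)] k(2))
    next
      case 2
      then have "s \<in> carrier G" using T assms(1-3) by auto
      then show ?thesis
        by (intro bexI[OF _ generate.incl[OF 2]] bexI[OF _ gc(2)]) simp
    qed
  qed (use assms(1-3) in auto)
  have cx: "c \<otimes> inv y = inv y \<otimes> c" "c \<otimes> inv z = inv z \<otimes> c"
    using commute_inv[OF cw[of y] c assms(2)] commute_inv[OF cw[of z] c assms(3)] by simp_all
  have z: "z = inv y \<otimes> inv x \<otimes> c"
    using assms(1-3) by (simp add: c_def m_assoc)
  have y: "y = inv x \<otimes> inv z \<otimes> c"
    using assms(1-3) c cx(2) [symmetric] by (simp add: m_assoc) (simp add: c_def m_assoc)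
  have "x = c \<otimes> (inv z \<otimes> inv y)"
    using assms(1-3) by (simp add: c_def m_assoc)
  then have x: "x = inv z \<otimes> inv y \<otimes> c"
    using commute_mult[OF cx(2,1)] assms(2,3) c by simp
  show "derived G (generate G {x, y, z}) \<subseteq> derived G (generate G {x, y})"
    by (rule *[OF _ _ _ z]) (blast, blast, intro generate.eng generate.inv, simp_all)
  show "derived G (generate G {x, y, z}) \<subseteq> derived G (generate G {x, z})"
    by (rule *[OF _ _ _ y]) (blast, blast, intro generate.eng generate.inv, simp_all)
  show "derived G (generate G {x, y, z}) \<subseteq> derived G (generate G {y, z})"
    by (rule *[OF _ _ _ x]) (blast, blast, intro generate.eng generate.inv, simp_all)
qed

lemma comm_group_if_generators_commute:
  assumes "carrier G = generate G S" "S \<subseteq> carrier G" "\<And>x y. x \<in> S \<Longrightarrow> y \<in> S \<Longrightarrow> x \<otimes> y = y \<otimes> x"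
  shows "comm_group G"
proof (rule group_comm_groupI)
  fix x y assume xy: "x \<in> carrier G" "y \<in> carrier G"
  have "s \<otimes> y = y \<otimes> s" if "s \<in> S" for s
  proof (rule commute_generate[OF _ assms(2) assms(3)[OF that]])
    show "s \<in> carrier G" "y \<in> generate G S" using that assms(1,2) xy by auto
  qed
  then have "y \<otimes> x = x \<otimes> y"
    using commute_generate[OF xy(2) assms(2), of x] xy(1) assms(1) by simp
  then show "x \<otimes> y = y \<otimes> x" by simp
qed

end

fun exponent_sum :: "'a \<Rightarrow> 'a word \<Rightarrow> int" where
  "exponent_sum a [] = 0"
| "exponent_sum a ((b, x) # w) = (if x = a then if b then 1 else -1 else 0) + exponent_sum a w"

lemma (in comm_group) word_eval_eq_finprod:
  assumes "finite S" "f \<in> S \<rightarrow> carrier G" "w \<in> words S"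
  shows "word_eval G f w = (\<Otimes>a\<in>S. f a [^] exponent_sum a w)"
  using assms(3)
proof (induction w)
  case Nil
  then show ?case by simp
next
  case (Cons p w)
  obtain b x where p: "p = (b, x)" by force
  have x: "x \<in> S" "w \<in> words S" using Cons.prems p by auto
  have fx: "f a \<in> carrier G" if "a \<in> S" for a using that assms by auto
  let ?d = "\<lambda>a. if x = a then if b then 1 else -1 else 0 :: int"
  have "(\<Otimes>a\<in>S. f a [^] exponent_sum a (p # w)) = (\<Otimes>a\<in>S. f a [^] ?d a \<otimes> f a [^] exponent_sum a w)"
    using fx by (intro finprod_cong) (auto simp: p int_pow_mult simp del: int_pow_0)
  also have "\<dots> = (\<Otimes>a\<in>S. f a [^] ?d a) \<otimes> (\<Otimes>a\<in>S. f a [^] exponent_sum a w)"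
    using fx by (intro finprod_multf) auto
  also have "(\<Otimes>a\<in>S. f a [^] ?d a) = (\<Otimes>a\<in>S. if x = a then f x [^] (if b then 1 else -1 :: int) else \<one>)"
    using fx by (intro finprod_cong) (auto simp: simp_implies_def)
  also have "\<dots> = f x [^] (if b then 1 else -1 :: int)"
    using finprod_singleton[of x S "\<lambda>_. f x [^] (if b then 1 else -1 :: int)"] x assms(1) fx by simp
  also have "\<dots> = (if b then f x else inv (f x))"
    using fx[OF x(1)] by (simp add: int_pow_neg)
  finally show ?case using Cons.IH[OF x(2)] p by simp
qed

lemma word_eval_integer_group:
  "word_eval integer_group (\<lambda>x. if x = a then c else 0) w = c * exponent_sum a w"
proof (induction w)
  case (Cons p w)
  then show ?case by (cases p) (auto simp: algebra_simps)
qed simp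

section \<open>Relations in graphic pure braid groups\<close>

lemma (in group) commute_if_product_commutes:
  assumes "x \<otimes> y \<otimes> y = y \<otimes> (x \<otimes> y)" "x \<in> carrier G" "y \<in> carrier G"
  shows "x \<otimes> y = y \<otimes> x"
proof -
  have "(x \<otimes> y) \<otimes> y = (y \<otimes> x) \<otimes> y" using assms by (simp add: m_assoc)
  then show ?thesis using assms right_cancel[of y "x \<otimes> y" "y \<otimes> x"] by simp
qed

text \<open>Edges are unordered, but the Artin generators are indexed by increasing pairs.\<close>

definition edge_gen :: "nat \<Rightarrow> nat set set \<Rightarrow> nat set \<Rightarrow> nat word set set" where
  "edge_gen n E e = graphic_gen n E (Min e) (Max e)"

lemma edge_gen_pair: "i < j \<Longrightarrow> edge_gen n E {i, j} = graphic_gen n E i j"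
  by (simp add: edge_gen_def)

definition edges_in :: "nat set \<Rightarrow> nat set set" where
  "edges_in T = {e. e \<subseteq> T \<and> card e = 2}"

lemma sorted_triple:
  fixes T :: "nat set"
  assumes "card T = 3"
  obtains i j k where "i < j" "j < k" "T = {i, j, k}"
proof -
  obtain x y z where T: "T = {x, y, z}" and xyz: "x \<noteq> y" "y \<noteq> z" "x \<noteq> z"
    using assms by (auto simp: card_3_iff)
  have that': thesis if "a < b" "b < c" "{x, y, z} = {a, b, c}" for a b c
    using \<open>\<And>i j k. \<lbrakk>i < j; j < k; T = {i, j, k}\<rbrakk> \<Longrightarrow> thesis\<close> that T by blast
  consider "x < y" "y < z" | "x < z" "z < y" | "y < x" "x < z" | "y < z" "z < x"
    | "z < x" "x < y" | "z < y" "y < x"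
    using xyz by linarith
  then show thesis
  proof cases
    case 1
    then show thesis by (rule that') auto
  next
    case 2
    then show thesis by (rule that') auto
  next
    case 3
    then show thesis by (rule that') auto
  next
    case 4
    then show thesis by (rule that') auto
  next
    case 5
    then show thesis by (rule that') auto
  next
    case 6
    then show thesis by (rule that') auto
  qed
qed

lemma edges_in_triple:
  assumes "i < j" "j < (k::nat)"
  shows "edges_in {i, j, k} = {{i, j}, {i, k}, {j, k}}"
proof (intro equalityI subsetI)
  fix e assume "e \<in> edges_in {i, j, k}"
  then obtain a b where "e = {a, b}" "a \<noteq> b" "a \<in> {i, j, k}" "b \<in> {i, j, k}"
    by (auto simp: edges_in_def card_2_iff)
  then show "e \<in> {{i, j}, {i, k}, {j, k}}" by auto
qed (use assms in \<open>auto simp: edges_in_def\<close>)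

text \<open>Two different triangles share at most one edge.\<close>

lemma two_edges_outside:
  fixes T T' :: "nat set"
  assumes "card T = 3" "card T' = 3" "T \<noteq> T'"
  obtains e f where "e \<in> edges_in T" "f \<in> edges_in T" "e \<noteq> f" "\<not> e \<subseteq> T'" "\<not> f \<subseteq> T'"
proof -
  have fin: "finite T" "finite T'" using assms(1,2) by (simp_all add: card_ge_0_finite)
  have "\<not> T \<subseteq> T'" using assms card_subset_eq[OF fin(2), of T] by auto
  then obtain p where p: "p \<in> T" "p \<notin> T'" by blast
  then have "card (T - {p}) = 2" using assms by simp
  then obtain q r where qr: "T - {p} = {q, r}" "q \<noteq> r" by (auto simp: card_2_iff)
  then have "q \<in> T" "r \<in> T" "q \<noteq> p" "r \<noteq> p" by blast+
  then show ?thesis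
    using p qr(2) by (intro that[of "{p, q}" "{p, r}"]) (simp_all add: edges_in_def doubleton_eq_iff)
qed

context
  fixes n :: nat and E :: "nat set set"
begin

interpretation G: group "graphic_pure_braid_group n E" by (rule group_graphic_pure_braid_group)

private abbreviation (input) G where "G \<equiv> graphic_pure_braid_group n E"
private abbreviation (input) g where "g \<equiv> graphic_gen n E"
private abbreviation (input) p where "p x \<equiv> non_edge_subgroup n E #>\<^bsub>pure_braid_group n\<^esub> x"

interpretation proj: group_hom "pure_braid_group n" G p by (rule graphic_proj_hom)

lemma pure_closed:
  assumes "x \<in> carrier (pure_braid_group n)" "y \<in> carrier (pure_braid_group n)"
  shows "x \<otimes>\<^bsub>braid_group n\<^esub> y \<in> carrier (pure_braid_group n)"
    "inv\<^bsub>braid_group n\<^esub> x \<in> carrier (pure_braid_group n)"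
    "braid.conjg n x y \<in> carrier (pure_braid_group n)"
  using assms subgroup.m_closed[OF subgroup_pure] subgroup.m_inv_closed[OF subgroup_pure]
  by (simp_all add: braid.conjg_def)

lemma inv_pure:
  assumes "x \<in> carrier (pure_braid_group n)"
  shows "inv\<^bsub>pure_braid_group n\<^esub> x = inv\<^bsub>braid_group n\<^esub> x"
  using braid.m_inv_consistent[OF subgroup_pure assms] by (simp add: pure_braid_group_def)

lemma proj_mult:
  assumes "x \<in> carrier (pure_braid_group n)" "y \<in> carrier (pure_braid_group n)"
  shows "p (x \<otimes>\<^bsub>braid_group n\<^esub> y) = p x \<otimes>\<^bsub>G\<^esub> p y"
  using proj.hom_mult[OF assms] unfolding mult_pure_braid_group .

lemma proj_inv:
  assumes "x \<in> carrier (pure_braid_group n)"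
  shows "p (inv\<^bsub>braid_group n\<^esub> x) = inv\<^bsub>G\<^esub> p x"
  using proj.hom_inv[OF assms] by (simp add: inv_pure assms)

lemma proj_conj:
  assumes "x \<in> carrier (pure_braid_group n)" "y \<in> carrier (pure_braid_group n)"
  shows "p (braid.conjg n x y) = G.conjg (p x) (p y)"
  using assms by (simp add: braid.conjg_def G.conjg_def proj_mult proj_inv pure_closed)

lemma graphic_gen_eq: "g i j = p (artin_gen n i j)"
  by (simp add: graphic_gen_def)

lemma graphic_gen_closed [simp]: "0 < i \<Longrightarrow> i < j \<Longrightarrow> j \<le> n \<Longrightarrow> g i j \<in> carrier G"
  by (rule graphic_gen_in_carrier) auto

lemma artin_gen_closed [simp]:
  "0 < i \<Longrightarrow> i < j \<Longrightarrow> j \<le> n \<Longrightarrow> artin_gen n i j \<in> carrier (pure_braid_group n)"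
  by (rule artin_gen_in_pure_braid_group) auto

lemma graphic_central_product:
  assumes "0 < i" "i < j" "j < k" "k \<le> n" "w \<in> {g i j, g i k, g j k}"
  shows "g i j \<otimes>\<^bsub>G\<^esub> g i k \<otimes>\<^bsub>G\<^esub> g j k \<otimes>\<^bsub>G\<^esub> w = w \<otimes>\<^bsub>G\<^esub> (g i j \<otimes>\<^bsub>G\<^esub> g i k \<otimes>\<^bsub>G\<^esub> g j k)"
proof -
  let ?B = "braid_group n"
  let ?x = "artin_gen n i j" and ?y = "artin_gen n i k" and ?z = "artin_gen n j k"
  have P: "?x \<in> carrier (pure_braid_group n)" "?y \<in> carrier (pure_braid_group n)"
    "?z \<in> carrier (pure_braid_group n)"
    using assms by auto
  have A: "braid.a n i j = ?x" "braid.a n i k = ?y" "braid.a n j k = ?z"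
    using assms(1-4) by (simp_all add: braid_a)
  have cp: "\<forall>v \<in> {?x, ?y, ?z}. ?x \<otimes>\<^bsub>?B\<^esub> ?y \<otimes>\<^bsub>?B\<^esub> ?z \<otimes>\<^bsub>?B\<^esub> v = v \<otimes>\<^bsub>?B\<^esub> (?x \<otimes>\<^bsub>?B\<^esub> ?y \<otimes>\<^bsub>?B\<^esub> ?z)"
    using braid.central_product_a[OF assms(1-4)] unfolding A braid.central_product_def .
  have key: "p ?x \<otimes>\<^bsub>G\<^esub> p ?y \<otimes>\<^bsub>G\<^esub> p ?z \<otimes>\<^bsub>G\<^esub> p v = p v \<otimes>\<^bsub>G\<^esub> (p ?x \<otimes>\<^bsub>G\<^esub> p ?y \<otimes>\<^bsub>G\<^esub> p ?z)"
    if v: "v \<in> {?x, ?y, ?z}" for v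
  proof -
    have vP: "v \<in> carrier (pure_braid_group n)" using v P by blast
    have "p (?x \<otimes>\<^bsub>?B\<^esub> ?y \<otimes>\<^bsub>?B\<^esub> ?z \<otimes>\<^bsub>?B\<^esub> v) = p (v \<otimes>\<^bsub>?B\<^esub> (?x \<otimes>\<^bsub>?B\<^esub> ?y \<otimes>\<^bsub>?B\<^esub> ?z))"
      by (rule arg_cong[of _ _ p]) (rule cp[rule_format, OF v])
    then show ?thesis by (simp only: P vP proj_mult pure_closed)
  qed
  from assms(5) have "w \<in> p ` {?x, ?y, ?z}" by (simp add: graphic_gen_eq)
  then obtain v where v: "v \<in> {?x, ?y, ?z}" "w = p v" by (rule imageE)
  show ?thesis
    using key[OF v(1)] unfolding v(2) graphic_gen_eq .
qed

text \<open>Only the pair \<open>{i, k}\<close>, \<open>{j, l}\<close> needs a missing edge.  If one of \<open>{i, j}\<close>,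
  \<open>{j, k}\<close>, \<open>{k, l}\<close> is missing, the conjugating element in one of the crossing relations is
  trivial.  If \<open>{i, l}\<close> is missing, the central product of \<open>i, j, l\<close> shows that
  \<open>g i j\<close> commutes with \<open>g j l\<close>, so the conjugation by \<open>g i j\<close> can be undone.\<close>

lemma graphic_gen_commute_disjoint_sorted:
  assumes "0 < i" "i < j" "j < k" "k < l" "l \<le> n"
    and missing: "{i, j} \<notin> E \<or> {i, k} \<notin> E \<or> {i, l} \<notin> E \<or> {j, k} \<notin> E \<or> {j, l} \<notin> E \<or> {k, l} \<notin> E"
  shows "g i j \<otimes>\<^bsub>G\<^esub> g k l = g k l \<otimes>\<^bsub>G\<^esub> g i j"
    and "g i l \<otimes>\<^bsub>G\<^esub> g j k = g j k \<otimes>\<^bsub>G\<^esub> g i l"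
    and "g i k \<otimes>\<^bsub>G\<^esub> g j l = g j l \<otimes>\<^bsub>G\<^esub> g i k"
proof -
  let ?a = "artin_gen n"
  have P: "?a i j \<in> carrier (pure_braid_group n)" "?a i k \<in> carrier (pure_braid_group n)"
    "?a i l \<in> carrier (pure_braid_group n)" "?a j k \<in> carrier (pure_braid_group n)"
    "?a j l \<in> carrier (pure_braid_group n)" "?a k l \<in> carrier (pure_braid_group n)"
    using assms(1-5) by auto
  have c: "g i j \<in> carrier G" "g i k \<in> carrier G" "g i l \<in> carrier G" "g j k \<in> carrier G"
    "g j l \<in> carrier G" "g k l \<in> carrier G"
    using assms(1-5) by auto
  have A: "braid.a n i j = ?a i j" "braid.a n i k = ?a i k" "braid.a n i l = ?a i l"
    "braid.a n j k = ?a j k" "braid.a n j l = ?a j l" "braid.a n k l = ?a k l"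
    using assms(1-5) by (simp_all add: braid_a)
  have eq: "p x \<otimes>\<^bsub>G\<^esub> p y = p y \<otimes>\<^bsub>G\<^esub> p x"
    if "x \<otimes>\<^bsub>braid_group n\<^esub> y = y \<otimes>\<^bsub>braid_group n\<^esub> x"
      "x \<in> carrier (pure_braid_group n)" "y \<in> carrier (pure_braid_group n)" for x y
    using arg_cong[OF that(1), of p] unfolding proj_mult[OF that(2,3)] proj_mult[OF that(3,2)] .
  show "g i j \<otimes>\<^bsub>G\<^esub> g k l = g k l \<otimes>\<^bsub>G\<^esub> g i j"
    unfolding graphic_gen_eq
    by (rule eq[OF braid.a_commute_separate[of i j k l n, unfolded A] P(1,6)]) (use assms in auto)
  show "g i l \<otimes>\<^bsub>G\<^esub> g j k = g j k \<otimes>\<^bsub>G\<^esub> g i l"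
    unfolding graphic_gen_eq
    by (rule eq[OF braid.a_commute_nested[of i j k l n, unfolded A] P(3,4)]) (use assms in auto)
  have cr: "braid.crossing n (?a i j) (?a i k) (?a j k) (?a j l) (?a k l)"
    using braid.crossing_a[of i j k l n] assms(1-5) unfolding A by simp
  note cr = cr[unfolded braid.crossing_def]
  have C1: "g i k \<otimes>\<^bsub>G\<^esub> G.conjg (inv\<^bsub>G\<^esub> g k l) (g j l) = G.conjg (inv\<^bsub>G\<^esub> g k l) (g j l) \<otimes>\<^bsub>G\<^esub> g i k"
    using eq[OF cr[THEN conjunct1]] P by (simp add: pure_closed proj_conj proj_inv graphic_gen_eq)
  have C2: "G.conjg (g i j) (g i k) \<otimes>\<^bsub>G\<^esub> g j l = g j l \<otimes>\<^bsub>G\<^esub> G.conjg (g i j) (g i k)"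
    using eq[OF cr[THEN conjunct2, THEN conjunct1]] P
    by (simp add: pure_closed proj_conj proj_inv graphic_gen_eq)
  have C3: "G.conjg (inv\<^bsub>G\<^esub> g j k) (g i k) \<otimes>\<^bsub>G\<^esub> g j l = g j l \<otimes>\<^bsub>G\<^esub> G.conjg (inv\<^bsub>G\<^esub> g j k) (g i k)"
    using eq[OF cr[THEN conjunct2, THEN conjunct2]] P
    by (simp add: pure_closed proj_conj proj_inv graphic_gen_eq)
  have one: "g u v = \<one>\<^bsub>G\<^esub>" if "0 < u" "u < v" "v \<le> n" "{u, v} \<notin> E" for u v
    using graphic_gen_non_edge[of u v n E] that by simp
  have conj_one: "G.conjg \<one>\<^bsub>G\<^esub> x = x" if "x \<in> carrier G" for x
    using that by (simp add: G.conjg_def)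
  show "g i k \<otimes>\<^bsub>G\<^esub> g j l = g j l \<otimes>\<^bsub>G\<^esub> g i k"
    using missing
  proof (elim disjE)
    assume "{i, j} \<notin> E"
    then have "g i j = \<one>\<^bsub>G\<^esub>" using assms(1-5) by (intro one) auto
    then show ?thesis using C2 c by (simp add: conj_one)
  next
    assume "{i, k} \<notin> E"
    then have "g i k = \<one>\<^bsub>G\<^esub>" using assms(1-5) by (intro one) auto
    then show ?thesis using c by simp
  next
    assume "{i, l} \<notin> E"
    then have "g i l = \<one>\<^bsub>G\<^esub>" using assms(1-5) by (intro one) auto
    then have il: "g i l = \<one>\<^bsub>G\<^esub>" .
    have "g i j \<otimes>\<^bsub>G\<^esub> g i l \<otimes>\<^bsub>G\<^esub> g j l \<otimes>\<^bsub>G\<^esub> g j l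
        = g j l \<otimes>\<^bsub>G\<^esub> (g i j \<otimes>\<^bsub>G\<^esub> g i l \<otimes>\<^bsub>G\<^esub> g j l)"
      by (rule graphic_central_product[OF assms(1,2) less_trans[OF assms(3,4)] assms(5)
            insertI2[OF insertI2[OF insertI1]]])
    then have "g i j \<otimes>\<^bsub>G\<^esub> g j l = g j l \<otimes>\<^bsub>G\<^esub> g i j"
      unfolding il G.r_one[OF c(1)] by (rule G.commute_if_product_commutes[OF _ c(1,5)])
    then have fixed: "G.conjg (g i j) (g j l) = g j l" using c by (simp add: G.conj_eq_self_iff)
    show ?thesis
      using G.conj_commute[OF C2, of "inv\<^bsub>G\<^esub> g i j"] G.conj_inv_cancel(1)[OF c(1,2)]
        G.conj_inv_cancel(1)[OF c(1,5)] c unfolding fixed by simp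
  next
    assume "{j, k} \<notin> E"
    then have "g j k = \<one>\<^bsub>G\<^esub>" using assms(1-5) by (intro one) auto
    then show ?thesis using C3 c by (simp add: conj_one)
  next
    assume "{j, l} \<notin> E"
    then have "g j l = \<one>\<^bsub>G\<^esub>" using assms(1-5) by (intro one) auto
    then show ?thesis using c by simp
  next
    assume "{k, l} \<notin> E"
    then have "g k l = \<one>\<^bsub>G\<^esub>" using assms(1-5) by (intro one) auto
    then show ?thesis using C1 c by (simp add: conj_one)
  qed
qed

text \<open>A central product with one trivial factor makes the other two factors commute.\<close>

lemma graphic_gen_commute_adjacent_sorted:
  assumes "0 < i" "i < j" "j < k" "k \<le> n"
  shows "{j, k} \<notin> E \<Longrightarrow> g i j \<otimes>\<^bsub>G\<^esub> g i k = g i k \<otimes>\<^bsub>G\<^esub> g i j"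
    and "{i, k} \<notin> E \<Longrightarrow> g i j \<otimes>\<^bsub>G\<^esub> g j k = g j k \<otimes>\<^bsub>G\<^esub> g i j"
    and "{i, j} \<notin> E \<Longrightarrow> g i k \<otimes>\<^bsub>G\<^esub> g j k = g j k \<otimes>\<^bsub>G\<^esub> g i k"
proof -
  have c: "g i j \<in> carrier G" "g i k \<in> carrier G" "g j k \<in> carrier G"
    using assms by auto
  note central = graphic_central_product[OF assms]
  have one: "g u v = \<one>\<^bsub>G\<^esub>" if "0 < u" "u < v" "v \<le> n" "{u, v} \<notin> E" for u v
    using graphic_gen_non_edge[of u v n E] that by simp
  show "g i j \<otimes>\<^bsub>G\<^esub> g i k = g i k \<otimes>\<^bsub>G\<^esub> g i j" if "{j, k} \<notin> E"
  proof (rule G.commute_if_product_commutes[OF _ c(1,2)])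
    have trivial: "g j k = \<one>\<^bsub>G\<^esub>" using that assms by (intro one) auto
    show "g i j \<otimes>\<^bsub>G\<^esub> g i k \<otimes>\<^bsub>G\<^esub> g i k = g i k \<otimes>\<^bsub>G\<^esub> (g i j \<otimes>\<^bsub>G\<^esub> g i k)"
      using central[OF insertI2[OF insertI1]] unfolding trivial G.r_one[OF G.m_closed[OF c(1,2)]] .
  qed
  show "g i j \<otimes>\<^bsub>G\<^esub> g j k = g j k \<otimes>\<^bsub>G\<^esub> g i j" if "{i, k} \<notin> E"
  proof (rule G.commute_if_product_commutes[OF _ c(1,3)])
    have trivial: "g i k = \<one>\<^bsub>G\<^esub>" using that assms by (intro one) auto
    show "g i j \<otimes>\<^bsub>G\<^esub> g j k \<otimes>\<^bsub>G\<^esub> g j k = g j k \<otimes>\<^bsub>G\<^esub> (g i j \<otimes>\<^bsub>G\<^esub> g j k)"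
      using central[OF insertI2[OF insertI2[OF insertI1]]] unfolding trivial G.r_one[OF c(1)] .
  qed
  show "g i k \<otimes>\<^bsub>G\<^esub> g j k = g j k \<otimes>\<^bsub>G\<^esub> g i k" if "{i, j} \<notin> E"
  proof (rule G.commute_if_product_commutes[OF _ c(2,3)])
    have trivial: "g i j = \<one>\<^bsub>G\<^esub>" using that assms by (intro one) auto
    show "g i k \<otimes>\<^bsub>G\<^esub> g j k \<otimes>\<^bsub>G\<^esub> g j k = g j k \<otimes>\<^bsub>G\<^esub> (g i k \<otimes>\<^bsub>G\<^esub> g j k)"
      using central[OF insertI2[OF insertI2[OF insertI1]]] unfolding trivial G.l_one[OF c(2)] .
  qed
qed

end

section \<open>Triangles of a graph without 4-cliques\<close>

lemma card_quadruple:
  "a \<noteq> b \<Longrightarrow> a \<noteq> c \<Longrightarrow> a \<noteq> d \<Longrightarrow> b \<noteq> c \<Longrightarrow> b \<noteq> d \<Longrightarrow> c \<noteq> d \<Longrightarrow> card {a, b, c, d} = 4"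
  by simp

locale k4_free_graph =
  fixes n :: nat and E :: "nat set set"
  assumes graph: "E \<subseteq> [{1..n}]\<^bsup>2\<^esup>"
    and K4_free: "\<not> (\<exists>X. X \<subseteq> {1..n} \<and> card X = 4 \<and> clique X E)"
begin

abbreviation (input) G where "G \<equiv> graphic_pure_braid_group n E"
abbreviation (input) A where "A \<equiv> edge_gen n E"

sublocale G: group G by (rule group_graphic_pure_braid_group)

lemma edge_cases:
  assumes "e \<in> E"
  obtains i j where "e = {i, j}" "0 < i" "i < j" "j \<le> n"
proof -
  have "e \<subseteq> {1..n}" "card e = 2" using assms graph by (auto simp: nsets_def)
  then obtain a b where ab: "e = {a, b}" "a \<noteq> b" "1 \<le> a" "a \<le> n" "1 \<le> b" "b \<le> n"
    by (auto simp: card_2_iff)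
  show thesis
  proof (cases "a < b")
    case True
    then show thesis using ab by (intro that[of a b]) auto
  next
    case False
    then show thesis using ab by (intro that[of b a]) auto
  qed
qed

lemma finite_E: "finite E"
  using graph finite_imp_finite_nsets finite_subset by blast

lemma A_closed: "e \<in> E \<Longrightarrow> A e \<in> carrier G"
  by (erule edge_cases) (simp add: edge_gen_pair)

lemma A_image_closed: "A \<in> E \<rightarrow> carrier G"
  using A_closed by blast

lemma carrier_G: "carrier G = generate G (A ` E)"
proof
  have "generate G (graphic_gens n E) \<subseteq> generate G (A ` E)"
  proof (rule G.generate_subgroup_incl)
    show "subgroup (generate G (A ` E)) G"
      by (rule G.generate_is_subgroup) (use A_closed in blast)
    show "graphic_gens n E \<subseteq> generate G (A ` E)"
    proof
      fix x assume "x \<in> graphic_gens n E"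
      then obtain i j where ij: "x = graphic_gen n E i j" "1 \<le> i" "i < j" "j \<le> n" by blast
      show "x \<in> generate G (A ` E)"
      proof (cases "{i, j} \<in> E")
        case True
        then have "x \<in> A ` E" using ij by (metis edge_gen_pair imageI)
        then show ?thesis by (rule generate.incl)
      next
        case False
        then have "x = \<one>\<^bsub>G\<^esub>" using ij graphic_gen_non_edge by simp
        then show ?thesis using generate.one by metis
      qed
    qed
  qed
  then show "carrier G \<subseteq> generate G (A ` E)" unfolding graphic_group_generated .
  show "generate G (A ` E) \<subseteq> carrier G"
    by (rule G.generate_incl) (use A_closed in blast)
qed

lemma quadruple_missing_edge:
  assumes "card {i, j, k, l} = 4" "{i, j, k, l} \<subseteq> {1..n}"
  shows "{i, j} \<notin> E \<or> {i, k} \<notin> E \<or> {i, l} \<notin> E \<or> {j, k} \<notin> E \<or> {j, l} \<notin> E \<or> {k, l} \<notin> E"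
proof -
  have "\<not> clique {i, j, k, l} E" using K4_free assms by blast
  then obtain v w where vw: "v \<in> {i, j, k, l}" "w \<in> {i, j, k, l}" "v \<noteq> w" "{v, w} \<notin> E"
    unfolding clique_def by blast
  then show ?thesis by (elim insertE emptyE) (simp_all add: insert_commute)
qed

lemma A_commute_disjoint:
  assumes "e \<in> E" "f \<in> E" "e \<inter> f = {}"
  shows "A e \<otimes>\<^bsub>G\<^esub> A f = A f \<otimes>\<^bsub>G\<^esub> A e"
proof -
  obtain a b where e: "e = {a, b}" "0 < a" "a < b" "b \<le> n" using assms(1) by (rule edge_cases)
  obtain c d where f: "f = {c, d}" "0 < c" "c < d" "d \<le> n" using assms(2) by (rule edge_cases)
  have ne: "a \<noteq> c" "a \<noteq> d" "b \<noteq> c" "b \<noteq> d" using assms(3) e f by auto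
  have missing: "{i, j} \<notin> E \<or> {i, k} \<notin> E \<or> {i, l} \<notin> E \<or> {j, k} \<notin> E \<or> {j, l} \<notin> E \<or> {k, l} \<notin> E"
    if "0 < i" "i < j" "j < k" "k < l" "l \<le> n" for i j k l
    by (rule quadruple_missing_edge) (use that in auto)
  note comm = graphic_gen_commute_disjoint_sorted[OF _ _ _ _ _ missing]
  have A: "A e = graphic_gen n E a b" "A f = graphic_gen n E c d"
    using e f by (simp_all add: edge_gen_pair)
  consider "b < c" | "a < c" "c < b" "b < d" | "a < c" "d < b" | "d < a"
    | "c < a" "a < d" "d < b" | "c < a" "b < d"
    using e f ne by linarith
  then show ?thesis
  proof cases
    case 1
    then show ?thesis unfolding A using comm(1)[of a b c d] e f by simp
  next
    case 2
    then show ?thesis unfolding A using comm(3)[of a c b d] e f by simp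
  next
    case 3
    then show ?thesis unfolding A using comm(2)[of a c d b] e f by simp
  next
    case 4
    then show ?thesis unfolding A using comm(1)[of c d a b] e f by simp
  next
    case 5
    then show ?thesis unfolding A using comm(3)[of c a d b] e f by simp
  next
    case 6
    then show ?thesis unfolding A using comm(2)[of c a b d] e f by simp
  qed
qed

lemma A_commute_adjacent:
  assumes "{a, b} \<in> E" "{a, c} \<in> E" "{b, c} \<notin> E" "b \<noteq> c"
  shows "A {a, b} \<otimes>\<^bsub>G\<^esub> A {a, c} = A {a, c} \<otimes>\<^bsub>G\<^esub> A {a, b}"
proof -
  have sorted: "A {a, b} \<otimes>\<^bsub>G\<^esub> A {a, c} = A {a, c} \<otimes>\<^bsub>G\<^esub> A {a, b}"
    if ab: "{a, b} \<in> E" and ac: "{a, c} \<in> E" and bc: "{b, c} \<notin> E" "b < c" for b c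
  proof -
    obtain i j where "{a, b} = {i, j}" "0 < i" "i < j" "j \<le> n" using ab by (rule edge_cases)
    then have b: "a \<noteq> b" "0 < a" "0 < b" "a \<le> n" "b \<le> n" by (auto simp: doubleton_eq_iff)
    obtain i j where "{a, c} = {i, j}" "0 < i" "i < j" "j \<le> n" using ac by (rule edge_cases)
    then have c: "a \<noteq> c" "c \<le> n" by (auto simp: doubleton_eq_iff)
    consider "a < b" | "b < a" "a < c" | "c < a" using b c bc by linarith
    then show ?thesis
    proof cases
      case 1
      then show ?thesis
        using graphic_gen_commute_adjacent_sorted(1)[of a b c n E] b c bc by (simp add: edge_gen_pair)
    next
      case 2
      then show ?thesis
        using graphic_gen_commute_adjacent_sorted(2)[of b a c n E] b c bc
        by (simp add: edge_gen_pair insert_commute[of a b])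
    next
      case 3
      then show ?thesis
        using graphic_gen_commute_adjacent_sorted(3)[of b c a n E] b c bc
        by (simp add: edge_gen_pair insert_commute[of a b] insert_commute[of a c])
    qed
  qed
  show ?thesis
  proof (cases "b < c")
    case True
    then show ?thesis using sorted assms by blast
  next
    case False
    then show ?thesis using sorted[of c b] assms by (simp add: insert_commute[of b c])
  qed
qed

definition triangles :: "nat set set" where
  "triangles = {T. T \<subseteq> {1..n} \<and> card T = 3 \<and> clique T E}"

lemma finite_triangles: "finite triangles"
  unfolding triangles_def by (rule finite_subset[of _ "Pow {1..n}"]) auto

lemma triangle_cases:
  assumes "T \<in> triangles"
  obtains i j k where "T = {i, j, k}" "0 < i" "i < j" "j < k" "k \<le> n"
    "{i, j} \<in> E" "{i, k} \<in> E" "{j, k} \<in> E"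
proof -
  have T: "T \<subseteq> {1..n}" "card T = 3" "clique T E" using assms by (auto simp: triangles_def)
  obtain i j k where ijk: "i < j" "j < k" "T = {i, j, k}" using T(2) by (rule sorted_triple)
  show thesis
    by (rule that[OF ijk(3)]) (use T ijk in \<open>auto simp: clique_def\<close>)
qed

lemma edges_in_triangle:
  assumes "T \<in> triangles" "e \<in> edges_in T"
  shows "e \<in> E"
proof -
  obtain i j k where T: "T = {i, j, k}" "i < j" "j < k" "{i, j} \<in> E" "{i, k} \<in> E" "{j, k} \<in> E"
    using assms(1) by (rule triangle_cases)
  then show ?thesis using assms(2) by (auto simp: edges_in_triple)
qed

text \<open>Two edges without a common triangle are disjoint, or they share a vertex and their other
  endpoints are not adjacent.\<close>

lemma A_commute_if_no_triangle:
  assumes "e \<in> E" "f \<in> E" "e \<noteq> f" "e \<union> f \<notin> triangles"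
  shows "A e \<otimes>\<^bsub>G\<^esub> A f = A f \<otimes>\<^bsub>G\<^esub> A e"
proof (cases "e \<inter> f = {}")
  case True
  then show ?thesis using assms A_commute_disjoint by blast
next
  case False
  then obtain a where a: "a \<in> e" "a \<in> f" by blast
  obtain i j where e: "e = {i, j}" "0 < i" "i < j" "j \<le> n" using assms(1) by (rule edge_cases)
  obtain k l where f: "f = {k, l}" "0 < k" "k < l" "l \<le> n" using assms(2) by (rule edge_cases)
  obtain b where b: "e = {a, b}" "a \<noteq> b" using a e by auto
  obtain c where c: "f = {a, c}" "a \<noteq> c" using a f by auto
  have "b \<noteq> c" using assms(3) b c by blast
  have "{b, c} \<notin> E"
  proof
    assume bc: "{b, c} \<in> E"
    have "e \<union> f \<subseteq> {1..n}" using e f by auto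
    moreover have "card (e \<union> f) = 3" using b c \<open>b \<noteq> c\<close> by (simp add: insert_commute)
    moreover have "clique (e \<union> f) E"
      using assms(1,2) b c bc unfolding clique_def
      by (auto simp: insert_commute)
    ultimately show False using assms(4) by (simp add: triangles_def)
  qed
  then show ?thesis using A_commute_adjacent[of a b c] assms b c \<open>b \<noteq> c\<close> by simp
qed

text \<open>If \<open>h\<close> is disjoint from \<open>T\<close>, it commutes with all edges of \<open>T\<close>.  If they share the
  vertex \<open>a\<close>, then \<open>h\<close> commutes with the edge of \<open>T\<close> opposite to \<open>a\<close>; and since the
  remaining endpoint of \<open>h\<close> is not adjacent to all of \<open>T\<close>, also with one of the edges at
  \<open>a\<close>.\<close>

lemma edge_outside_triangle:
  assumes "T \<in> triangles" "h \<in> E" "\<not> h \<subseteq> T"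
  obtains e f where "e \<in> edges_in T" "f \<in> edges_in T" "e \<noteq> f"
    "A h \<otimes>\<^bsub>G\<^esub> A e = A e \<otimes>\<^bsub>G\<^esub> A h" "A h \<otimes>\<^bsub>G\<^esub> A f = A f \<otimes>\<^bsub>G\<^esub> A h"
proof -
  have T: "T \<subseteq> {1..n}" "card T = 3" "clique T E" using assms(1) by (auto simp: triangles_def)
  obtain i j where ij: "h = {i, j}" "0 < i" "i < j" "j \<le> n" using assms(2) by (rule edge_cases)
  have comm: "A h \<otimes>\<^bsub>G\<^esub> A e = A e \<otimes>\<^bsub>G\<^esub> A h" if "e \<in> edges_in T" "h \<union> e \<notin> triangles" for e
  proof (rule A_commute_if_no_triangle[OF assms(2) edges_in_triangle[OF assms(1) that(1)] _ that(2)])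
    show "h \<noteq> e" using that(1) assms(3) by (auto simp: edges_in_def)
  qed
  obtain b where b: "b \<in> h" "b \<notin> T" using assms(3) by blast
  then obtain a where h: "h = {a, b}" "a \<noteq> b" using ij by auto
  show thesis
  proof (cases "a \<in> T")
    case False
    obtain p q r where pqr: "T = {p, q, r}" "p < q" "q < r" using T(2) sorted_triple by metis
    have no: "h \<union> {x, y} \<notin> triangles" if "x \<in> T" "y \<in> T" "x \<noteq> y" for x y
    proof -
      have "card {a, b, x, y} = 4" by (rule card_quadruple) (use that False b(2) h(2) in blast)+
      then show ?thesis using h by (simp add: triangles_def insert_commute)
    qed
    show thesis
      by (rule that[of "{p, q}" "{p, r}"])
        (use pqr no in \<open>auto simp: edges_in_triple doubleton_eq_iff intro!: comm\<close>)
  next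
    case True
    then have "card (T - {a}) = 2" using T(2) by simp
    then obtain r s where rs: "T - {a} = {r, s}" "r \<noteq> s" by (auto simp: card_2_iff)
    then have mem: "r \<in> T" "s \<in> T" "r \<noteq> a" "s \<noteq> a" "r \<noteq> b" "s \<noteq> b" using b by blast+
    have TE: "{a, r} \<in> E" "{a, s} \<in> E" "{r, s} \<in> E"
      using T(3) mem True rs unfolding clique_def by metis+
    have edges: "{r, s} \<in> edges_in T" "{a, r} \<in> edges_in T" "{a, s} \<in> edges_in T"
      using mem True rs(2) by (auto simp: edges_in_def)
    have card4: "card {a, b, r, s} = 4" by (rule card_quadruple) (use mem(3-) rs(2) h(2) in blast)+
    have "h \<subseteq> {1..n}" using ij by simp
    then have "{a, b, r, s} \<subseteq> {1..n}" using T(1) mem(1,2) unfolding h(1) by blast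
    then have "{b, r} \<notin> E \<or> {b, s} \<notin> E"
      using quadruple_missing_edge[OF card4] TE assms(2) unfolding h(1) by blast
    moreover have "h \<union> {r, s} \<notin> triangles"
      using card4 h by (simp add: triangles_def insert_commute)
    moreover have "h \<union> {a, x} \<notin> triangles" if "{b, x} \<notin> E" "b \<noteq> x" for x
      using that h by (auto simp: triangles_def clique_def)
    ultimately have rs_no: "h \<union> {r, s} \<notin> triangles"
      and "h \<union> {a, r} \<notin> triangles \<or> h \<union> {a, s} \<notin> triangles"
      using mem by blast+
    then show thesis
    proof (elim disjE)
      assume "h \<union> {a, r} \<notin> triangles"
      moreover have "{r, s} \<noteq> {a, r}" using mem rs(2) by blast
      ultimately show thesis by (intro that[OF edges(1,2)] comm edges rs_no)
    next
      assume "h \<union> {a, s} \<notin> triangles"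
      moreover have "{r, s} \<noteq> {a, s}" using mem rs(2) by blast
      ultimately show thesis by (intro that[OF edges(1,3)] comm edges rs_no)
    qed
  qed
qed

definition H :: "nat set \<Rightarrow> nat word set set set" where
  "H T = generate G (A ` edges_in T)"

abbreviation D :: "nat set \<Rightarrow> nat word set set set" where
  "D T \<equiv> derived G (H T)"

lemma A_edges_closed: "T \<in> triangles \<Longrightarrow> A ` edges_in T \<subseteq> carrier G"
  using edges_in_triangle A_closed by blast

lemma H_closed: "T \<in> triangles \<Longrightarrow> H T \<subseteq> carrier G"
  unfolding H_def by (rule G.generate_incl[OF A_edges_closed])

lemma D_closed: "T \<in> triangles \<Longrightarrow> D T \<subseteq> carrier G"
  by (rule G.derived_in_carrier[OF H_closed])

lemma D_subgroup: "T \<in> triangles \<Longrightarrow> subgroup (D T) G"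
  by (rule G.derived_is_subgroup[OF H_closed])

lemma D_two_edges:
  assumes "T \<in> triangles" "e \<in> edges_in T" "f \<in> edges_in T" "e \<noteq> f"
  shows "D T \<subseteq> derived G (generate G {A e, A f})"
proof -
  obtain i j k where T: "T = {i, j, k}" "0 < i" "i < j" "j < k" "k \<le> n"
    using assms(1) by (rule triangle_cases)
  let ?g = "graphic_gen n E"
  have edges: "edges_in T = {{i, j}, {i, k}, {j, k}}" using T by (simp add: edges_in_triple)
  have A: "A {i, j} = ?g i j" "A {i, k} = ?g i k" "A {j, k} = ?g j k"
    using T by (simp_all add: edge_gen_pair)
  have H: "H T = generate G {?g i j, ?g i k, ?g j k}"
    unfolding H_def edges by (simp add: A)
  have c: "?g i j \<in> carrier G" "?g i k \<in> carrier G" "?g j k \<in> carrier G"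
    using T by simp_all
  note D = G.derived_three_generators[OF c graphic_central_product[OF T(2-5)], folded H]
  have ef: "e = {i, j} \<or> e = {i, k} \<or> e = {j, k}" "f = {i, j} \<or> f = {i, k} \<or> f = {j, k}"
    using assms edges by auto
  have "{A e, A f} = {?g i j, ?g i k} \<or> {A e, A f} = {?g i j, ?g j k} \<or> {A e, A f} = {?g i k, ?g j k}"
    using ef assms(4) A by (elim disjE) (simp_all add: insert_commute)
  then show ?thesis using D by (elim disjE) simp_all
qed

lemma D_two_edges_generate:
  assumes "T \<in> triangles" "e \<in> edges_in T" "f \<in> edges_in T" "e \<noteq> f"
  shows "D T \<subseteq> generate G {A e, A f}"
proof -
  have "A e \<in> carrier G" "A f \<in> carrier G" using assms edges_in_triangle A_closed by blast+
  then have "subgroup (generate G {A e, A f}) G" by (intro G.generate_is_subgroup) simp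
  then have "derived G (generate G {A e, A f}) \<subseteq> generate G {A e, A f}"
    by (intro G.derived_incl) simp_all
  then show ?thesis using D_two_edges[OF assms] by (rule order.trans[rotated])
qed

lemma A_centralises_D:
  assumes "T \<in> triangles" "h \<in> E" "\<not> h \<subseteq> T" "d \<in> D T"
  shows "A h \<otimes>\<^bsub>G\<^esub> d = d \<otimes>\<^bsub>G\<^esub> A h"
proof -
  obtain e f where ef: "e \<in> edges_in T" "f \<in> edges_in T" "e \<noteq> f"
    "A h \<otimes>\<^bsub>G\<^esub> A e = A e \<otimes>\<^bsub>G\<^esub> A h" "A h \<otimes>\<^bsub>G\<^esub> A f = A f \<otimes>\<^bsub>G\<^esub> A h"
    using assms(1-3) by (rule edge_outside_triangle)
  have closed: "A e \<in> carrier G" "A f \<in> carrier G"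
    using assms(1) ef(1,2) edges_in_triangle A_closed by blast+
  have d: "d \<in> generate G {A e, A f}" using D_two_edges_generate[OF assms(1) ef(1-3)] assms(4) by blast
  show ?thesis
    by (rule G.commute_generate[OF A_closed[OF assms(2)] _ _ d]) (use closed ef(4,5) in blast)+
qed

text \<open>Two edges of \<open>T'\<close> generate a group that contains \<open>D T'\<close>, and they can be chosen
  outside of \<open>T\<close>.\<close>

lemma D_commute:
  assumes "T \<in> triangles" "T' \<in> triangles" "T \<noteq> T'" "d \<in> D T" "d' \<in> D T'"
  shows "d \<otimes>\<^bsub>G\<^esub> d' = d' \<otimes>\<^bsub>G\<^esub> d"
proof -
  have "card T' = 3" "card T = 3" "T' \<noteq> T" using assms by (auto simp: triangles_def)
  then obtain e f where ef: "e \<in> edges_in T'" "f \<in> edges_in T'" "e \<noteq> f" "\<not> e \<subseteq> T" "\<not> f \<subseteq> T"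
    by (rule two_edges_outside)
  have E: "e \<in> E" "f \<in> E" using assms(2) ef(1,2) edges_in_triangle by blast+
  have d': "d' \<in> generate G {A e, A f}" using D_two_edges_generate[OF assms(2) ef(1-3)] assms(5) by blast
  have dc: "d \<in> carrier G" using D_closed assms(1,4) by blast
  show ?thesis
  proof (rule G.commute_generate[OF dc _ _ d'])
    show "{A e, A f} \<subseteq> carrier G" using E A_closed by blast
    fix y assume "y \<in> {A e, A f}"
    then obtain h where "y = A h" "h \<in> E" "\<not> h \<subseteq> T" using E ef by blast
    then show "d \<otimes>\<^bsub>G\<^esub> y = y \<otimes>\<^bsub>G\<^esub> d" using A_centralises_D[OF assms(1) _ _ assms(4)] by metis
  qed
qed

lemma H_normalises_D:
  assumes "T \<in> triangles" "u \<in> H T" "d \<in> D T"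
  shows "G.conjg u d \<in> D T"
proof -
  have H: "subgroup (H T) G"
    unfolding H_def by (rule G.generate_is_subgroup[OF A_edges_closed[OF assms(1)]])
  have "D T \<subseteq> H T" by (rule G.derived_incl[OF subset_refl H])
  then have d: "d \<in> H T" using assms(3) by blast
  have c: "u \<in> carrier G" "d \<in> carrier G" using d assms H_closed by blast+
  have "u \<otimes>\<^bsub>G\<^esub> d \<otimes>\<^bsub>G\<^esub> inv\<^bsub>G\<^esub> u \<otimes>\<^bsub>G\<^esub> inv\<^bsub>G\<^esub> d \<in> D T"
    unfolding derived_def using assms(2) d by (intro generate.incl) blast
  then have "u \<otimes>\<^bsub>G\<^esub> d \<otimes>\<^bsub>G\<^esub> inv\<^bsub>G\<^esub> u \<otimes>\<^bsub>G\<^esub> inv\<^bsub>G\<^esub> d \<otimes>\<^bsub>G\<^esub> d \<in> D T"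
    using assms(3) by (rule subgroup.m_closed[OF D_subgroup[OF assms(1)]])
  then show ?thesis using c by (simp add: G.conjg_def G.m_assoc)
qed

text \<open>The commutator subgroup of the graphic group is contained in \<open>N\<close>, see
  \<open>A_commutator_in_N\<close>.\<close>

definition N :: "nat word set set set" where
  "N = generate G (\<Union>T\<in>triangles. D T)"

lemma D_union_closed: "(\<Union>T\<in>triangles. D T) \<subseteq> carrier G"
  using D_closed by blast

text \<open>A generator either belongs to \<open>H T\<close>, which normalises \<open>D T\<close>, or centralises \<open>D T\<close>.\<close>

lemma N_normal: "N \<lhd> G"
proof (rule G.normal_if_generators[OF _ _ carrier_G])
  let ?U = "\<Union>T\<in>triangles. D T"
  show "subgroup N G"
    unfolding N_def by (rule G.generate_is_subgroup[OF D_union_closed])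
  show "A ` E \<subseteq> carrier G" using A_closed by blast
  have one: "G.conjg (A h) d \<in> generate G ?U \<and> G.conjg (inv\<^bsub>G\<^esub> A h) d \<in> generate G ?U"
    if h: "h \<in> E" and d: "d \<in> ?U" for h d
  proof -
    obtain T where T: "T \<in> triangles" "d \<in> D T" using d by blast
    have dc: "d \<in> carrier G" using T D_closed by blast
    have "G.conjg (A h) d \<in> D T \<and> G.conjg (inv\<^bsub>G\<^esub> A h) d \<in> D T"
    proof (cases "h \<subseteq> T")
      case True
      then have "h \<in> edges_in T" using h graph by (auto simp: edges_in_def nsets_def)
      then have "A h \<in> H T" "inv\<^bsub>G\<^esub> A h \<in> H T"
        unfolding H_def by (auto intro: generate.incl generate.inv)
      then show ?thesis using H_normalises_D[OF T(1) _ T(2)] by blast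
    next
      case False
      have "G.conjg (A h) d = d"
        using A_centralises_D[OF T(1) h False T(2)] G.conj_eq_self_iff[OF A_closed[OF h] dc] by blast
      moreover from this have "G.conjg (inv\<^bsub>G\<^esub> A h) d = d"
        using G.conj_inv_cancel(1)[OF A_closed[OF h] dc] by metis
      ultimately show ?thesis using T(2) by metis
    qed
    then show ?thesis using T(1) by (meson UN_I generate.incl)
  qed
  fix g x assume g: "g \<in> A ` E" and x: "x \<in> N"
  then obtain h where h: "g = A h" "h \<in> E" by blast
  have gc: "g \<in> carrier G" using h A_closed by blast
  have "G.conjg g x \<in> generate G ?U"
    by (rule G.conj_generate[OF gc D_union_closed _ D_union_closed x[unfolded N_def]])
      (use one[OF h(2)] h(1) in blast)
  moreover have "G.conjg (inv\<^bsub>G\<^esub> g) x \<in> generate G ?U"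
    by (rule G.conj_generate[OF G.inv_closed[OF gc] D_union_closed _ D_union_closed x[unfolded N_def]])
      (use one[OF h(2)] h(1) in blast)
  ultimately show "G.conjg g x \<in> N \<and> G.conjg (inv\<^bsub>G\<^esub> g) x \<in> N" unfolding N_def by blast
qed

lemma A_commutator_in_N:
  assumes "e \<in> E" "f \<in> E"
  shows "A e \<otimes>\<^bsub>G\<^esub> A f \<otimes>\<^bsub>G\<^esub> inv\<^bsub>G\<^esub> A e \<otimes>\<^bsub>G\<^esub> inv\<^bsub>G\<^esub> A f \<in> N"
proof (cases "e \<noteq> f \<and> e \<union> f \<in> triangles")
  case True
  have "card e = 2" "card f = 2" using assms graph by (auto simp: nsets_def)
  then have "e \<in> edges_in (e \<union> f)" "f \<in> edges_in (e \<union> f)" by (auto simp: edges_in_def)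
  then have "A e \<in> H (e \<union> f)" "A f \<in> H (e \<union> f)"
    unfolding H_def by (auto intro: generate.incl)
  then have "A e \<otimes>\<^bsub>G\<^esub> A f \<otimes>\<^bsub>G\<^esub> inv\<^bsub>G\<^esub> A e \<otimes>\<^bsub>G\<^esub> inv\<^bsub>G\<^esub> A f \<in> D (e \<union> f)"
    unfolding derived_def by (intro generate.incl) blast
  then show ?thesis
    unfolding N_def using True by (intro generate.incl) blast
next
  case False
  have c: "A e \<in> carrier G" "A f \<in> carrier G" using assms A_closed by blast+
  have "A e \<otimes>\<^bsub>G\<^esub> A f = A f \<otimes>\<^bsub>G\<^esub> A e"
    using False assms A_commute_if_no_triangle by blast
  then have "A e \<otimes>\<^bsub>G\<^esub> A f \<otimes>\<^bsub>G\<^esub> inv\<^bsub>G\<^esub> A e \<otimes>\<^bsub>G\<^esub> inv\<^bsub>G\<^esub> A f = \<one>\<^bsub>G\<^esub>"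
    using c by (simp add: G.m_assoc)
  then show ?thesis unfolding N_def using generate.one by metis
qed

end

section \<open>The kernel of the product of the restrictions\<close>

lemma (in group) generate_Un_commuting:
  assumes K: "subgroup K G" and U: "U \<subseteq> carrier G"
    and comm: "\<And>k u. k \<in> K \<Longrightarrow> u \<in> U \<Longrightarrow> k \<otimes> u = u \<otimes> k"
    and "x \<in> generate G (K \<union> U)"
  shows "\<exists>k\<in>K. \<exists>u\<in>generate G U. x = k \<otimes> u"
  using assms(4)
proof induction
  case one
  show ?case
    by (rule bexI[OF _ subgroup.one_closed[OF K]], rule bexI[OF _ generate.one]) simp
next
  case (incl h)
  then show ?case
  proof
    assume h: "h \<in> K"
    then have "h \<in> carrier G" using subgroup.mem_carrier[OF K] by blast
    then show ?case by (intro bexI[OF _ h] bexI[OF _ generate.one]) simp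
  next
    assume h: "h \<in> U"
    then have "h \<in> carrier G" using U by blast
    then show ?case
      by (intro bexI[OF _ subgroup.one_closed[OF K]] bexI[OF _ generate.incl[OF h]]) simp
  qed
next
  case (inv h)
  then show ?case
  proof
    assume h: "h \<in> K"
    then have "h \<in> carrier G" using subgroup.mem_carrier[OF K] by blast
    then show ?case
      by (intro bexI[OF _ subgroup.m_inv_closed[OF K h]] bexI[OF _ generate.one]) simp
  next
    assume h: "h \<in> U"
    then have "h \<in> carrier G" using U by blast
    then show ?case
      by (intro bexI[OF _ subgroup.one_closed[OF K]] bexI[OF _ generate.inv[OF h]]) simp
  qed
next
  case (eng x y)
  then obtain k u k' u' where *: "k \<in> K" "u \<in> generate G U" "x = k \<otimes> u"
    "k' \<in> K" "u' \<in> generate G U" "y = k' \<otimes> u'" by blast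
  have c: "k \<in> carrier G" "k' \<in> carrier G" "u \<in> carrier G" "u' \<in> carrier G"
    using * subgroup.mem_carrier[OF K] generate_in_carrier[OF U] by blast+
  have "k' \<otimes> u = u \<otimes> k'"
    by (rule commute_generate[OF c(2) U comm[OF *(4)] *(2)])
  then have "u \<otimes> (k' \<otimes> u') = k' \<otimes> (u \<otimes> u')"
    using c by (simp add: m_assoc [symmetric])
  then have "x \<otimes> y = (k \<otimes> k') \<otimes> (u \<otimes> u')"
    using c *(3,6) by (simp add: m_assoc)
  then show ?case
    by (intro bexI[OF _ subgroup.m_closed[OF K *(1,4)]] bexI[OF _ generate.eng[OF *(2,5)]])
qed

lemma (in group_hom) hom_one_on_generate:
  assumes S: "S \<subseteq> carrier G" and one: "\<And>x. x \<in> S \<Longrightarrow> h x = \<one>\<^bsub>H\<^esub>" and x: "x \<in> generate G S"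
  shows "h x = \<one>\<^bsub>H\<^esub>"
proof -
  have "S \<subseteq> kernel G H h" using S one by (auto simp: kernel_def)
  then have "generate G S \<subseteq> kernel G H h"
    by (rule G.generate_subgroup_incl[OF _ subgroup_kernel])
  then show ?thesis using x by (auto simp: kernel_def)
qed

context k4_free_graph
begin

abbreviation (input) \<rho> where "\<rho> \<equiv> restriction_hom n E"

lemma rho_group_hom: "finite X \<Longrightarrow> group_hom G (induced_group E X) (\<rho> X)"
  by (intro group_hom.intro group_hom_axioms.intro G.is_group group_induced_group restriction_hom_spec)

lemma max_clique_finite: "X \<in> max_cliques n E \<Longrightarrow> finite X"
  unfolding max_cliques_def by (auto intro: finite_subset)

lemma clique_in_max_clique:
  assumes "C \<subseteq> {1..n}" "clique C E"
  obtains X where "X \<in> max_cliques n E" "C \<subseteq> X"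
proof -
  let ?S = "{X. X \<subseteq> {1..n} \<and> clique X E}"
  have "finite ?S" by (rule finite_subset[of _ "Pow {1..n}"]) auto
  moreover have "C \<in> ?S" using assms by simp
  ultimately obtain X where X: "X \<in> ?S" "C \<subseteq> X" "\<forall>Y\<in>?S. X \<subseteq> Y \<longrightarrow> X = Y"
    using finite_has_maximal2[of ?S C] by blast
  then have "X \<in> max_cliques n E" unfolding max_cliques_def by blast
  then show thesis using X(2) by (rule that)
qed

text \<open>A larger clique would contain a clique with four elements.\<close>

lemma triangle_in_max_cliques:
  assumes "T \<in> triangles" shows "T \<in> max_cliques n E"
proof -
  have T: "T \<subseteq> {1..n}" "card T = 3" "clique T E" using assms by (auto simp: triangles_def)
  have "Y = T" if Y: "Y \<subseteq> {1..n}" "clique Y E" "T \<subseteq> Y" for Y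
  proof (rule ccontr)
    assume "Y \<noteq> T"
    then obtain y where y: "y \<in> Y" "y \<notin> T" using Y(3) by blast
    have "finite T" using T(1) finite_subset by blast
    then have "card (insert y T) = 4" using y T(2) by simp
    moreover have "insert y T \<subseteq> {1..n}" using y Y T by blast
    moreover have "clique (insert y T) E"
      using Y(2,3) y(1) unfolding clique_def by blast
    ultimately show False using K4_free by blast
  qed
  then show ?thesis using T unfolding max_cliques_def by blast
qed

lemma rho_A_outside:
  assumes "e \<in> E" "\<not> e \<subseteq> X" "finite X" shows "\<rho> X (A e) = \<one>\<^bsub>induced_group E X\<^esub>"
proof -
  obtain i j where e: "e = {i, j}" "0 < i" "i < j" "j \<le> n" using assms(1) by (rule edge_cases)
  have "\<rho> X (graphic_gen n E i j) = \<one>\<^bsub>induced_group E X\<^esub>"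
    using restriction_hom_spec(3)[OF assms(3), of i j n E] e(2-4)
    unfolding if_not_P[OF assms(2)[unfolded e(1)]] by simp
  then show ?thesis using e(1,3) by (simp add: edge_gen_pair)
qed

text \<open>The exponent homomorphism of \<open>e\<close> factors through the restriction to every clique
  containing \<open>e\<close>, hence through the restriction to some maximal clique.\<close>

lemma exponent_sum_eq_zero:
  assumes w: "w \<in> words E" and ker: "\<And>X. X \<in> max_cliques n E \<Longrightarrow> \<rho> X (word_eval G A w) = \<one>\<^bsub>induced_group E X\<^esub>"
    and e: "e \<in> E"
  shows "exponent_sum e w = 0"
proof -
  obtain i j where ij: "e = {i, j}" "0 < i" "i < j" "j \<le> n" using e by (rule edge_cases)
  have "e \<subseteq> {1..n}" "clique e E"
    using ij e by (auto simp: clique_def insert_commute)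
  then obtain X where X: "X \<in> max_cliques n E" "e \<subseteq> X" by (rule clique_in_max_clique)
  have fin: "finite X" using X(1) by (rule max_clique_finite)
  have mem: "i \<in> X" "j \<in> X" using X(2) ij by auto
  let ?F = "induced_graph E X" and ?m = "card X"
  have F: "{rank X i, rank X j} \<in> ?F" using induced_graph_pair[OF mem, of E] e ij by simp
  obtain \<chi> where \<chi>: "\<chi> \<in> hom (induced_group E X) integer_group"
    "\<And>p q. 1 \<le> p \<Longrightarrow> p < q \<Longrightarrow> q \<le> ?m \<Longrightarrow>
      \<chi> (graphic_gen ?m ?F p q) = (if p = rank X i \<and> q = rank X j then 2 else 0)"
    using edge_exponent_hom[OF rank_pair_bounds[of i j X] F] mem ij(3) fin
    unfolding induced_group_def by blast
  interpret \<rho>: group_hom G "induced_group E X" "\<rho> X" using fin by (rule rho_group_hom)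
  interpret \<chi>: group_hom "induced_group E X" integer_group \<chi>
    by (intro group_hom.intro group_hom_axioms.intro group_induced_group group_integer_group \<chi>(1))
  have vals: "\<chi> (\<rho> X (A f)) = (if f = e then 2 else 0)" if f: "f \<in> E" for f
  proof (cases "f \<subseteq> X")
    case False
    then have "f \<noteq> e" using X(2) by blast
    then show ?thesis using rho_A_outside[OF f False fin] \<chi>.hom_one by simp
  next
    case True
    obtain p q where pq: "f = {p, q}" "0 < p" "p < q" "q \<le> n" using f by (rule edge_cases)
    have sub: "{p, q} \<subseteq> X" using True pq(1) by simp
    have "\<rho> X (A f) = graphic_gen ?m ?F (rank X p) (rank X q)"
      using restriction_hom_spec(3)[OF fin, of p q n E] sub pq by (simp add: edge_gen_pair)
    then have "\<chi> (\<rho> X (A f)) = (if rank X p = rank X i \<and> rank X q = rank X j then 2 else 0)"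
      using \<chi>(2)[OF rank_pair_bounds[OF sub pq(3) fin]] by simp
    moreover have "rank X p = rank X i \<longleftrightarrow> p = i" "rank X q = rank X j \<longleftrightarrow> q = j"
      using inj_on_rank[of X] sub mem by (auto simp: inj_on_eq_iff)
    moreover have "f = e \<longleftrightarrow> p = i \<and> q = j"
      using pq(1,3) ij(1,3) by (auto simp: doubleton_eq_iff)
    ultimately show ?thesis by simp
  qed
  have closed: "(\<lambda>f. \<rho> X (A f)) \<in> E \<rightarrow> carrier (induced_group E X)"
    using A_closed by auto
  have "\<chi> (\<rho> X (word_eval G A w)) = \<chi> (word_eval (induced_group E X) (\<lambda>f. \<rho> X (A f)) w)"
    using \<rho>.hom_word_eval[OF A_image_closed w] by simp
  also have "\<dots> = word_eval integer_group (\<lambda>f. \<chi> (\<rho> X (A f))) w"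
    by (rule \<chi>.hom_word_eval[OF closed w])
  also have "\<dots> = word_eval integer_group (\<lambda>f. if f = e then 2 else 0) w"
    by (rule word_eval_cong[OF w vals])
  also have "\<dots> = 2 * exponent_sum e w" by (rule word_eval_integer_group)
  finally show ?thesis using ker[OF X(1)] \<chi>.hom_one by simp
qed

text \<open>In the abelian quotient by \<open>N\<close> a word is determined by its exponent sums.\<close>

lemma word_eval_in_N:
  assumes w: "w \<in> words E" and zero: "\<And>e. e \<in> E \<Longrightarrow> exponent_sum e w = 0"
  shows "word_eval G A w \<in> N"
proof -
  interpret N: normal N G by (rule N_normal)
  let ?Q = "G Mod N" and ?q = "\<lambda>x. N #>\<^bsub>G\<^esub> x"
  interpret q: group_hom G ?Q ?q
    by (intro group_hom.intro group_hom_axioms.intro G.is_group N.factorgroup_is_group N.r_coset_hom_Mod)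
  have gens: "A ` E \<subseteq> carrier G" using A_closed by blast
  have "carrier ?Q = generate ?Q (?q ` A ` E)"
    using q.generate_img[OF gens] carrier_G by (simp add: carrier_FactGroup)
  moreover have "?q ` A ` E \<subseteq> carrier ?Q" using gens q.hom_closed by blast
  moreover have "x \<otimes>\<^bsub>?Q\<^esub> y = y \<otimes>\<^bsub>?Q\<^esub> x" if xy: "x \<in> ?q ` A ` E" "y \<in> ?q ` A ` E" for x y
  proof -
    obtain e f where ef: "x = ?q (A e)" "y = ?q (A f)" "e \<in> E" "f \<in> E" using xy by blast
    have c: "A e \<in> carrier G" "A f \<in> carrier G" using ef A_closed by blast+
    \<comment> \<open>The generators commute modulo \<open>N\<close>.\<close>
    let ?k = "A e \<otimes>\<^bsub>G\<^esub> A f \<otimes>\<^bsub>G\<^esub> inv\<^bsub>G\<^esub> A e \<otimes>\<^bsub>G\<^esub> inv\<^bsub>G\<^esub> A f"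
    have k: "?k \<in> carrier G" using c by simp
    have "?q ?k = \<one>\<^bsub>?Q\<^esub>"
      using N.rcos_const[OF G.is_group A_commutator_in_N[OF ef(3,4)]] by simp
    moreover have "A e \<otimes>\<^bsub>G\<^esub> A f = ?k \<otimes>\<^bsub>G\<^esub> (A f \<otimes>\<^bsub>G\<^esub> A e)" using c by (simp add: G.m_assoc)
    ultimately have "?q (A e \<otimes>\<^bsub>G\<^esub> A f) = \<one>\<^bsub>?Q\<^esub> \<otimes>\<^bsub>?Q\<^esub> ?q (A f \<otimes>\<^bsub>G\<^esub> A e)"
      using q.hom_mult[OF k G.m_closed[OF c(2,1)]] by metis
    then have "?q (A e \<otimes>\<^bsub>G\<^esub> A f) = ?q (A f \<otimes>\<^bsub>G\<^esub> A e)"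
      using q.H.l_one[OF q.hom_closed[OF G.m_closed[OF c(2,1)]]] by metis
    then show ?thesis
      unfolding ef(1,2) q.hom_mult[OF c] q.hom_mult[OF c(2,1)] .
  qed
  ultimately interpret Q: comm_group ?Q by (rule q.H.comm_group_if_generators_commute)
  have qA: "(\<lambda>e. ?q (A e)) \<in> E \<rightarrow> carrier ?Q" using A_closed q.hom_closed by blast
  have "?q (word_eval G A w) = word_eval ?Q (\<lambda>e. ?q (A e)) w"
    by (rule q.hom_word_eval[OF A_image_closed w])
  also have "\<dots> = (\<Otimes>\<^bsub>?Q\<^esub>e\<in>E. ?q (A e) [^]\<^bsub>?Q\<^esub> exponent_sum e w)"
    by (rule Q.word_eval_eq_finprod[OF finite_E qA w])
  also have "\<dots> = (\<Otimes>\<^bsub>?Q\<^esub>e\<in>E. \<one>\<^bsub>?Q\<^esub>)"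
    by (rule Q.finprod_cong) (simp_all add: zero simp_implies_def del: one_FactGroup)
  also have "\<dots> = \<one>\<^bsub>?Q\<^esub>" by (rule Q.finprod_one)
  also have "\<dots> = N" by simp
  finally have "?q (word_eval G A w) = N" .
  moreover have "word_eval G A w \<in> ?q (word_eval G A w)"
    by (rule G.rcos_self[OF G.word_eval_closed[OF A_image_closed w] N.is_subgroup])
  ultimately show ?thesis by simp
qed

text \<open>\<open>D T\<close> is contained in the group generated by \<open>A {i, j}\<close> and \<open>A {j, k}\<close>, and these go
  to \<open>\<sigma>\<^sub>1\<^sup>2\<close> and \<open>\<sigma>\<^sub>2\<^sup>2\<close>.  As these two act as free
  generators, a word in the two edges that is killed by \<open>\<rho> T\<close> is trivial in every group.\<close>

lemma rho_injective_on_D: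
  assumes T: "T \<in> triangles" and d: "d \<in> D T" and one: "\<rho> T d = \<one>\<^bsub>induced_group E T\<^esub>"
  shows "d = \<one>\<^bsub>G\<^esub>"
proof -
  obtain i j k where ijk: "T = {i, j, k}" "0 < i" "i < j" "j < k" "k \<le> n"
    "{i, j} \<in> E" "{i, k} \<in> E" "{j, k} \<in> E"
    using T by (rule triangle_cases)
  have fin: "finite T" using ijk(1) by simp
  let ?F = "induced_graph E T"
  have "{x \<in> T. x \<le> i} = {i}" "{x \<in> T. x \<le> j} = {i, j}" "{x \<in> T. x \<le> k} = {i, j, k}" "card T = 3"
    using ijk(1,3,4) by auto
  then have r: "rank T i = 1" "rank T j = 2" "rank T k = 3" and card: "card T = 3"
    using ijk(3,4) by (simp_all add: rank_def)
  have F: "{1, 2} \<in> ?F" "{1, 3} \<in> ?F" "{2, 3} \<in> ?F"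
    using induced_graph_pair[of i T j E] induced_graph_pair[of i T k E] induced_graph_pair[of j T k E]
      ijk r by simp_all
  obtain h where h: "h \<in> hom (induced_group E T) (BijGroup (UNIV :: (int \<times> int) set))"
    "h (graphic_gen 3 ?F 1 2) = shear_gen 2 True" "h (graphic_gen 3 ?F 2 3) = shear_gen 2 False"
    using three_strand_shear_hom[OF F] unfolding induced_group_def card by blast
  interpret \<rho>: group_hom G "induced_group E T" "\<rho> T" using fin by (rule rho_group_hom)
  interpret h: group_hom "induced_group E T" "BijGroup (UNIV :: (int \<times> int) set)" h
    by (intro group_hom.intro group_hom_axioms.intro group_induced_group group_BijGroup h(1))
  \<comment> \<open>After the deletion of the other strands, \<open>i, j, k\<close> become the strands \<open>1, 2, 3\<close>.\<close>
  define \<phi> where "\<phi> b = (if b then A {i, j} else A {j, k})" for b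
  have \<phi>: "\<phi> \<in> UNIV \<rightarrow> carrier G" using ijk(6,8) A_closed by (simp add: \<phi>_def)
  have "{i, j} \<in> edges_in T" "{j, k} \<in> edges_in T" "{i, j} \<noteq> {j, k}"
    using ijk(1,3,4) by (auto simp: edges_in_def doubleton_eq_iff)
  then have "d \<in> generate G {A {i, j}, A {j, k}}" using D_two_edges_generate[OF T] d by blast
  also have "{A {i, j}, A {j, k}} = \<phi> ` UNIV" by (auto simp: \<phi>_def UNIV_bool)
  finally obtain w where w: "w \<in> words UNIV" "d = word_eval G \<phi> w"
    unfolding G.generate_eq_word_eval[OF \<phi>] by blast
  have \<rho>\<phi>: "(\<lambda>b. \<rho> T (\<phi> b)) \<in> UNIV \<rightarrow> carrier (induced_group E T)"
    by (intro Pi_I \<rho>.hom_closed) (use \<phi> in auto)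
  have "{i, j} \<subseteq> T" "{j, k} \<subseteq> T" using ijk(1) by auto
  then have "\<rho> T (A {i, j}) = graphic_gen 3 ?F 1 2" "\<rho> T (A {j, k}) = graphic_gen 3 ?F 2 3"
    using restriction_hom_spec(3)[OF fin, of i j n E] restriction_hom_spec(3)[OF fin, of j k n E]
      ijk(2-5) r card by (simp_all add: edge_gen_pair)
  then have h\<rho>: "h (\<rho> T (\<phi> b)) = shear_gen 2 b" for b
    using h(2,3) by (cases b) (simp_all add: \<phi>_def)
  have "shear_word w = word_eval (BijGroup UNIV) (\<lambda>b. h (\<rho> T (\<phi> b))) w"
    by (simp add: h\<rho> word_eval_shear)
  also have "\<dots> = h (word_eval (induced_group E T) (\<lambda>b. \<rho> T (\<phi> b)) w)"
    by (rule h.hom_word_eval[OF \<rho>\<phi> w(1), symmetric])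
  also have "\<dots> = h (\<rho> T d)"
    unfolding w(2) \<rho>.hom_word_eval[OF \<phi> w(1)] ..
  also have "\<dots> = id" unfolding one h.hom_one one_BijGroup_UNIV ..
  finally show ?thesis unfolding w(2) by (rule G.word_eval_eq_one_if_shear_word_id[OF \<phi>])
qed

text \<open>Two edges of \<open>T'\<close> that are not edges of \<open>T\<close> generate a group containing \<open>D T'\<close>.\<close>

lemma rho_trivial_on_other_D:
  assumes "T \<in> triangles" "T' \<in> triangles" "T \<noteq> T'" "d \<in> D T'"
  shows "\<rho> T d = \<one>\<^bsub>induced_group E T\<^esub>"
proof -
  have "card T' = 3" "card T = 3" "T' \<noteq> T" using assms by (auto simp: triangles_def)
  then obtain e f where ef: "e \<in> edges_in T'" "f \<in> edges_in T'" "e \<noteq> f" "\<not> e \<subseteq> T" "\<not> f \<subseteq> T"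
    by (rule two_edges_outside)
  have E: "e \<in> E" "f \<in> E" using assms(2) ef(1,2) edges_in_triangle by blast+
  have fin: "finite T" using assms(1) triangle_in_max_cliques max_clique_finite by blast
  interpret \<rho>: group_hom G "induced_group E T" "\<rho> T" using fin by (rule rho_group_hom)
  show ?thesis
  proof (rule \<rho>.hom_one_on_generate)
    show "{A e, A f} \<subseteq> carrier G" using E A_closed by blast
    show "d \<in> generate G {A e, A f}" using D_two_edges_generate[OF assms(2) ef(1-3)] assms(4) by blast
    show "\<rho> T x = \<one>\<^bsub>induced_group E T\<^esub>" if "x \<in> {A e, A f}" for x
      using that rho_A_outside E ef(4,5) fin by blast
  qed
qed

text \<open>Peel off one triangle after the other: in a product of elements of different \<open>D T\<close>, the
  restriction to \<open>T\<close> only sees the factor in \<open>D T\<close>.\<close>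

lemma generate_D_kernel_trivial:
  assumes "F \<subseteq> triangles" "x \<in> generate G (\<Union>T\<in>F. D T)"
    and "\<And>T. T \<in> F \<Longrightarrow> \<rho> T x = \<one>\<^bsub>induced_group E T\<^esub>"
  shows "x = \<one>\<^bsub>G\<^esub>"
proof -
  have "finite F" using assms(1) finite_triangles finite_subset by blast
  then show ?thesis using assms
  proof (induction F)
    case empty
    then show ?case using G.generate_empty by simp
  next
    case (insert T F)
    let ?U = "\<Union>T\<in>F. D T"
    have T: "T \<in> triangles" and F: "F \<subseteq> triangles" using insert.prems(1) by blast+
    have U: "?U \<subseteq> carrier G" using F D_closed by blast
    have comm: "d \<otimes>\<^bsub>G\<^esub> u = u \<otimes>\<^bsub>G\<^esub> d" if d: "d \<in> D T" and u: "u \<in> ?U" for d u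
    proof -
      obtain T' where "T' \<in> F" "u \<in> D T'" using u by blast
      then show ?thesis using D_commute[OF T _ _ d] insert.hyps(2) F by blast
    qed
    have "x \<in> generate G (D T \<union> ?U)" using insert.prems(2) by simp
    from G.generate_Un_commuting[OF D_subgroup[OF T] U comm this]
    obtain d u where du: "d \<in> D T" "u \<in> generate G ?U" "x = d \<otimes>\<^bsub>G\<^esub> u" by blast
    have c: "d \<in> carrier G" "u \<in> carrier G"
      using du D_closed[OF T] G.generate_in_carrier[OF U] by blast+
    have fin: "finite T" using T triangle_in_max_cliques max_clique_finite by blast
    interpret \<rho>: group_hom G "induced_group E T" "\<rho> T" using fin by (rule rho_group_hom)
    have "\<rho> T u = \<one>\<^bsub>induced_group E T\<^esub>"
    proof (rule \<rho>.hom_one_on_generate[OF U _ du(2)])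
      fix y assume "y \<in> ?U"
      then obtain T' where "T' \<in> F" "y \<in> D T'" by blast
      then show "\<rho> T y = \<one>\<^bsub>induced_group E T\<^esub>"
        using rho_trivial_on_other_D[OF T, of T' y] insert.hyps(2) F by blast
    qed
    then have "\<rho> T d = \<rho> T x" unfolding du(3) using c by simp
    then have "\<rho> T d = \<one>\<^bsub>induced_group E T\<^esub>" using insert.prems(3) by simp
    then have "d = \<one>\<^bsub>G\<^esub>" by (rule rho_injective_on_D[OF T du(1)])
    then have xu: "x = u" using du(3) c(2) by simp
    show ?case
      by (rule insert.IH[OF F]) (use du(2) xu insert.prems(3) in auto)
  qed
qed

lemma restriction_kernel_trivial:
  assumes "x \<in> carrier G" and ker: "\<And>X. X \<in> max_cliques n E \<Longrightarrow> \<rho> X x = \<one>\<^bsub>induced_group E X\<^esub>"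
  shows "x = \<one>\<^bsub>G\<^esub>"
proof -
  obtain w where w: "w \<in> words E" "x = word_eval G A w"
    using assms(1) carrier_G G.generate_eq_word_eval[OF A_image_closed] by blast
  have "x \<in> N"
    unfolding w(2)
    by (rule word_eval_in_N[OF w(1) exponent_sum_eq_zero[OF w(1) ker[unfolded w(2)]]])
  then show ?thesis
    unfolding N_def
    by (rule generate_D_kernel_trivial[OF subset_refl]) (rule ker[OF triangle_in_max_cliques])
qed

lemma restriction_prod_hom:
  "restriction_prod n E (max_cliques n E) \<in> hom G (product_group (max_cliques n E) (induced_group E))"
proof (rule homI)
  have hom: "\<rho> X \<in> hom G (induced_group E X)" if "X \<in> max_cliques n E" for X
    using restriction_hom_spec(1)[OF max_clique_finite[OF that]] .
  fix x assume x: "x \<in> carrier G"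
  show "restriction_prod n E (max_cliques n E) x
      \<in> carrier (product_group (max_cliques n E) (induced_group E))"
    using x hom by (auto simp: restriction_prod_def hom_def)
  fix y assume y: "y \<in> carrier G"
  show "restriction_prod n E (max_cliques n E) (x \<otimes>\<^bsub>G\<^esub> y)
      = restriction_prod n E (max_cliques n E) x
        \<otimes>\<^bsub>product_group (max_cliques n E) (induced_group E)\<^esub> restriction_prod n E (max_cliques n E) y"
    unfolding restriction_prod_def mult_product_group
    by (rule restrict_ext) (simp add: hom_mult[OF hom] x y)
qed

end

theorem theorem5p5:
  fixes n :: nat and E :: "nat set set"
  assumes graph: "E \<subseteq> [{1..n}]\<^bsup>2\<^esup>"
    and K4_free: "\<not> (\<exists>X. X \<subseteq> {1..n} \<and> card X = 4 \<and> clique X E)"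
  shows "restriction_prod n E (max_cliques n E)
    \<in> mon (graphic_pure_braid_group n E) (product_group (max_cliques n E) (induced_group E))"
proof -
  interpret k4_free_graph n E by (rule k4_free_graph.intro[OF graph K4_free])
  have P: "group (product_group (max_cliques n E) (induced_group E))"
    by (rule product_group) (rule group_induced_group)
  show ?thesis
  proof (subst mon_iff_hom_one[OF G.is_group P], intro conjI allI impI)
    show "restriction_prod n E (max_cliques n E) \<in> hom G (product_group (max_cliques n E) (induced_group E))"
      by (rule restriction_prod_hom)
    fix x
    assume x: "x \<in> carrier G \<and> restriction_prod n E (max_cliques n E) x
        = \<one>\<^bsub>product_group (max_cliques n E) (induced_group E)\<^esub>"
    show "x = \<one>\<^bsub>G\<^esub>"
    proof (rule restriction_kernel_trivial)
      show "x \<in> carrier G" using x by simp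
      fix X assume X: "X \<in> max_cliques n E"
      have "(\<lambda>X\<in>max_cliques n E. \<rho> X x) X = (\<lambda>X\<in>max_cliques n E. \<one>\<^bsub>induced_group E X\<^esub>) X"
        using x by (simp add: restriction_prod_def)
      then show "\<rho> X x = \<one>\<^bsub>induced_group E X\<^esub>" using X by simp
    qed
  qed
qed

end
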